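(* Let $0\le\gamma\le\alpha\le1$ and fix $n\in\mathbb{N}$. Let $(\hat T_n(m))_{m\in\mathbb{N}_0}$ be the semi-planar $(\alpha,\gamma)$-chain on $\hat{\mathbb{T}}_{[n]}$ and let $\hat T_n$ be the $n$th step of the semi-planar $(\alpha,\gamma)$-growth process. Then $\hat T_n(m)\to\hat T_n$ in distribution as $m\to\infty$. Furthermore, the projection $\hat\pi(\hat T_n)$ of $\hat T_n$ to the space $\mathbb{T}_{[n]}$ of non-planar trees has the same distribution as the $n$th step of the $(\alpha,\gamma)$-growth process.
   Context: Trees. $[n]=\{1,\dots,n\}$. For a finite set $A\subset\mathbb{N}$, $\mathbb{T}_A$ is the set of rooted non-planar trees whose leaves are labelled bijectively by $A$, with one additional vertex of degree 1 called the root (not a leaf), and all of whose other vertices, called branch points, have degree at least 3 (trees are identified up to label- and root-preserving isomorphism). Parents and children are taken with respect to the root. An edge is external if it ends in a leaf and internal otherwise. $\mathrm{ins}(t)$ is the set of all edges and branch points of $t$. Inserting a leaf $j$ at a branch point $v$: add leaf $j$ as a new child of $v$. Inserting $j$ at an edge: subdivide the edge by a new branch point and attach leaf $j$ to it. Deleting a leaf: remove it and its edge; if its parent had only 2 children, that parent is suppressed (its two remaining edges are merged). For a leaf $i$, let $v_1,v_2,\dots$ be the successive branch points on the path from $i$ to the root ($v_1$ the parent of $i$). The $r$th spinal bush on the ancestral line from $i$ is the collection of subtrees of $v_r$ not containing $i$. $(\alpha,\gamma)$-growth process. $T_1$ is the unique element of $\mathbb{T}_{[1]}$; given $T_n=s$,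 $T_{n+1}$ is obtained by inserting leaf $n+1$ at $x\in\mathrm{ins}(s)$ with probability $w_x/(n-\alpha)$, where $w_x=1-\alpha$ if $x$ is an external edge, $w_x=\gamma$ if $x$ is an internal edge, $w_x=(c_x-1)\alpha-\gamma$ if $x$ is a branch point with $c_x$ children. ($T_2$ is the unique element of $\mathbb{T}_{[2]}$, also if $\alpha=1$.) Semi-planar trees. $\hat{\mathbb{T}}_A$ is the set of pairs $\hat t=(t,(\sigma_v)_v)$ with $t\in\mathbb{T}_A$ and, for each branch point $v$ of $t$ with $c_v$ children, $\sigma_v$ a permutation of $[c_v-2]$ (trivial if $c_v=2$). Meaning: enumerate the subtrees of $v$ by increasing least leaf label; the first and second are the two leftmost subtrees of $v$ (with no order distinguished between these two) and, for $3\le l\le c_v$, the $l$th subtree is the $\sigma_v(l-2)$-th from the left among the remaining $c_v-2$ subtrees. $\hat\pi(t,\sigma)=t$. Semi-planar insertion. Inserting leaf $j$ (larger than all labels present) at an edge (location $l=0$) creates a new branch point with two children. Inserting $j$ at a branch point $v$ with $c$ children in location $l\in[c-1]$: leaf $j$ becomes the $l$th from the left among the $c-1$ subtrees of $v$ other than the two leftmost ones, the relative order of the other subtrees being unchanged. Semi-planar $(\alpha,\gamma)$-growth process. $\hat T_1$ is the unique element of $\hat{\mathbb{T}}_{[1]}$; given $\hat T_n$, leaf $n+1$ is inserted at $x$ in location $l$ with probability $w_{x,l}/(n-\alpha)$, where $w_{x,0}=1-\alpha$ for external edges $x$, $w_{x,0}=\gamma$ for internal edges $x$, and for a branch point $x$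 with $c_x$ children $w_{x,l}=\alpha$ for $l\in[c_x-2]$ and $w_{x,c_x-1}=\alpha-\gamma$ (the step to $n=2$ is the unique possible one, also if $\alpha=1$). Semi-planar $(\alpha,\gamma)$-chain on $\hat{\mathbb{T}}_{[n]}$. For $n=1$ it is constant. For $n\ge2$ it is the Markov chain with the following transition from $\hat t$. Select $i$ uniformly from $[n]$. Let $v$ be the parent of leaf $i$, $c_v$ its number of children, $l_i$ the rank of $i$ among the least leaf labels of the $c_v$ subtrees of $v$. Let $a$ be the least leaf label in the first spinal bush on the ancestral line from $i$. Let $b$ be: if $c_v=2$, the least leaf label in the second spinal bush on the ancestral line from $i$ ($b=0$ if there is none); if $c_v>2$ and $l_i\le2$, the least leaf label in the first subtree of $v$ not containing $a$ to the right of leaf $i$ (i.e. the third subtree of $v$ from the left); if $c_v>2$ and $l_i>2$, the least leaf label in the first subtree of $v$ not containing $a$ to the left of leaf $i$. (For these purposes, order the two leftmost subtrees by least label.) Put $\tilde\imath=\max\{i,a,b\}$. Swap the labels $i$ and $\tilde\imath$, leaving all positions (the left-to-right arrangement at every branch point) unchanged; delete the leaf now labelled $\tilde\imath$, keeping the relative left-to-right order of all remaining subtrees; relabel $\tilde\imath+1,\dots,n$ by $\tilde\imath,\dots,n-1$ increasingly. The result is again a semi-planar tree (element of $\hat{\mathbb{T}}_{[n-1]}$). Finally insert leaf $n$ by the step of the semi-planar $(\alpha,\gamma)$-growth process from $\hat{\mathbb{T}}_{[n-1]}$ to $\hat{\mathbb{T}}_{[n]}$. *)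

theory Defs
  imports "HOL-Probability.Probability" "HOL-Combinatorics.Combinatorics" "HOL-Library.FSet"
begin

section \<open>Non-planar trees\<close>

text \<open>
  A tree is given by what hangs below its root: the root itself and the edge leaving it are
  implicit. Siblings form a finite set, so that equality of trees with distinct leaf labels is
  isomorphism preserving root and leaf labels. As the labels are distinct, a vertex other than the
  root is identified by the subtree consisting of it and its descendants, and every such vertex has
  exactly one edge above it.
\<close>

datatype (leaf_labels: 'a) ltree =
    is_leaf: Leaf 'a
  | Node (children: "'a ltree fset")

inductive is_tree :: "nat ltree \<Rightarrow> bool" where
  "is_tree (Leaf i)"
| "\<lbrakk>2 \<le> fcard F; \<And>t. t |\<in>| F \<Longrightarrow> is_tree t; disjoint_family_on leaf_labels (fset F)\<rbrakk>
    \<Longrightarrow> is_tree (Node F)"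

definition labelled_trees :: "nat set \<Rightarrow> nat ltree set" where
  "labelled_trees A = {t. is_tree t \<and> leaf_labels t = A}"

primrec subtrees :: "'a ltree \<Rightarrow> 'a ltree set" where
  "subtrees (Leaf i) = {Leaf i}"
| "subtrees (Node F) = insert (Node F) (\<Union>(fset (subtrees |`| F)))"

definition branch_points :: "'a ltree \<Rightarrow> 'a ltree set" where
  "branch_points t = {v \<in> subtrees t. \<not> is_leaf v}"

text \<open>\<open>Edge v\<close> is the edge from the parent of \<open>v\<close> to \<open>v\<close>; it is external iff \<open>v\<close> is a leaf.\<close>

datatype site = Edge "nat ltree" | Branch "nat ltree"

definition ins :: "nat ltree \<Rightarrow> site set" where
  "ins t = Edge ` subtrees t \<union> Branch ` branch_points t"

primrec modify_at :: "'a ltree \<Rightarrow> ('a ltree \<Rightarrow> 'a ltree) \<Rightarrow> 'a ltree \<Rightarrow> 'a ltree" where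
  "modify_at v f (Leaf i) = (if Leaf i = v then f (Leaf i) else Leaf i)"
| "modify_at v f (Node F) = (if Node F = v then f (Node F) else Node (modify_at v f |`| F))"

primrec insert_leaf :: "nat \<Rightarrow> site \<Rightarrow> nat ltree \<Rightarrow> nat ltree" where
  "insert_leaf j (Edge v) t = modify_at v (\<lambda>s. Node {|s, Leaf j|}) t"
| "insert_leaf j (Branch v) t = modify_at v (\<lambda>s. Node (finsert (Leaf j) (children s))) t"

primrec weight :: "real \<Rightarrow> real \<Rightarrow> site \<Rightarrow> real" where
  "weight \<alpha> \<gamma> (Edge v) = (if is_leaf v then 1 - \<alpha> else \<gamma>)"
| "weight \<alpha> \<gamma> (Branch v) = (real (fcard (children v)) - 1) * \<alpha> - \<gamma>"

text \<open>
  Transition of the growth process from \<open>labelled_trees {1..n}\<close> to \<open>labelled_trees {1..n + 1}\<close>. The weights of the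
  sites of such a tree sum to \<open>n - \<alpha>\<close>. The case \<open>n = 1\<close> is separate because \<open>n - \<alpha> = 0\<close> if \<open>\<alpha> = 1\<close>.
\<close>

definition growth_step :: "real \<Rightarrow> real \<Rightarrow> nat \<Rightarrow> nat ltree \<Rightarrow> nat ltree pmf" where
  "growth_step \<alpha> \<gamma> n t =
    (if n = 1 then return_pmf (the_elem (labelled_trees {1..2}))
     else map_pmf (\<lambda>x. insert_leaf (n + 1) x t)
       (embed_pmf (\<lambda>x. if x \<in> ins t then weight \<alpha> \<gamma> x / (real n - \<alpha>) else 0)))"


section \<open>Semi-planar trees\<close>

type_synonym semiplanar = "nat ltree \<times> (nat ltree \<Rightarrow> nat \<Rightarrow> nat)"

definition semiplanar_trees :: "nat set \<Rightarrow> semiplanar set" where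
  "semiplanar_trees A =
    (SIGMA t : labelled_trees A. \<Pi>\<^sub>E v \<in> branch_points t. {p. p permutes {1..fcard (children v) - 2}})"

definition proj :: "semiplanar \<Rightarrow> nat ltree" where
  "proj = fst"

text \<open>
  Left-to-right drawings of semi-planar trees. In a drawing the subtrees of a branch point are
  listed from left to right.
\<close>

datatype (plabels: 'a) ptree = is_pleaf: PLeaf 'a | PNode (psubs: "'a ptree list")

definition least_label :: "nat ptree \<Rightarrow> nat" where
  "least_label p = Min (plabels p)"

text \<open>
  \<open>layout \<sigma> xs\<close> puts \<open>xs\<close>, the subtrees in increasing order of least labels, into left-to-right order:
  the two first come first, and for \<open>3 \<le> l\<close> the \<open>l\<close>th one (list index \<open>l - 1\<close>) gets to the \<open>\<sigma> (l - 2)\<close>th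
  place after these two (list index \<open>\<sigma> (l - 2) + 1\<close>).
\<close>

definition layout :: "(nat \<Rightarrow> nat) \<Rightarrow> 'a list \<Rightarrow> 'a list" where
  "layout \<sigma> xs = map (\<lambda>k. xs ! (if k < 2 then k else inv \<sigma> (k - 1) + 1)) [0..<length xs]"

lemma layout_nth:
  assumes "\<sigma> permutes {1..length xs - 2}" "3 \<le> l" "l \<le> length xs"
  shows "layout \<sigma> xs ! (\<sigma> (l - 2) + 1) = xs ! (l - 1)"
proof -
  have "\<sigma> (l - 2) \<in> {1..length xs - 2}"
    using assms by (subst permutes_in_image[OF assms(1)]) auto
  moreover have "inv \<sigma> (\<sigma> (l - 2)) = l - 2"
    using permutes_inverses(2)[OF assms(1)] .
  moreover have "Suc (l - 2) = l - 1"
    using assms(2) by simp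
  ultimately show ?thesis
    using assms by (auto simp: layout_def)
qed

primrec draw_with :: "(nat ltree \<Rightarrow> nat \<Rightarrow> nat) \<Rightarrow> nat ltree \<Rightarrow> nat ptree" where
  "draw_with \<sigma> (Leaf i) = PLeaf i"
| "draw_with \<sigma> (Node F) = PNode (layout (\<sigma> (Node F))
      (sorted_key_list_of_set least_label (fset (draw_with \<sigma> |`| F))))"

definition draw :: "semiplanar \<Rightarrow> nat ptree" where
  "draw = (\<lambda>(t, \<sigma>). draw_with \<sigma> t)"

text \<open>
  Conversely, a drawing in which the two leftmost subtrees of every branch point are those with the
  two smallest least labels, in either order, determines a semi-planar tree.
\<close>

primrec order_leftmost :: "nat ptree \<Rightarrow> nat ptree" where
  "order_leftmost (PLeaf i) = PLeaf i"
| "order_leftmost (PNode ts) = PNode (let us = map order_leftmost ts in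
      sort_key least_label (take 2 us) @ drop 2 us)"

definition read_off :: "nat ptree \<Rightarrow> semiplanar" where
  "read_off p = the_inv_into (semiplanar_trees (plabels p)) draw (order_leftmost p)"

primrec shape :: "'a ptree \<Rightarrow> 'a ltree" where
  "shape (PLeaf i) = Leaf i"
| "shape (PNode ts) = Node (fset_of_list (map shape ts))"


section \<open>Semi-planar growth\<close>

text \<open>The pairs of an edge and location \<open>0\<close>, or of a branch point and a location in \<open>[c - 1]\<close>.\<close>

definition locations :: "nat ltree \<Rightarrow> (site \<times> nat) set" where
  "locations t = (\<lambda>v. (Edge v, 0)) ` subtrees t \<union>
    {(Branch v, l) | v l. v \<in> branch_points t \<and> l \<in> {1..fcard (children v) - 1}}"

primrec pmodify_at :: "'a ltree \<Rightarrow> ('a ptree \<Rightarrow> 'a ptree) \<Rightarrow> 'a ptree \<Rightarrow> 'a ptree" where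
  "pmodify_at v f (PLeaf i) = (if Leaf i = v then f (PLeaf i) else PLeaf i)"
| "pmodify_at v f (PNode ts) =
    (if shape (PNode ts) = v then f (PNode ts) else PNode (map (pmodify_at v f) ts))"

primrec pinsert :: "nat \<Rightarrow> site \<Rightarrow> nat \<Rightarrow> nat ptree \<Rightarrow> nat ptree" where
  "pinsert j (Edge v) l p = pmodify_at v (\<lambda>s. PNode [s, PLeaf j]) p"
| "pinsert j (Branch v) l p = pmodify_at v
    (\<lambda>s. PNode (take (l + 1) (psubs s) @ [PLeaf j] @ drop (l + 1) (psubs s))) p"

definition semiplanar_insert :: "nat \<Rightarrow> site \<Rightarrow> nat \<Rightarrow> semiplanar \<Rightarrow> semiplanar" where
  "semiplanar_insert j x l s = read_off (pinsert j x l (draw s))"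

fun semiplanar_weight :: "real \<Rightarrow> real \<Rightarrow> site \<Rightarrow> nat \<Rightarrow> real" where
  "semiplanar_weight \<alpha> \<gamma> (Edge v) l = (if is_leaf v then 1 - \<alpha> else \<gamma>)"
| "semiplanar_weight \<alpha> \<gamma> (Branch v) l = (if l = fcard (children v) - 1 then \<alpha> - \<gamma> else \<alpha>)"

definition semiplanar_growth_step ::
    "real \<Rightarrow> real \<Rightarrow> nat \<Rightarrow> semiplanar \<Rightarrow> semiplanar pmf" where
  "semiplanar_growth_step \<alpha> \<gamma> n s =
    (if n = 1 then return_pmf (the_elem (semiplanar_trees {1..2}))
     else map_pmf (\<lambda>(x, l). semiplanar_insert (n + 1) x l s)
       (embed_pmf (\<lambda>(x, l). if (x, l) \<in> locations (proj s)
          then semiplanar_weight \<alpha> \<gamma> x l / (real n - \<alpha>) else 0)))"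


section \<open>The semi-planar down-step\<close>

text \<open>The branch points on the path from leaf \<open>i\<close> to the root, starting with the parent of \<open>i\<close>.\<close>

primrec spine :: "'a \<Rightarrow> 'a ptree \<Rightarrow> 'a ptree list" where
  "spine i (PLeaf j) = []"
| "spine i (PNode ts) =
    concat (map (spine i) ts) @ (if i \<in> plabels (PNode ts) then [PNode ts] else [])"

definition spinal_bush :: "nat \<Rightarrow> 'a \<Rightarrow> 'a ptree \<Rightarrow> 'a ptree set" where
  "spinal_bush r i p = {s \<in> set (psubs (spine i p ! (r - 1))). i \<notin> plabels s}"

definition least_label_of_bush :: "nat ptree set \<Rightarrow> nat" where
  "least_label_of_bush B = Min (\<Union>(plabels ` B))"

definition a_label :: "nat \<Rightarrow> nat ptree \<Rightarrow> nat" where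
  "a_label i p = least_label_of_bush (spinal_bush 1 i p)"

text \<open>
  The first subtree not containing \<open>a\<close> in a given direction from leaf \<open>i\<close> is the head (to the right)
  or the last element (to the left) of the list of all such subtrees.
\<close>

definition b_label :: "nat \<Rightarrow> nat ptree \<Rightarrow> nat" where
  "b_label i p =
    (let ts = psubs (spine i p ! 0);
         rank = card {s \<in> set ts. least_label s \<le> i};
         lefts = takeWhile (\<lambda>s. s \<noteq> PLeaf i) ts;
         rights = tl (dropWhile (\<lambda>s. s \<noteq> PLeaf i) ts);
         without_a = filter (\<lambda>s. a_label i p \<notin> plabels s)
     in if length ts = 2 then
          (if 2 \<le> length (spine i p) then least_label_of_bush (spinal_bush 2 i p) else 0)
        else if rank \<le> 2 then least_label (hd (without_a rights))
        else least_label (last (without_a lefts)))"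

primrec delete_leaf :: "'a \<Rightarrow> 'a ptree \<Rightarrow> 'a ptree" where
  "delete_leaf k (PLeaf i) = PLeaf i"
| "delete_leaf k (PNode ts) =
    (case filter (\<lambda>s. s \<noteq> PLeaf k) (map (delete_leaf k) ts) of
       [s] \<Rightarrow> s
     | us \<Rightarrow> PNode us)"

definition down :: "nat \<Rightarrow> semiplanar \<Rightarrow> semiplanar" where
  "down i s =
    (let p = draw s;
         i' = Max {i, a_label i p, b_label i p}
     in read_off (map_ptree (\<lambda>k. if k > i' then k - 1 else k)
          (delete_leaf i' (map_ptree (Transposition.transpose i i') p))))"

definition chain_step :: "real \<Rightarrow> real \<Rightarrow> nat \<Rightarrow> semiplanar \<Rightarrow> semiplanar pmf" where
  "chain_step \<alpha> \<gamma> n s =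
    (if n = 1 then return_pmf s
     else bind_pmf (pmf_of_set {1..n}) (\<lambda>i. semiplanar_growth_step \<alpha> \<gamma> (n - 1) (down i s)))"


section \<open>Markov chains and convergence in distribution\<close>

text \<open>
  \<open>markov_process M k0 S K X\<close>: on the probability space \<open>M\<close>, the sequence \<open>X k\<close> for \<open>k \<ge> k0\<close> is a
  Markov chain with an arbitrary law of \<open>X k0\<close>, where \<open>X k\<close> takes values in \<open>S k\<close> and \<open>K k\<close> is the
  transition kernel from time \<open>k\<close> to \<open>k + 1\<close>. This definition is meant for countable \<open>S k\<close>.
\<close>

definition markov_process ::
    "'w measure \<Rightarrow> nat \<Rightarrow> (nat \<Rightarrow> 's set) \<Rightarrow> (nat \<Rightarrow> 's \<Rightarrow> 's pmf) \<Rightarrow> (nat \<Rightarrow> 'w \<Rightarrow> 's) \<Rightarrow> bool" where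
  "markov_process M k0 S K X \<longleftrightarrow>
    prob_space M \<and>
    (\<forall>k\<ge>k0. X k \<in> M \<rightarrow>\<^sub>M count_space (S k)) \<and>
    (\<forall>m\<ge>k0. \<forall>x y. \<P>(\<omega> in M. \<forall>k\<in>{k0..m}. X k \<omega> = x k) > 0 \<longrightarrow>
       \<P>(\<omega> in M. X (m + 1) \<omega> = y \<bar> \<forall>k\<in>{k0..m}. X k \<omega> = x k) = pmf (K m (x m)) y)"

text \<open>
  The semi-planar growth process, the growth process (both with time starting at \<open>1\<close>, where the
  state space is a singleton) and the semi-planar chain.
\<close>

definition semiplanar_growth_process ::
    "real \<Rightarrow> real \<Rightarrow> 'w measure \<Rightarrow> (nat \<Rightarrow> 'w \<Rightarrow> semiplanar) \<Rightarrow> bool" where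
  "semiplanar_growth_process \<alpha> \<gamma> M X \<longleftrightarrow>
    markov_process M 1 (\<lambda>k. semiplanar_trees {1..k}) (semiplanar_growth_step \<alpha> \<gamma>) X"

definition growth_process ::
    "real \<Rightarrow> real \<Rightarrow> 'w measure \<Rightarrow> (nat \<Rightarrow> 'w \<Rightarrow> nat ltree) \<Rightarrow> bool" where
  "growth_process \<alpha> \<gamma> M X \<longleftrightarrow>
    markov_process M 1 (\<lambda>k. labelled_trees {1..k}) (growth_step \<alpha> \<gamma>) X"

definition semiplanar_chain ::
    "real \<Rightarrow> real \<Rightarrow> nat \<Rightarrow> 'w measure \<Rightarrow> (nat \<Rightarrow> 'w \<Rightarrow> semiplanar) \<Rightarrow> bool" where
  "semiplanar_chain \<alpha> \<gamma> n M X \<longleftrightarrow>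
    markov_process M 0 (\<lambda>_. semiplanar_trees {1..n}) (\<lambda>_. chain_step \<alpha> \<gamma> n) X"

text \<open>
  Convergence in distribution for random variables with values in a discrete space, on which every
  function is continuous. The limit may live on a different probability space.
\<close>

definition converges_in_distribution ::
    "'v measure \<Rightarrow> (nat \<Rightarrow> 'v \<Rightarrow> 's) \<Rightarrow> 'w measure \<Rightarrow> ('w \<Rightarrow> 's) \<Rightarrow> bool" where
  "converges_in_distribution M X N Y \<longleftrightarrow>
    (\<forall>f :: 's \<Rightarrow> real. bounded (range f) \<longrightarrow>
       (\<lambda>m. \<integral>\<omega>. f (X m \<omega>) \<partial>M) \<longlonglongrightarrow> (\<integral>\<omega>. f (Y \<omega>) \<partial>N))"

end

theory Submission
  imports Defs
begin

text \<open>
  Fix a tree \<open>s\<close> with leaves \<open>1, \<dots>, n\<close> and a leaf \<open>i \<le> n\<close>, and let leaf \<open>n + 1\<close> be inserted by the growth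
  step. The locations from which the down-step for \<open>i\<close> kills leaf \<open>n + 1\<close> have total weight \<open>1\<close>,
  and killing it gives back \<open>s\<close>. The other locations, of total weight \<open>n - 1 - \<alpha>\<close>, correspond weight
  by weight to the locations of the down-stepped tree \<open>down i s\<close>. Hence, with \<open>G\<close> the growth step,
  \<open>G\<^sub>n\<close> followed by \<open>down i\<close> is the mixture of the point mass at \<open>s\<close> and of \<open>down i\<close> followed by
  \<open>G\<^sub>n\<^sub>-\<^sub>1\<close> with weights \<open>1/(n - \<alpha>)\<close> and \<open>(n - 1 - \<alpha>)/(n - \<alpha>)\<close>, while \<open>down (n + 1)\<close> undoes \<open>G\<^sub>n\<close>.

  Averaging over \<open>i\<close> and inducting on \<open>n\<close>, the down-step with uniform \<open>i\<close> maps the law of the \<open>n\<close>th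
  growth step to that of step \<open>n - 1\<close>, so that the former is stationary for the chain. The same
  identity lifts supports: whatever grows out of \<open>down i s\<close> is the image under \<open>down i\<close> of something
  that grows out of \<open>s\<close>. Therefore the chain reaches every possible value of the growth process in
  exactly \<open>n - 2\<close> steps from any starting state, and converges by Doeblin's theorem.
\<close>

text \<open>The total weight 1 arises as follows. The edge above leaf \<open>i\<close>, of weight 1
  - \<alpha>, always kills the new leaf. If \<open>i\<close> has one sibling, so do the edge above
  its parent (\<gamma>) and the only location at the parent (\<alpha> - \<gamma>). If it has more,
  so does one location of weight \<alpha> at the parent: just right of the two leftmost subtrees if
  \<open>i\<close> is one of these, just left of \<open>i\<close> otherwise. The label
  \<open>b\<close> is tuned to this. The obstacle to an induction over subtrees is that a subtree
  containing \<open>i\<close> need not determine the killed label: for a leaf with one sibling, the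
  second bush may lie outside. So the induction runs over subtrees that are \<open>deep\<close>,
  with a test function carrying the rest of the tree, and a leaf with one sibling is treated one
  level up. All this happens on drawings whose two leftmost subtrees may stand in either order,
  since deletion and relabelling can disturb this order. Some weights can vanish: for \<alpha> = 0,
  say, growth never creates a branch point with three children. So the chain need not be
  irreducible, and convergence rests on one state that is reached from everywhere.\<close>

section \<open>Finite Markov chains\<close>

text \<open>\<open>markov_process\<close> speaks only of conditioning on whole histories of positive
  probability, so the recursion for the marginal laws goes through a sum over the finitely many
  histories up to time \<open>m\<close>.\<close>

lemma markov_process_law:
  assumes M: "markov_process M k0 S K X" and fin: "\<And>k. finite (S k)" and m: "k0 \<le> m"
  shows "\<P>(\<omega> in M. X (Suc m) \<omega> = y) = (\<Sum>x\<in>S m. \<P>(\<omega> in M. X m \<omega> = x) * pmf (K m x) y)"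
proof -
  interpret prob_space M using M by (simp add: markov_process_def)
  have X: "X k \<in> M \<rightarrow>\<^sub>M count_space (S k)" if "k0 \<le> k" for k
    using M that by (simp add: markov_process_def)
  have XS: "X k \<omega> \<in> S k" if "k0 \<le> k" "\<omega> \<in> space M" for k \<omega>
    using measurable_space[OF X[OF that(1)] that(2)] by simp
  have ev: "{\<omega> \<in> space M. X k \<omega> = x} \<in> events" if "k0 \<le> k" for k x
  proof (cases "x \<in> S k")
    case True
    have "X k -` {x} \<inter> space M \<in> events" using True by (intro measurable_sets[OF X[OF that]]) auto
    then show ?thesis by (simp add: vimage_def Int_def conj_commute)
  next
    case False
    then have "{\<omega> \<in> space M. X k \<omega> = x} = {}" using XS[OF that] by auto
    then show ?thesis by (metis sets.empty_sets)
  qed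
  let ?P = "\<Pi>\<^sub>E k\<in>{k0..m}. S k"
  have finP: "finite ?P" using fin by (intro finite_PiE) auto
  let ?A = "\<lambda>x \<omega>. \<forall>k\<in>{k0..m}. X k \<omega> = x k"
  have evA: "{\<omega> \<in> space M. ?A x \<omega>} \<in> events" for x :: "nat \<Rightarrow> _"
    using ev by (intro sets.sets_Collect_finite_All) auto
  have uniq: "\<exists>!x. x \<in> ?P \<and> ?A x \<omega>" if "\<omega> \<in> space M" for \<omega>
  proof (rule ex1I[of _ "restrict (\<lambda>k. X k \<omega>) {k0..m}"])
    show "restrict (\<lambda>k. X k \<omega>) {k0..m} \<in> ?P \<and> ?A (restrict (\<lambda>k. X k \<omega>) {k0..m}) \<omega>"
      using XS that by auto
  next
    fix x assume "x \<in> ?P \<and> ?A x \<omega>"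
    then show "x = restrict (\<lambda>k. X k \<omega>) {k0..m}"
      by (intro extensionalityI[of _ "{k0..m}"]) (auto simp: PiE_def)
  qed
  \<comment> \<open>Nothing is known about the conditional probability given a history of
    probability 0, but there both sides vanish.\<close>
  have joint: "\<P>(\<omega> in M. X (Suc m) \<omega> = y \<and> ?A x \<omega>) = \<P>(\<omega> in M. ?A x \<omega>) * pmf (K m (x m)) y" for x
  proof (cases "\<P>(\<omega> in M. ?A x \<omega>) > 0")
    case True
    then have "\<P>(\<omega> in M. X (m + 1) \<omega> = y \<bar> ?A x \<omega>) = pmf (K m (x m)) y"
      using M m unfolding markov_process_def by blast
    then show ?thesis using True by (simp add: cond_prob_def field_simps)
  next
    case False
    then have 0: "\<P>(\<omega> in M. ?A x \<omega>) = 0"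
      using measure_nonneg[of M "{\<omega> \<in> space M. ?A x \<omega>}"] by linarith
    have "\<P>(\<omega> in M. X (Suc m) \<omega> = y \<and> ?A x \<omega>) \<le> \<P>(\<omega> in M. ?A x \<omega>)"
      by (intro finite_measure_mono evA) auto
    then have "\<P>(\<omega> in M. X (Suc m) \<omega> = y \<and> ?A x \<omega>) = 0"
      using 0 measure_nonneg[of M "{\<omega> \<in> space M. X (Suc m) \<omega> = y \<and> ?A x \<omega>}"] by linarith
    then show ?thesis using 0 by simp
  qed
  have "\<P>(\<omega> in M. X (Suc m) \<omega> = y) = (\<Sum>x\<in>?P. \<P>(\<omega> in M. X (Suc m) \<omega> = y \<and> ?A x \<omega>))"
  proof (rule prob_sum[OF finP])
    show "{\<omega> \<in> space M. X (Suc m) \<omega> = y \<and> ?A x \<omega>} \<in> events" for x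
      using ev[of "Suc m" y] evA m by (intro sets.sets_Collect_conj) auto
    show "{\<omega> \<in> space M. X (Suc m) \<omega> = y} \<in> events" using ev m by simp
    show "AE \<omega> in M. (\<forall>x\<in>?P. X (Suc m) \<omega> = y \<and> ?A x \<omega> \<longrightarrow> X (Suc m) \<omega> = y) \<and>
        (X (Suc m) \<omega> = y \<longrightarrow> (\<exists>!x. x \<in> ?P \<and> X (Suc m) \<omega> = y \<and> ?A x \<omega>))"
      using uniq by (intro AE_I2) auto
  qed
  also have "\<dots> = (\<Sum>x\<in>?P. \<P>(\<omega> in M. ?A x \<omega>) * pmf (K m (x m)) y)" by (simp only: joint)
  \<comment> \<open>Histories are grouped by their last value, on which alone the kernel
    depends.\<close>
  also have "\<dots> = (\<Sum>z\<in>S m. \<Sum>x\<in>{x\<in>?P. x m = z}. \<P>(\<omega> in M. ?A x \<omega>) * pmf (K m (x m)) y)"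
    using m finP fin by (intro sum.group[symmetric]) auto
  also have "\<dots> = (\<Sum>z\<in>S m. (\<Sum>x\<in>{x\<in>?P. x m = z}. \<P>(\<omega> in M. ?A x \<omega>)) * pmf (K m z) y)"
    by (intro sum.cong refl) (simp add: sum_distrib_right)
  also have "\<dots> = (\<Sum>z\<in>S m. \<P>(\<omega> in M. X m \<omega> = z) * pmf (K m z) y)"
  proof (intro sum.cong refl)
    fix z
    have "\<P>(\<omega> in M. X m \<omega> = z) = (\<Sum>x\<in>{x\<in>?P. x m = z}. \<P>(\<omega> in M. ?A x \<omega>))"
    proof (rule prob_sum)
      show "finite {x\<in>?P. x m = z}" using finP by simp
      show "{\<omega> \<in> space M. ?A x \<omega>} \<in> events" for x by (rule evA)
      show "{\<omega> \<in> space M. X m \<omega> = z} \<in> events" using ev m by simp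
      show "AE \<omega> in M. (\<forall>x\<in>{x\<in>?P. x m = z}. ?A x \<omega> \<longrightarrow> X m \<omega> = z) \<and>
        (X m \<omega> = z \<longrightarrow> (\<exists>!x. x \<in> {x\<in>?P. x m = z} \<and> ?A x \<omega>))"
      proof (intro AE_I2 conjI ballI impI)
        fix \<omega> x assume "x \<in> {x\<in>?P. x m = z}" "?A x \<omega>"
        then show "X m \<omega> = z" using m by auto
      next
        fix \<omega> assume w: "\<omega> \<in> space M" "X m \<omega> = z"
        have "(x \<in> {x\<in>?P. x m = z} \<and> ?A x \<omega>) = (x \<in> ?P \<and> ?A x \<omega>)" for x
          using w(2) m by auto
        then show "\<exists>!x. x \<in> {x\<in>?P. x m = z} \<and> ?A x \<omega>" using uniq[OF w(1)] by simp
      qed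
    qed
    then show "(\<Sum>x\<in>{x\<in>?P. x m = z}. \<P>(\<omega> in M. ?A x \<omega>)) * pmf (K m z) y = \<P>(\<omega> in M. X m \<omega> = z) * pmf (K m z) y"
      by simp
  qed
  finally show ?thesis .
qed

lemma markov_process_prob_sum:
  fixes f :: "'s \<Rightarrow> real"
  assumes M: "markov_process M k0 S K X" and fin: "finite (S k)" and k: "k0 \<le> k"
  shows "(\<integral>\<omega>. f (X k \<omega>) \<partial>M) = (\<Sum>x\<in>S k. \<P>(\<omega> in M. X k \<omega> = x) * f x)"
proof -
  interpret prob_space M using M by (simp add: markov_process_def)
  have X: "X k \<in> M \<rightarrow>\<^sub>M count_space (S k)" using M k by (simp add: markov_process_def)
  have XS: "X k \<omega> \<in> S k" if "\<omega> \<in> space M" for \<omega>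
    using measurable_space[OF X that] by simp
  have ev: "{\<omega> \<in> space M. X k \<omega> = x} \<in> events" if "x \<in> S k" for x
  proof -
    have "X k -` {x} \<inter> space M \<in> events" using that by (intro measurable_sets[OF X]) auto
    then show ?thesis by (simp add: vimage_def Int_def conj_commute)
  qed
  have "(\<integral>\<omega>. f (X k \<omega>) \<partial>M) = (\<integral>\<omega>. (\<Sum>x\<in>S k. f x * indicator {\<omega> \<in> space M. X k \<omega> = x} \<omega>) \<partial>M)"
  proof (rule Bochner_Integration.integral_cong[OF refl])
    fix \<omega> assume w: "\<omega> \<in> space M"
    have "(\<Sum>x\<in>S k. f x * indicator {\<omega> \<in> space M. X k \<omega> = x} \<omega>) = (\<Sum>x\<in>S k. if x = X k \<omega> then f x else 0)"
      using w by (intro sum.cong) auto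
    then show "f (X k \<omega>) = (\<Sum>x\<in>S k. f x * indicator {\<omega> \<in> space M. X k \<omega> = x} \<omega>)"
      using fin XS[OF w] by simp
  qed
  also have "\<dots> = (\<Sum>x\<in>S k. \<integral>\<omega>. f x * indicator {\<omega> \<in> space M. X k \<omega> = x} \<omega> \<partial>M)"
    using ev by (intro Bochner_Integration.integral_sum integrable_mult_right) (auto simp: emeasure_eq_measure)
  also have "\<dots> = (\<Sum>x\<in>S k. \<P>(\<omega> in M. X k \<omega> = x) * f x)"
    using ev by (intro sum.cong) (auto simp: mult.commute)
  finally show ?thesis .
qed

section \<open>Convergence of finite Markov chains\<close>

primrec kernel_power :: "('s \<Rightarrow> 's pmf) \<Rightarrow> nat \<Rightarrow> 's \<Rightarrow> 's pmf" where
  "kernel_power K 0 s = return_pmf s"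
| "kernel_power K (Suc m) s = bind_pmf (kernel_power K m s) K"

lemma kernel_power_set:
  assumes "\<And>s. s \<in> S \<Longrightarrow> set_pmf (K s) \<subseteq> S" "s \<in> S"
  shows "set_pmf (kernel_power K m s) \<subseteq> S"
  using assms by (induction m) (auto simp: set_bind_pmf)

lemma pmf_bind_sum:
  assumes "finite A" "set_pmf p \<subseteq> A"
  shows "pmf (bind_pmf p k) y = (\<Sum>x\<in>A. pmf p x * pmf (k x) y)"
  unfolding pmf_bind using assms
  by (subst integral_measure_pmf_real[of A]) (auto simp: mult.commute)

text \<open>Doeblin's argument: a state that is reached from everywhere after the same number of steps
  makes the kernel a contraction on signed measures of total mass 0.\<close>

lemma doeblin_convergence:
  fixes p :: "nat \<Rightarrow> 's \<Rightarrow> real" and \<mu> :: "'s \<Rightarrow> real"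
  assumes fin: "finite S" and K: "\<And>s. s \<in> S \<Longrightarrow> set_pmf (K s) \<subseteq> S"
    and z: "z \<in> S" "\<And>s. s \<in> S \<Longrightarrow> z \<in> set_pmf (kernel_power K N s)"
    and p: "\<And>m y. y \<in> S \<Longrightarrow> p (Suc m) y = (\<Sum>x\<in>S. p m x * pmf (K x) y)" "\<And>m. sum (p m) S = 1"
    and \<mu>: "\<And>y. y \<in> S \<Longrightarrow> \<mu> y = (\<Sum>x\<in>S. \<mu> x * pmf (K x) y)" "sum \<mu> S = 1"
    and y: "y \<in> S"
  shows "(\<lambda>m. p m y) \<longlonglongrightarrow> \<mu> y"
proof -
  define d where "d m x = p m x - \<mu> x" for m x
  define a where "a m = (\<Sum>x\<in>S. \<bar>d m x\<bar>)" for m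
  have d_Suc: "d (Suc m) y = (\<Sum>x\<in>S. d m x * pmf (K x) y)" if "y \<in> S" for m y
    using p(1)[OF that] \<mu>(1)[OF that] by (simp add: d_def left_diff_distrib sum_subtractf)
  have d0: "sum (d m) S = 0" for m using p(2)[of m] \<mu>(2) by (simp add: d_def sum_subtractf)
  have d_pow: "d (m + r) y = (\<Sum>x\<in>S. d m x * pmf (kernel_power K r x) y)" if "y \<in> S" for m r y
    using that
  proof (induction r arbitrary: y)
    case 0
    have "(\<Sum>x\<in>S. d m x * pmf (return_pmf x) y) = (\<Sum>x\<in>S. if x = y then d m x else 0)"
      by (intro sum.cong) (auto simp: indicator_def)
    then show ?case using fin 0 by simp
  next
    case (Suc r)
    have "d (m + Suc r) y = (\<Sum>w\<in>S. (\<Sum>x\<in>S. d m x * pmf (kernel_power K r x) w) * pmf (K w) y)"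
      using d_Suc[OF Suc.prems, of "m + r"] Suc.IH by simp
    also have "\<dots> = (\<Sum>x\<in>S. d m x * (\<Sum>w\<in>S. pmf (kernel_power K r x) w * pmf (K w) y))"
      unfolding sum_distrib_right sum_distrib_left by (subst sum.swap) (simp add: mult.assoc)
    also have "\<dots> = (\<Sum>x\<in>S. d m x * pmf (kernel_power K (Suc r) x) y)"
    proof (intro sum.cong refl)
      fix x assume "x \<in> S"
      have "set_pmf (kernel_power K r x) \<subseteq> S" by (rule kernel_power_set[OF K \<open>x \<in> S\<close>])
      then show "d m x * (\<Sum>w\<in>S. pmf (kernel_power K r x) w * pmf (K w) y) =
          d m x * pmf (kernel_power K (Suc r) x) y"
        using pmf_bind_sum[OF fin, of _ K y] by simp
    qed
    finally show ?case .
  qed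
  have sum1: "(\<Sum>y\<in>S. pmf q y) = 1" if "set_pmf q \<subseteq> S" for q :: "'s pmf"
    using sum_pmf_eq_1[OF fin that] .
  have "S \<noteq> {}" using z by auto
  \<comment> \<open>A uniform lower bound for the mass that \<open>N\<close> steps put on
    \<open>z\<close>; it is positive because \<open>S\<close> is finite.\<close>
  define \<epsilon> where "\<epsilon> = Min ((\<lambda>s. pmf (kernel_power K N s) z) ` S)"
  have \<epsilon>: "\<epsilon> > 0" "\<And>s. s \<in> S \<Longrightarrow> \<epsilon> \<le> pmf (kernel_power K N s) z"
    unfolding \<epsilon>_def using fin \<open>S \<noteq> {}\<close> z(2) by (auto simp: pmf_positive_iff[symmetric])
  have contract: "a (m + N) \<le> (1 - \<epsilon>) * a m" for m
  proof -
    \<comment> \<open>Removing mass \<epsilon> at \<open>z\<close> from every row does not change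
      the image of \<open>d m\<close>, whose total mass is 0. The reduced rows are nonnegative with
      sum 1 - \<epsilon>, which is the contraction factor.\<close>
    let ?q = "\<lambda>x y. pmf (kernel_power K N x) y - (if y = z then \<epsilon> else 0)"
    have "d (m + N) y = (\<Sum>x\<in>S. d m x * ?q x y)" if "y \<in> S" for y
    proof -
      have "(\<Sum>x\<in>S. d m x * (if y = z then \<epsilon> else 0)) = 0"
        using d0[of m] by (simp add: sum_distrib_right[symmetric])
      then show ?thesis using d_pow[OF that, of m N] by (simp add: right_diff_distrib sum_subtractf)
    qed
    then have "a (m + N) = (\<Sum>y\<in>S. \<bar>\<Sum>x\<in>S. d m x * ?q x y\<bar>)" unfolding a_def by (intro sum.cong) auto
    also have "\<dots> \<le> (\<Sum>y\<in>S. \<Sum>x\<in>S. \<bar>d m x * ?q x y\<bar>)" by (intro sum_mono sum_abs)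
    also have "\<dots> = (\<Sum>y\<in>S. \<Sum>x\<in>S. \<bar>d m x\<bar> * ?q x y)"
      using \<epsilon>(2) by (intro sum.cong refl) (auto simp: abs_mult)
    also have "\<dots> = (\<Sum>x\<in>S. \<bar>d m x\<bar> * (\<Sum>y\<in>S. ?q x y))"
      by (subst sum.swap) (simp add: sum_distrib_left)
    also have "\<dots> = (\<Sum>x\<in>S. \<bar>d m x\<bar> * (1 - \<epsilon>))"
    proof (intro sum.cong refl)
      fix x assume "x \<in> S"
      have "(\<Sum>y\<in>S. pmf (kernel_power K N x) y) = 1"
        using K \<open>x \<in> S\<close> by (intro sum1 kernel_power_set) auto
      then have "(\<Sum>y\<in>S. ?q x y) = 1 - \<epsilon>" using fin z(1) by (simp add: sum_subtractf)
      then show "\<bar>d m x\<bar> * (\<Sum>y\<in>S. ?q x y) = \<bar>d m x\<bar> * (1 - \<epsilon>)" by simp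
    qed
    finally show ?thesis by (simp add: a_def sum_distrib_left mult.commute)
  qed
  \<comment> \<open>Contraction is known only over \<open>N\<close> steps. Monotonicity in single
    steps gives a limit \<open>L\<close> of the whole sequence, and contraction then forces
    \<open>L = 0\<close>.\<close>
  have mono: "a (Suc m) \<le> a m" for m
  proof -
    have "a (Suc m) = (\<Sum>y\<in>S. \<bar>\<Sum>x\<in>S. d m x * pmf (K x) y\<bar>)" unfolding a_def using d_Suc by (intro sum.cong) auto
    also have "\<dots> \<le> (\<Sum>y\<in>S. \<Sum>x\<in>S. \<bar>d m x * pmf (K x) y\<bar>)" by (intro sum_mono sum_abs)
    also have "\<dots> = (\<Sum>x\<in>S. \<bar>d m x\<bar> * (\<Sum>y\<in>S. pmf (K x) y))"
      by (subst sum.swap) (simp add: sum_distrib_left abs_mult)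
    also have "\<dots> = a m" unfolding a_def using sum1 K by (intro sum.cong) auto
    finally show ?thesis .
  qed
  have nonneg: "0 \<le> a m" for m unfolding a_def by (intro sum_nonneg) auto
  have "decseq a" using mono by (rule decseq_SucI)
  then obtain L where L: "a \<longlonglongrightarrow> L" using decseq_convergent[of a 0] nonneg by metis
  have "L \<le> (1 - \<epsilon>) * L"
    by (rule LIMSEQ_le[OF LIMSEQ_ignore_initial_segment[OF L, of N] tendsto_mult_left[OF L, of "1 - \<epsilon>"]])
      (use contract in auto)
  then have "\<epsilon> * L \<le> 0" by (simp add: algebra_simps)
  moreover have "0 \<le> L" using L nonneg by (intro LIMSEQ_le_const) auto
  ultimately have "L = 0" using \<epsilon>(1) by (simp add: mult_le_0_iff)
  then have "(\<lambda>m. d m y) \<longlonglongrightarrow> 0"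
    using L y fin by (intro Lim_null_comparison[of "\<lambda>m. d m y" a]) (auto simp: a_def intro!: member_le_sum eventuallyI)
  then show ?thesis using LIM_zero_cancel[of "\<lambda>m. p m y"] by (simp add: d_def LIM_zero_iff)
qed

section \<open>Down-up chains\<close>

text \<open>\<open>G_d\<close> is the mixture identity, tested against functions so that it can be
  used as plain arithmetic. The singleton \<open>S 1\<close> starts the induction for stationarity;
  the singleton \<open>S 2\<close> is the common ancestor that makes the chain forget its
  start.\<close>

locale down_up =
  fixes S :: "nat \<Rightarrow> 's set" and G :: "nat \<Rightarrow> 's \<Rightarrow> 's pmf" and d :: "nat \<Rightarrow> 's \<Rightarrow> 's" and \<alpha> :: real
    and e1 e2 :: 's
  assumes fin: "finite (S n)" and S1: "S 1 = {e1}" and S2: "S 2 = {e2}" and alpha: "\<alpha> \<le> 1"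
    and G_in: "1 \<le> n \<Longrightarrow> s \<in> S n \<Longrightarrow> set_pmf (G n s) \<subseteq> S (n + 1)"
    and d_in: "2 \<le> n \<Longrightarrow> i \<in> {1..n} \<Longrightarrow> s \<in> S n \<Longrightarrow> d i s \<in> S (n - 1)"
    and d_top: "1 \<le> n \<Longrightarrow> s \<in> S n \<Longrightarrow> q \<in> set_pmf (G n s) \<Longrightarrow> d (n + 1) q = s"
    and G_d: "2 \<le> n \<Longrightarrow> i \<in> {1..n} \<Longrightarrow> s \<in> S n \<Longrightarrow>
      measure_pmf.expectation (G n s) (\<lambda>q. f (d i q)) = f s / (real n - \<alpha>) +
        (real n - 1 - \<alpha>) / (real n - \<alpha>) * measure_pmf.expectation (G (n - 1) (d i s)) f"
begin

text \<open>Time starts at 1; the value at 0 is a filler.\<close>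

primrec law :: "nat \<Rightarrow> 's pmf" where
  "law 0 = return_pmf e1"
| "law (Suc n) = (if n = 0 then return_pmf e1 else bind_pmf (law n) (G n))"

definition chain :: "nat \<Rightarrow> 's \<Rightarrow> 's pmf" where
  "chain n s = (if n = 1 then return_pmf s
     else bind_pmf (pmf_of_set {1..n}) (\<lambda>i. G (n - 1) (d i s)))"

lemma law_in: "1 \<le> n \<Longrightarrow> set_pmf (law n) \<subseteq> S n"
proof (induction n)
  case (Suc n)
  show ?case
  proof (cases "n = 0")
    case True
    then show ?thesis using S1 by simp
  next
    case False
    then show ?thesis using Suc G_in[of n] by (fastforce simp: set_bind_pmf)
  qed
qed simp

lemma finite_G: "1 \<le> n \<Longrightarrow> s \<in> S n \<Longrightarrow> finite (set_pmf (G n s))"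
  using finite_subset[OF G_in fin] .

lemma finite_law: "1 \<le> n \<Longrightarrow> finite (set_pmf (law n))"
  using finite_subset[OF law_in fin] .

lemma chain_in: "1 \<le> n \<Longrightarrow> s \<in> S n \<Longrightarrow> set_pmf (chain n s) \<subseteq> S n"
proof (cases "n = 1")
  case False
  assume n: "1 \<le> n" and s: "s \<in> S n"
  have "set_pmf (G (n - 1) (d i s)) \<subseteq> S n" if "i \<in> {1..n}" for i
    using G_in[of "n - 1" "d i s"] d_in[OF _ that s] n False by simp
  moreover have "set_pmf (chain n s) = (\<Union>i\<in>{1..n}. set_pmf (G (n - 1) (d i s)))"
    using n False by (simp add: chain_def)
  ultimately show ?thesis by (simp only: UN_least)
qed (simp add: chain_def)

lemma law_Suc_expectation:
  fixes f :: "'s \<Rightarrow> real"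
  assumes "1 \<le> n"
  shows "measure_pmf.expectation (law (Suc n)) f = measure_pmf.expectation (law n) (\<lambda>s. measure_pmf.expectation (G n s) f)"
proof -
  have "measure_pmf.expectation (law (Suc n)) f = (\<Sum>s\<in>S n. pmf (law n) s *\<^sub>R measure_pmf.expectation (G n s) f)"
  proof -
    have "law (Suc n) = bind_pmf (law n) (G n)" using assms by simp
    then show ?thesis
      using pmf_expectation_bind[where A = "S n" and f = "G n" and p = "law n" and h = f]
        fin finite_G[OF assms] law_in[OF assms] by simp
  qed
  also have "\<dots> = measure_pmf.expectation (law n) (\<lambda>s. measure_pmf.expectation (G n s) f)"
    using law_in[OF assms] by (subst integral_measure_pmf_real[of "S n"]) (auto simp: fin mult.commute)
  finally show ?thesis .
qed

text \<open>Condition on the last growth step: the newest leaf contributes \<open>f s\<close> by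
  \<open>d_top\<close>, and every other leaf is expanded by \<open>G_d\<close>. In the remaining
  terms growth comes after the down-step, so the induction hypothesis applies to the expectation of
  \<open>f\<close> under \<open>G (n - 1)\<close> as a function of the state. This is why
  \<open>f\<close> varies in the induction.\<close>

lemma law_down:
  assumes "2 \<le> n"
  shows "measure_pmf.expectation (law n) (\<lambda>s. (\<Sum>i=1..n. f (d i s)) / n) = measure_pmf.expectation (law (n - 1)) f"
  using assms
proof (induction n arbitrary: f rule: dec_induct)
  case base
  have "(\<Sum>i=1..2. f (d i s)) / 2 = f e1" if "s \<in> set_pmf (law 2)" for s
  proof -
    have "s \<in> S 2" using law_in[of 2] that by auto
    then have "f (d i s) = f e1" if "i \<in> {1..2}" for i using d_in[of 2 i s] that S1 by auto
    then have "(\<Sum>i=1..2. f (d i s)) = (\<Sum>i=1..(2::nat). f e1)" by (intro sum.cong) auto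
    then show ?thesis by simp
  qed
  then have "measure_pmf.expectation (law 2) (\<lambda>s. (\<Sum>i=1..2. f (d i s)) / real 2) = measure_pmf.expectation (law 2) (\<lambda>s. f e1)"
    by (intro integral_cong_AE) (auto simp: AE_measure_pmf_iff)
  then show ?case by simp
next
  case (step n)
  have n: "2 \<le> n" using step by simp
  have pos: "0 < real n - \<alpha>" using n alpha by simp
  let ?E = "\<lambda>p f. measure_pmf.expectation p f"
  have G: "?E (G n s) (\<lambda>q. (\<Sum>i=1..Suc n. f (d i q)) / Suc n) =
      ((real n / (real n - \<alpha>) + 1) * f s + (real n - 1 - \<alpha>) / (real n - \<alpha>) * (\<Sum>i=1..n. ?E (G (n - 1) (d i s)) f)) / Suc n"
    if s: "s \<in> S n" for s
  proof -
    have [simp]: "integrable (measure_pmf (G n s)) h" for h :: "'s \<Rightarrow> real"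
      using finite_G[OF _ s] n by (intro integrable_measure_pmf_finite) auto
    have "?E (G n s) (\<lambda>q. f (d (Suc n) q)) = ?E (G n s) (\<lambda>q. f s)"
      using d_top[OF _ s] n by (intro integral_cong_AE) (auto simp: AE_measure_pmf_iff)
    then have top: "?E (G n s) (\<lambda>q. f (d (Suc n) q)) = f s" by simp
    have "?E (G n s) (\<lambda>q. (\<Sum>i=1..Suc n. f (d i q)) / Suc n) =
      (?E (G n s) (\<lambda>q. (\<Sum>i=1..n. f (d i q))) + ?E (G n s) (\<lambda>q. f (d (Suc n) q))) / Suc n"
      by (simp add: sum.atLeast_Suc_atMost del: of_nat_Suc)
    also have "?E (G n s) (\<lambda>q. (\<Sum>i=1..n. f (d i q))) = (\<Sum>i=1..n. ?E (G n s) (\<lambda>q. f (d i q)))"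
      by (rule Bochner_Integration.integral_sum) simp
    also have "\<dots> = (\<Sum>i=1..n. f s / (real n - \<alpha>) + (real n - 1 - \<alpha>) / (real n - \<alpha>) * ?E (G (n - 1) (d i s)) f)"
      using G_d[OF n _ s] by (intro sum.cong) auto
    also have "\<dots> = real n / (real n - \<alpha>) * f s + (real n - 1 - \<alpha>) / (real n - \<alpha>) * (\<Sum>i=1..n. ?E (G (n - 1) (d i s)) f)"
      by (simp add: sum.distrib sum_distrib_left)
    finally show ?thesis unfolding top by (simp add: algebra_simps)
  qed
  have fl [simp]: "integrable (measure_pmf (law n)) h" for h :: "'s \<Rightarrow> real"
    using finite_law n by (intro integrable_measure_pmf_finite) auto
  let ?F = "\<lambda>s. (\<Sum>i=1..n. ?E (G (n - 1) (d i s)) f)"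
  have "?E (law (Suc n)) (\<lambda>s. (\<Sum>i=1..Suc n. f (d i s)) / Suc n) =
      ?E (law n) (\<lambda>s. ?E (G n s) (\<lambda>q. (\<Sum>i=1..Suc n. f (d i q)) / Suc n))"
    using n by (intro law_Suc_expectation) auto
  also have "\<dots> = ?E (law n) (\<lambda>s. ((real n / (real n - \<alpha>) + 1) * f s + (real n - 1 - \<alpha>) / (real n - \<alpha>) * ?F s) / Suc n)"
  proof (intro integral_cong_AE)
    show "AE s in law n. ?E (G n s) (\<lambda>q. (\<Sum>i=1..Suc n. f (d i q)) / Suc n) =
      ((real n / (real n - \<alpha>) + 1) * f s + (real n - 1 - \<alpha>) / (real n - \<alpha>) * ?F s) / Suc n"
      using G law_in[of n] n by (intro AE_pmfI) auto
  qed auto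
  also have "\<dots> = ((real n / (real n - \<alpha>) + 1) * ?E (law n) f + (real n - 1 - \<alpha>) / (real n - \<alpha>) * ?E (law n) ?F) / Suc n"
    by simp
  also have "?E (law n) ?F = real n * ?E (law n) f"
  proof -
    have "?E (law n) (\<lambda>s. ?F s / n) = ?E (law (n - 1)) (\<lambda>z. ?E (G (n - 1) z) f)"
      by (rule step.IH)
    also have "\<dots> = ?E (law n) f" using law_Suc_expectation[of "n - 1" f] n by simp
    finally show ?thesis using n by (simp add: field_simps)
  qed
  \<comment> \<open>The coefficients match because n + (n - \<alpha>) + n (n - 1 - \<alpha>) = (n -
    \<alpha>) (n + 1).\<close>
  also have "((real n / (real n - \<alpha>) + 1) * ?E (law n) f + (real n - 1 - \<alpha>) / (real n - \<alpha>) * (real n * ?E (law n) f)) / Suc n = ?E (law n) f"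
  proof -
    have "a / D + 1 + e / D * b = (a + D + e * b) / D" if "D \<noteq> 0" for a b D e :: real
      using that by (simp add: add_divide_distrib)
    then have "real n / (real n - \<alpha>) + 1 + (real n - 1 - \<alpha>) / (real n - \<alpha>) * real n =
        (real n + (real n - \<alpha>) + (real n - 1 - \<alpha>) * real n) / (real n - \<alpha>)"
      using pos by simp
    also have "real n + (real n - \<alpha>) + (real n - 1 - \<alpha>) * real n = (real n - \<alpha>) * real (Suc n)"
      by (simp add: algebra_simps)
    finally have "real n / (real n - \<alpha>) + 1 + (real n - 1 - \<alpha>) / (real n - \<alpha>) * real n = real (Suc n)"
      using pos by simp
    then have "(real n / (real n - \<alpha>) + 1) * x + (real n - 1 - \<alpha>) / (real n - \<alpha>) * (real n * x) = real (Suc n) * x" for x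
      by (metis distrib_right mult.assoc)
    then show ?thesis by simp
  qed
  finally show ?case by simp
qed

text \<open>The chain is the averaged down-step followed by the growth step that produces
  \<open>law n\<close>, so \<open>law_down\<close> is applied to the probability of growing into
  \<open>y\<close>.\<close>

lemma law_stationary:
  assumes "1 \<le> n"
  shows "pmf (law n) y = (\<Sum>x\<in>S n. pmf (law n) x * pmf (chain n x) y)"
proof (cases "n = 1")
  case True
  then show ?thesis using S1 by (auto simp: chain_def indicator_def)
next
  case False
  then have n: "2 \<le> n" using assms by simp
  let ?E = "\<lambda>p f. measure_pmf.expectation p f"
  have "(\<Sum>x\<in>S n. pmf (law n) x * pmf (chain n x) y) = ?E (law n) (\<lambda>x. pmf (chain n x) y)"
    using law_in[OF assms] by (subst integral_measure_pmf_real[of "S n"]) (auto simp: fin mult.commute)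
  also have "\<dots> = ?E (law n) (\<lambda>x. (\<Sum>i=1..n. pmf (G (n - 1) (d i x)) y) / n)"
    using n by (simp add: chain_def pmf_bind integral_pmf_of_set)
  also have "\<dots> = ?E (law (n - 1)) (\<lambda>z. pmf (G (n - 1) z) y)"
    by (rule law_down[OF n])
  also have "\<dots> = pmf (bind_pmf (law (n - 1)) (G (n - 1))) y" by (simp add: pmf_bind)
  also have "bind_pmf (law (n - 1)) (G (n - 1)) = law n" using n by (cases n) auto
  finally show ?thesis ..
qed

section \<open>States that the chain can reach\<close>

primrec grow :: "nat \<Rightarrow> nat \<Rightarrow> 's \<Rightarrow> 's pmf" where
  "grow k 0 x = return_pmf x"
| "grow k (Suc r) x = bind_pmf (grow k r x) (G (k + r))"

lemma grow_in: "1 \<le> k \<Longrightarrow> x \<in> S k \<Longrightarrow> set_pmf (grow k r x) \<subseteq> S (k + r)"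
proof (induction r)
  case (Suc r)
  then show ?case using G_in[of "k + r"] by (fastforce simp: set_bind_pmf)
qed simp

text \<open>Test \<open>G_d\<close> against the indicator of \<open>z\<close>: without such a
  \<open>q\<close> the left side is 0, while the last term on the right is positive. Positivity uses
  n - 1 - \<alpha> > 0, which fails for \<open>n = 2\<close> and \<alpha> = 1, hence the bound
  3.\<close>

lemma G_lift:
  assumes "3 \<le> n" "i \<in> {1..n}" "s \<in> S n" "z \<in> set_pmf (G (n - 1) (d i s))"
  shows "\<exists>q\<in>set_pmf (G n s). d i q = z"
proof (rule ccontr)
  assume none: "\<not> ?thesis"
  have n: "2 \<le> n" using assms(1) by simp
  have "measure_pmf.expectation (G n s) (\<lambda>q. indicator {z} (d i q)) = (measure_pmf.expectation (G n s) (\<lambda>q. 0) :: real)"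
    using none by (intro integral_cong_AE) (auto simp: AE_measure_pmf_iff indicator_def)
  moreover have "measure_pmf.expectation (G (n - 1) (d i s)) (indicator {z}) = pmf (G (n - 1) (d i s)) z"
    by (simp add: measure_pmf_single)
  moreover have "0 \<le> indicator {z} s / (real n - \<alpha>)" using assms(1) alpha by auto
  moreover have "0 < (real n - 1 - \<alpha>) / (real n - \<alpha>) * pmf (G (n - 1) (d i s)) z"
    using assms(1,4) alpha by (intro mult_pos_pos divide_pos_pos) (auto simp: pmf_positive)
  ultimately show False using G_d[OF n assms(2,3), of "indicator {z}"] by simp
qed

lemma grow_lift:
  assumes "3 \<le> k" "i \<in> {1..k}" "x \<in> S k" "z \<in> set_pmf (grow (k - 1) r (d i x))"
  shows "\<exists>q\<in>set_pmf (grow k r x). d i q = z"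
  using assms(4)
proof (induction r arbitrary: z)
  case (Suc r)
  then obtain z0 where z0: "z0 \<in> set_pmf (grow (k - 1) r (d i x))" "z \<in> set_pmf (G (k - 1 + r) z0)"
    by (auto simp: set_bind_pmf)
  obtain q0 where q0: "q0 \<in> set_pmf (grow k r x)" "d i q0 = z0" using Suc.IH[OF z0(1)] by blast
  have "q0 \<in> S (k + r)" using grow_in[of k x r] assms q0 by auto
  then have "\<exists>q\<in>set_pmf (G (k + r) q0). d i q = z"
    using assms(1,2) z0(2) q0(2) by (intro G_lift) auto
  then show ?case using q0 by (auto simp: set_bind_pmf)
qed simp

text \<open>Peeling off \<open>r\<close> leaves one at a time and regrowing them, the chain reaches in \<open>r\<close> steps
  every state that grows in \<open>r\<close> steps out of what is left.\<close>

lemma chain_reaches_grow: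
  assumes "2 \<le> n" "s \<in> S n" "r \<le> n - 2"
  shows "\<exists>x\<in>S (n - r). set_pmf (grow (n - r) r x) \<subseteq> set_pmf (kernel_power (chain n) r s)"
  using assms(3)
proof (induction r)
  case 0
  then show ?case using assms by auto
next
  case (Suc r)
  then obtain x where x: "x \<in> S (n - r)" "set_pmf (grow (n - r) r x) \<subseteq> set_pmf (kernel_power (chain n) r s)" by auto
  have k: "3 \<le> n - r" "n - r - 1 = n - Suc r" and e: "n - Suc r + r = n - 1" using Suc.prems by auto
  \<comment> \<open>Leaf 1 exists at every size and may be selected each time. A state
    \<open>z\<close> grown from \<open>d 1 x\<close> equals \<open>d 1 q\<close> for some
    \<open>q\<close> that the chain has already reached, and its next step can lead from
    \<open>q\<close> through \<open>z\<close> to \<open>w\<close>.\<close>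
  have "w \<in> set_pmf (kernel_power (chain n) (Suc r) s)" if "w \<in> set_pmf (grow (n - Suc r) (Suc r) (d 1 x))" for w
  proof -
    from that obtain z where z: "z \<in> set_pmf (grow (n - Suc r) r (d 1 x))" "w \<in> set_pmf (G (n - 1) z)"
      using e unfolding grow.simps(2) set_bind_pmf by (auto simp only: UN_iff)
    obtain q where q: "q \<in> set_pmf (grow (n - r) r x)" "d 1 q = z"
      using grow_lift[of "n - r" 1 x z r] z(1) k x(1) by auto
    have "w \<in> set_pmf (chain n q)" using z(2) q(2) assms(1) by (auto simp: chain_def set_bind_pmf)
    then show ?thesis using q(1) x(2) by (auto simp: set_bind_pmf)
  qed
  moreover have "d 1 x \<in> S (n - Suc r)" using d_in[of "n - r" 1 x] k x(1) by simp
  ultimately show ?case by blast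
qed

text \<open>After peeling off \<open>n - 2\<close> leaves only the single state of
  \<open>S 2\<close> is left, so what grows out of it is reached from every start.\<close>

lemma chain_common_state: "1 \<le> n \<Longrightarrow> \<exists>N. \<exists>z\<in>S n. \<forall>s\<in>S n. z \<in> set_pmf (kernel_power (chain n) N s)"
proof (cases "n = 1")
  case True
  then show ?thesis using S1 by (intro exI[of _ 0]) auto
next
  case False
  assume "1 \<le> n"
  then have n: "2 \<le> n" using False by simp
  obtain z where z: "z \<in> set_pmf (grow 2 (n - 2) e2)" using set_pmf_not_empty by fast
  have "set_pmf (grow 2 (n - 2) e2) \<subseteq> S (2 + (n - 2))" using S2 by (intro grow_in) auto
  then have "z \<in> S n" using z n by (metis le_add_diff_inverse subsetD)
  moreover have "z \<in> set_pmf (kernel_power (chain n) (n - 2) s)" if "s \<in> S n" for s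
    using chain_reaches_grow[OF n that, of "n - 2"] z S2 n by auto
  ultimately show ?thesis by blast
qed

lemma chain_converges:
  fixes p :: "nat \<Rightarrow> 's \<Rightarrow> real"
  assumes "1 \<le> n" "\<And>m y. y \<in> S n \<Longrightarrow> p (Suc m) y = (\<Sum>x\<in>S n. p m x * pmf (chain n x) y)"
    "\<And>m. sum (p m) (S n) = 1" "y \<in> S n"
  shows "(\<lambda>m. p m y) \<longlonglongrightarrow> pmf (law n) y"
proof -
  obtain N z where "z \<in> S n" "\<And>s. s \<in> S n \<Longrightarrow> z \<in> set_pmf (kernel_power (chain n) N s)"
    using chain_common_state[OF assms(1)] by blast
  note z = this
  show ?thesis
  proof (rule doeblin_convergence[where S = "S n" and K = "chain n" and p = p and \<mu> = "pmf (law n)"])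
    show "sum (pmf (law n)) (S n) = 1" by (rule sum_pmf_eq_1[OF fin law_in[OF assms(1)]])
    show "pmf (law n) y = (\<Sum>x\<in>S n. pmf (law n) x * pmf (chain n x) y)" for y
      by (rule law_stationary[OF assms(1)])
  qed (fact fin chain_in[OF assms(1)] z assms(2,3,4))+
qed

end

section \<open>Drawings and insertion of a leaf\<close>

lemma finite_plabels [simp]: "finite (plabels p)"
  by (induction p) auto

text \<open>Stated for lists of least labels instead of lists of subtrees, so that it can be carried
  along relabellings.\<close>

definition lead2 :: "nat list \<Rightarrow> bool" where
  "lead2 ks \<longleftrightarrow> (\<forall>s\<in>set (take 2 ks). \<forall>t\<in>set (drop 2 ks). s < t)"

lemma lead2_simps [simp]:
  "lead2 []" "lead2 [x]" "lead2 (x # y # zs) \<longleftrightarrow> (\<forall>t\<in>set zs. x < t \<and> y < t)"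
  by (auto simp: lead2_def)

abbreviation disjoint_labels :: "'a ptree list \<Rightarrow> bool" where
  "disjoint_labels \<equiv> sorted_wrt (\<lambda>s t. plabels s \<inter> plabels t = {})"

text \<open>Drawings of semi-planar trees up to the order of the two leftmost subtrees, a class that
  the down-step does not leave. Disjointness is required by position, which also rules out repeated
  siblings.\<close>

fun drawing :: "nat ptree \<Rightarrow> bool" where
  "drawing (PLeaf i) \<longleftrightarrow> True"
| "drawing (PNode ts) \<longleftrightarrow> 2 \<le> length ts \<and> (\<forall>t\<in>set ts. drawing t) \<and>
     disjoint_labels ts \<and> lead2 (map least_label ts)"

lemma drawing_plabels_nonempty: "drawing p \<Longrightarrow> plabels p \<noteq> {}"
proof (induction p)
  case (PNode ts)
  then show ?case by (cases ts) auto
qed simp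

lemma least_label_PLeaf [simp]: "least_label (PLeaf i) = i"
  by (simp add: least_label_def)

lemma least_label_in: "drawing p \<Longrightarrow> least_label p \<in> plabels p"
  unfolding least_label_def by (rule Min_in) (auto simp: drawing_plabels_nonempty)

lemma least_label_le: "i \<in> plabels p \<Longrightarrow> least_label p \<le> i"
  unfolding least_label_def by simp

lemma disjoint_labels_mid:
  "disjoint_labels (xs @ v # ys) \<longleftrightarrow> disjoint_labels (xs @ ys) \<and>
     (\<forall>t\<in>set (xs @ ys). plabels t \<inter> plabels v = {})"
  unfolding sorted_wrt_append by (simp, blast)

lemma disjoint_labels_distinct:
  assumes "disjoint_labels ts" "\<And>t. t \<in> set ts \<Longrightarrow> plabels t \<noteq> {}"
  shows "distinct ts"
  using assms by (induction ts) auto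

lemma disjoint_labels_unique:
  assumes "disjoint_labels ts" "s \<in> set ts" "t \<in> set ts" "x \<in> plabels s" "x \<in> plabels t"
  shows "s = t"
  using assms by (induction ts) auto

lemma drawing_least_label_inj:
  assumes "drawing (PNode ts)" "s \<in> set ts" "t \<in> set ts" "least_label s = least_label t"
  shows "s = t"
  using assms disjoint_labels_unique[of ts s t "least_label s"] least_label_in[of s] least_label_in[of t]
  by simp

text \<open>The conditions at a branch point see a child only through its labels and its least
  label.\<close>

lemma drawing_replace:
  assumes "drawing (PNode (xs @ v # ys))" "drawing q" "plabels q \<subseteq> insert j (plabels v)"
    "least_label q = least_label v" "\<And>t. t \<in> set (xs @ ys) \<Longrightarrow> j \<notin> plabels t"
  shows "drawing (PNode (xs @ q # ys))"
  using assms unfolding drawing.simps disjoint_labels_mid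
  by (auto simp del: sorted_wrt_append) blast+

text \<open>The results of inserting \<open>j\<close>, described without locations, so that facts
  about insertion follow by rule induction. The bound in \<open>at\<close> keeps the new leaf away
  from the two leftmost places.\<close>

inductive grown :: "nat \<Rightarrow> nat ptree \<Rightarrow> nat ptree \<Rightarrow> bool" for j where
  above: "grown j p (PNode [p, PLeaf j])"
| at: "2 \<le> length us \<Longrightarrow> grown j (PNode (us @ vs)) (PNode (us @ PLeaf j # vs))"
| below: "grown j v q \<Longrightarrow> grown j (PNode (us @ v # vs)) (PNode (us @ q # vs))"

lemma grown_plabels: "grown j p q \<Longrightarrow> plabels q = insert j (plabels p)"
  by (induction rule: grown.induct) auto

lemma grown_least_label:
  assumes "grown j p q" "drawing p" "\<forall>k\<in>plabels p. k < j"
  shows "least_label q = least_label p"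
  unfolding least_label_def grown_plabels[OF assms(1)]
  using assms(3) drawing_plabels_nonempty[OF assms(2)]
  by (subst Min_insert) (use Min_in[of "plabels p"] in \<open>force simp: min_def not_le\<close>)+

lemma lead2_append_ge: "2 \<le> length us \<Longrightarrow> lead2 (us @ vs) \<longleftrightarrow> lead2 us \<and> (\<forall>t\<in>set vs. \<forall>s\<in>set (take 2 us). s < t)"
  by (auto simp: lead2_def)

lemma grown_drawing:
  "grown j p q \<Longrightarrow> drawing p \<Longrightarrow> \<forall>k\<in>plabels p. k < j \<Longrightarrow> drawing q"
proof (induction rule: grown.induct)
  case (above p)
  then show ?case by auto
next
  case (at us vs)
  then show ?case
    by (auto simp: sorted_wrt_append lead2_append_ge dest!: in_set_takeD)
       (use at least_label_in in fastforce)+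
next
  case (below v q us vs)
  then have "drawing q" by auto
  then show ?case
    using below.prems grown_plabels[OF below.hyps] grown_least_label[OF below.hyps]
    by (intro drawing_replace[OF below.prems(1)]) auto
qed

lemma grown_not_PLeaf: "grown j p q \<Longrightarrow> q \<noteq> PLeaf k"
  by (auto elim: grown.cases)

text \<open>A form with a test on the length instead of a pattern match on the remaining list, which
  suits lists split around one child.\<close>

lemma delete_leaf_PNode:
  "delete_leaf k (PNode ts) =
    (let us = filter (\<lambda>s. s \<noteq> PLeaf k) (map (delete_leaf k) ts)
     in if length us = 1 then hd us else PNode us)"
  unfolding delete_leaf.simps Let_def
  by (cases "filter (\<lambda>s. s \<noteq> PLeaf k) (map (delete_leaf k) ts)";
      cases "tl (filter (\<lambda>s. s \<noteq> PLeaf k) (map (delete_leaf k) ts))") simp_all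

declare delete_leaf.simps(2) [simp del]

lemma delete_leaf_id [simp]:
  "drawing p \<Longrightarrow> i \<notin> plabels p \<Longrightarrow> delete_leaf i p = p"
proof (induction p)
  case (PNode ts)
  have "map (delete_leaf i) ts = ts" using PNode by (intro map_idI) auto
  moreover have "filter (\<lambda>s. s \<noteq> PLeaf i) ts = ts" using PNode.prems by (auto simp: filter_id_conv)
  ultimately show ?case using PNode.prems
    by (auto simp: delete_leaf_PNode)
qed simp

lemma map_delete_leaf_others:
  assumes "\<forall>t\<in>set ts. drawing t \<and> i \<notin> plabels t"
  shows "filter (\<lambda>s. s \<noteq> PLeaf i) (map (delete_leaf i) ts) = ts"
proof -
  have "map (delete_leaf i) ts = ts" using assms by (intro map_idI) auto
  then show ?thesis using assms by (auto simp: filter_id_conv)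
qed

lemma drawing_PNode_others:
  assumes "drawing (PNode (xs @ v # ys))" "i \<in> plabels v"
  shows "\<forall>t\<in>set xs. drawing t \<and> i \<notin> plabels t" "\<forall>t\<in>set ys. drawing t \<and> i \<notin> plabels t"
  using assms by (auto simp: sorted_wrt_append)

lemma delete_leaf_parent:
  assumes "drawing (PNode (xs @ PLeaf i # ys))"
  shows "delete_leaf i (PNode (xs @ PLeaf i # ys)) =
    (if length (xs @ ys) = 1 then hd (xs @ ys) else PNode (xs @ ys))"
  using drawing_PNode_others[OF assms] by (simp add: map_delete_leaf_others delete_leaf_PNode Let_def)

lemma delete_leaf_parent3:
  assumes "drawing (PNode (xs @ PLeaf i # ys))" "2 \<le> length (xs @ ys)"
  shows "delete_leaf i (PNode (xs @ PLeaf i # ys)) = PNode (xs @ ys)"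
  using assms by (subst delete_leaf_parent) auto

lemma delete_leaf_child:
  assumes "drawing (PNode (xs @ v # ys))" "i \<in> plabels v" "delete_leaf i v \<noteq> PLeaf i"
  shows "delete_leaf i (PNode (xs @ v # ys)) = PNode (xs @ delete_leaf i v # ys)"
proof -
  have "xs @ ys \<noteq> []" using assms(1) by auto
  then show ?thesis
    using drawing_PNode_others[OF assms(1,2)] assms(3)
    by (auto simp: map_delete_leaf_others delete_leaf_PNode Let_def)
qed

lemma split_child:
  assumes "i \<in> plabels (PNode ts)"
  obtains xs v ys where "ts = xs @ v # ys" "i \<in> plabels v"
  using assms by (auto dest: split_list)

lemma plabels_delete_leaf:
  "drawing p \<Longrightarrow> p \<noteq> PLeaf i \<Longrightarrow> plabels (delete_leaf i p) = plabels p - {i}"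
proof (induction p)
  case (PNode ts)
  show ?case
  proof (cases "i \<in> plabels (PNode ts)")
    case True
    then obtain xs v ys where ts: "ts = xs @ v # ys" "i \<in> plabels v" by (rule split_child)
    have d: "drawing (PNode (xs @ v # ys))" using PNode.prems(1) ts(1) by simp
    note oth = drawing_PNode_others[OF d ts(2)]
    have u: "(\<Union>t\<in>set (xs @ ys). plabels t) = plabels (PNode (xs @ v # ys)) - plabels v"
      using d unfolding drawing.simps disjoint_labels_mid by (auto simp del: sorted_wrt_append)
    show ?thesis
    proof (cases "v = PLeaf i")
      case True
      have "plabels (if length (xs @ ys) = 1 then hd (xs @ ys) else PNode (xs @ ys)) =
          (\<Union>t\<in>set (xs @ ys). plabels t)"
        by (cases "xs @ ys") auto
      then show ?thesis
        using u True unfolding ts(1) True delete_leaf_parent[OF d[unfolded True]]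
        by (metis ptree.set(1) list.simps(15) empty_set)
    next
      case False
      have *: "plabels (delete_leaf i v) = plabels v - {i}"
        using PNode.IH[of v] d False ts by simp
      then have "i \<notin> plabels (delete_leaf i v)" by simp
      then have "delete_leaf i v \<noteq> PLeaf i" by auto
      from delete_leaf_child[OF d ts(2) this] show ?thesis
        using oth * unfolding ts(1) by auto
    qed
  next
    case False
    then show ?thesis using delete_leaf_id[OF PNode.prems(1)] by simp
  qed
qed auto

lemma delete_leaf_not_PLeaf:
  assumes "drawing p" "p \<noteq> PLeaf i" shows "delete_leaf i p \<noteq> PLeaf i"
proof -
  have "i \<notin> plabels (delete_leaf i p)" using plabels_delete_leaf[OF assms] by simp
  then show ?thesis by auto
qed

lemma grown_delete_leaf:
  "grown j p q \<Longrightarrow> drawing p \<Longrightarrow> \<forall>k\<in>plabels p. k < j \<Longrightarrow> delete_leaf j q = p"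
proof (induction rule: grown.induct)
  case (above p)
  then have *: "drawing (PNode ([p] @ PLeaf j # []))" by auto
  show ?case using delete_leaf_parent[OF *] by simp
next
  case (at us vs)
  have *: "drawing (PNode (us @ PLeaf j # vs))"
    using grown_drawing[OF grown.at] at by blast
  show ?case using delete_leaf_parent3[OF *] at by simp
next
  case (below v q us vs)
  have *: "drawing (PNode (us @ q # vs))"
    using grown_drawing[OF grown.below] below by blast
  have "j \<in> plabels q" using grown_plabels below by auto
  moreover have "delete_leaf j q = v" using below by auto
  moreover have "v \<noteq> PLeaf j" using below.prems by auto
  ultimately show ?case using delete_leaf_child[OF *] by auto
qed

section \<open>Weighted sums over all insertions of a leaf\<close>

locale insertion_weights =
  fixes \<alpha> \<gamma> :: real
begin

text \<open>The list stands for the subtrees to the right of the two leftmost ones, so that its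
  right end is the location of weight \<alpha> - \<gamma>.\<close>

primrec loc_sum :: "nat \<Rightarrow> (nat ptree list \<Rightarrow> real) \<Rightarrow> nat ptree list \<Rightarrow> real" where
  "loc_sum j F [] = (\<alpha> - \<gamma>) * F [PLeaf j]"
| "loc_sum j F (y # ys) = \<alpha> * F (PLeaf j # y # ys) + loc_sum j (\<lambda>u. F (y # u)) ys"

text \<open>
  \<open>ins_sum j f p\<close> is the sum of weight times \<open>f\<close> over all insertions of \<open>j\<close> into \<open>p\<close>, by recursion on the
  drawing rather than over the locations: edge above, locations at the root, subtrees.
\<close>

function (sequential) ins_sum :: "nat \<Rightarrow> (nat ptree \<Rightarrow> real) \<Rightarrow> nat ptree \<Rightarrow> real"
  and ins_sums :: "nat \<Rightarrow> (nat ptree list \<Rightarrow> real) \<Rightarrow> nat ptree list \<Rightarrow> real" where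
  "ins_sum j f (PLeaf i) = (1 - \<alpha>) * f (PNode [PLeaf i, PLeaf j])"
| "ins_sum j f (PNode ts) = \<gamma> * f (PNode [PNode ts, PLeaf j]) +
     (if 2 \<le> length ts then loc_sum j (\<lambda>u. f (PNode (take 2 ts @ u))) (drop 2 ts) else 0) +
     ins_sums j (\<lambda>u. f (PNode u)) ts"
| "ins_sums j F [] = 0"
| "ins_sums j F (y # ys) = ins_sum j (\<lambda>s. F (s # ys)) y + ins_sums j (\<lambda>u. F (y # u)) ys"
  by pat_completeness auto
termination
  by (relation "Wellfounded.measure (\<lambda>x. case x of Inl (j, f, p) \<Rightarrow> size p | Inr (j, F, ts) \<Rightarrow> size_list size ts)") auto

text \<open>Positions in an initial segment of the list; its right end belongs to what
  follows.\<close>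

primrec pre_sum :: "nat \<Rightarrow> (nat ptree list \<Rightarrow> real) \<Rightarrow> nat ptree list \<Rightarrow> real" where
  "pre_sum j F [] = 0"
| "pre_sum j F (y # ys) = \<alpha> * F (PLeaf j # y # ys) + pre_sum j (\<lambda>u. F (y # u)) ys"

lemma loc_sum_append:
  "loc_sum j F (us @ ws) = pre_sum j (\<lambda>w. F (w @ ws)) us + loc_sum j (\<lambda>w. F (us @ w)) ws"
  by (induction us arbitrary: F) (auto simp: algebra_simps)

lemma ins_sums_append:
  "ins_sums j F (us @ ws) = ins_sums j (\<lambda>w. F (w @ ws)) us + ins_sums j (\<lambda>w. F (us @ w)) ws"
  by (induction us arbitrary: F) (auto simp: algebra_simps)

lemma loc_sum_cong:
  assumes "\<And>u1 u2. zs = u1 @ u2 \<Longrightarrow> F (u1 @ PLeaf j # u2) = G (u1 @ PLeaf j # u2)"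
  shows "loc_sum j F zs = loc_sum j G zs"
  using assms
proof (induction zs arbitrary: F G)
  case Nil
  show ?case using Nil[of "[]" "[]"] by simp
next
  case (Cons y ys)
  have "loc_sum j (\<lambda>u. F (y # u)) ys = loc_sum j (\<lambda>u. G (y # u)) ys"
    using Cons.prems[of "y # _"] by (intro Cons.IH) simp
  then show ?case using Cons.prems[of "[]"] by simp
qed

lemma pre_sum_cong:
  assumes "\<And>u1 u2. zs = u1 @ u2 \<Longrightarrow> u2 \<noteq> [] \<Longrightarrow> F (u1 @ PLeaf j # u2) = G (u1 @ PLeaf j # u2)"
  shows "pre_sum j F zs = pre_sum j G zs"
  using assms
proof (induction zs arbitrary: F G)
  case (Cons y ys)
  have "pre_sum j (\<lambda>u. F (y # u)) ys = pre_sum j (\<lambda>u. G (y # u)) ys"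
    using Cons.prems[of "y # _"] by (intro Cons.IH) simp
  then show ?case using Cons.prems[of "[]"] by simp
qed simp

text \<open>Only drawings related by \<open>grown\<close> are ever passed to the test function. This
  reduces identities of sums to identities for single insertions.\<close>

lemma ins_sum_cong:
  "(\<And>q. grown j p q \<Longrightarrow> f q = g q) \<Longrightarrow> ins_sum j f p = ins_sum j g p"
  "(\<And>us v q vs. ts = us @ v # vs \<Longrightarrow> grown j v q \<Longrightarrow> F (us @ q # vs) = G (us @ q # vs)) \<Longrightarrow>
     ins_sums j F ts = ins_sums j G ts"
proof (induction j f p and j F ts arbitrary: g and G rule: ins_sum_ins_sums.induct)
  case (1 j f i)
  then show ?case by (simp add: grown.above)
next
  case (2 j f ts)
  have "ins_sums j (\<lambda>u. f (PNode u)) ts = ins_sums j (\<lambda>u. g (PNode u)) ts"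
    by (rule 2(1)) (auto intro!: 2(2) grown.below)
  moreover have "loc_sum j (\<lambda>u. f (PNode (take 2 ts @ u))) (drop 2 ts) =
     loc_sum j (\<lambda>u. g (PNode (take 2 ts @ u))) (drop 2 ts)" if True: "2 \<le> length ts"
  proof (rule loc_sum_cong)
      fix u1 u2 assume "drop 2 ts = u1 @ u2"
      then have *: "ts = (take 2 ts @ u1) @ u2" by (metis append.assoc append_take_drop_id)
      have "2 \<le> length (take 2 ts @ u1)" using True by simp
      then have "grown j (PNode ts) (PNode ((take 2 ts @ u1) @ PLeaf j # u2))"
        by (subst * ) (rule grown.at)
      then show "f (PNode (take 2 ts @ u1 @ PLeaf j # u2)) = g (PNode (take 2 ts @ u1 @ PLeaf j # u2))"
        using 2(2) by simp
  qed
  moreover have "f (PNode [PNode ts, PLeaf j]) = g (PNode [PNode ts, PLeaf j])"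
    by (rule 2(2)) (rule grown.above)
  ultimately show ?case by simp
next
  case (3 j F)
  then show ?case by simp
next
  case (4 j F y ys)
  have "ins_sum j (\<lambda>s. F (s # ys)) y = ins_sum j (\<lambda>s. G (s # ys)) y"
    using 4(3)[of "[]"] by (intro 4(1)) auto
  moreover have "ins_sums j (\<lambda>u. F (y # u)) ys = ins_sums j (\<lambda>u. G (y # u)) ys"
    using 4(3)[of "y # _"] by (intro 4(2)) auto
  ultimately show ?case by simp
qed

end

section \<open>The label that is killed\<close>

lemma spine_notin [simp]: "i \<notin> plabels p \<Longrightarrow> spine i p = []"
  by (induction p) auto

lemma spine_mid:
  assumes "drawing (PNode (xs @ v # ys))" "i \<in> plabels v"
  shows "spine i (PNode (xs @ v # ys)) = spine i v @ [PNode (xs @ v # ys)]"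
proof -
  have "concat (map (spine i) xs) = []" "concat (map (spine i) ys) = []"
    using drawing_PNode_others[OF assms] by auto
  moreover have "spine i (PNode (xs @ v # ys)) = concat (map (spine i) xs) @ spine i v @
      concat (map (spine i) ys) @ [PNode (xs @ v # ys)]"
    using assms(2) by simp
  ultimately show ?thesis by (simp only: append_Nil)
qed

lemma spine_nonempty: "i \<in> plabels p \<Longrightarrow> p \<noteq> PLeaf i \<Longrightarrow> spine i p \<noteq> []"
  by (cases p) auto

lemma least_label_of_bush_eq:
  assumes "finite B" "B \<noteq> {}" "\<And>t. t \<in> B \<Longrightarrow> drawing t"
  shows "least_label_of_bush B = Min (least_label ` B)"
  unfolding least_label_of_bush_def
proof (rule Min_eqI)
  show "finite (\<Union>(plabels ` B))" using assms by auto
next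
  fix y assume "y \<in> \<Union>(plabels ` B)"
  then obtain t where t: "t \<in> B" "y \<in> plabels t" by auto
  then have "Min (least_label ` B) \<le> least_label t" using assms by auto
  also have "\<dots> \<le> y" using t by (simp add: least_label_le)
  finally show "Min (least_label ` B) \<le> y" .
next
  have "Min (least_label ` B) \<in> least_label ` B" using assms by auto
  then show "Min (least_label ` B) \<in> \<Union>(plabels ` B)" using assms least_label_in by fastforce
qed

definition kill_label :: "nat \<Rightarrow> nat ptree \<Rightarrow> nat" where
  "kill_label i p = Max {i, a_label i p, b_label i p}"

text \<open>If \<open>deep i v\<close>, the down-step for \<open>i\<close> is determined by \<open>v\<close>, whatever \<open>v\<close> is part of: the second
  spinal bush is not needed or lies in \<open>v\<close>.\<close>

definition deep :: "'a \<Rightarrow> 'a ptree \<Rightarrow> bool" where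
  "deep i v \<longleftrightarrow> (\<exists>ts. v = PNode ts \<and> (PLeaf i \<in> set ts \<longrightarrow> 3 \<le> length ts))"

definition sibling_of_leaf :: "'a \<Rightarrow> 'a ptree \<Rightarrow> 'a ptree \<Rightarrow> bool" where
  "sibling_of_leaf i u v \<longleftrightarrow> v = PNode [PLeaf i, u] \<or> v = PNode [u, PLeaf i]"

lemma spinal_bush_child:
  assumes "drawing (PNode (xs @ v # ys))" "i \<in> plabels v" "r \<le> length (spine i v)" "1 \<le> r"
  shows "spinal_bush r i (PNode (xs @ v # ys)) = spinal_bush r i v"
proof -
  have "r - 1 < length (spine i v)" using assms(3,4) by simp
  then show ?thesis unfolding spinal_bush_def spine_mid[OF assms(1,2)] by (simp add: nth_append)
qed

lemma spinal_bush_last: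
  assumes "drawing (PNode (xs @ v # ys))" "i \<in> plabels v" "r = length (spine i v) + 1"
  shows "spinal_bush r i (PNode (xs @ v # ys)) = set (xs @ ys)"
  using drawing_PNode_others[OF assms(1,2)] assms(2,3)
  unfolding spinal_bush_def spine_mid[OF assms(1,2)] by auto

lemma a_label_child:
  assumes "drawing (PNode (xs @ v # ys))" "i \<in> plabels v" "v \<noteq> PLeaf i"
  shows "a_label i (PNode (xs @ v # ys)) = a_label i v"
  using spinal_bush_child[OF assms(1,2), of 1] spine_nonempty[OF assms(2,3)]
  by (simp add: a_label_def Suc_le_eq)

text \<open>If the parent of \<open>i\<close> has two children and \<open>v\<close> is
  \<open>deep\<close>, this parent lies strictly below \<open>v\<close>, so the branch point
  carrying the second bush is still in \<open>v\<close>.\<close>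

lemma b_label_child:
  assumes "drawing (PNode (xs @ v # ys))" "i \<in> plabels v" "deep i v"
  shows "b_label i (PNode (xs @ v # ys)) = b_label i v"
proof -
  let ?p = "PNode (xs @ v # ys)"
  have v: "v \<noteq> PLeaf i" using assms(3) by (auto simp: deep_def)
  have 0: "spine i ?p ! 0 = spine i v ! 0"
    using spine_nonempty[OF assms(2) v] spine_mid[OF assms(1,2)] by (simp add: nth_append)
  have a: "a_label i ?p = a_label i v" by (rule a_label_child[OF assms(1,2) v])
  have "2 \<le> length (spine i v)" if "length (psubs (spine i v ! 0)) = 2"
  proof -
    obtain ts where ts: "v = PNode ts" "PLeaf i \<in> set ts \<longrightarrow> 3 \<le> length ts"
      using assms(3) by (auto simp: deep_def)
    obtain us w vs where w: "ts = us @ w # vs" "i \<in> plabels w"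
      using assms(2) unfolding ts by (rule split_child)
    have dv: "drawing (PNode (us @ w # vs))" using assms(1) ts w by auto
    have s: "spine i v = spine i w @ [v]" using spine_mid[OF dv w(2)] ts w by simp
    have "w \<noteq> PLeaf i"
    proof
      assume "w = PLeaf i"
      then have "spine i v ! 0 = v" using s by simp
      then show False using that ts \<open>w = PLeaf i\<close> w by simp
    qed
    then show ?thesis using s spine_nonempty[OF w(2)] by (cases "spine i w") auto
  qed
  moreover from this have "spinal_bush 2 i ?p = spinal_bush 2 i v" if "length (psubs (spine i v ! 0)) = 2"
    using that spinal_bush_child[OF assms(1,2), of 2] by simp
  moreover have "length (spine i ?p) = Suc (length (spine i v))" using spine_mid[OF assms(1,2)] by simp
  ultimately show ?thesis
    unfolding b_label_def 0 a by (cases "length (psubs (spine i v ! 0)) = 2") (simp_all add: Let_def)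
qed

lemma kill_label_child:
  assumes "drawing (PNode (xs @ v # ys))" "i \<in> plabels v" "deep i v"
  shows "kill_label i (PNode (xs @ v # ys)) = kill_label i v"
  using a_label_child[OF assms(1,2)] b_label_child[OF assms] assms(3)
  by (auto simp: kill_label_def deep_def)

lemma spine_sibling:
  assumes "drawing v" "sibling_of_leaf i u v"
  shows "spine i v = [v]" "spinal_bush 1 i v = {u}" "i \<in> plabels v" "v \<noteq> PLeaf i"
    "length (psubs v) = 2" "i \<notin> plabels u" "drawing u"
proof -
  show "spine i v = [v]" "spinal_bush 1 i v = {u}" "i \<in> plabels v" "v \<noteq> PLeaf i"
    "length (psubs v) = 2" "i \<notin> plabels u" "drawing u"
    using assms by (auto simp: sibling_of_leaf_def spinal_bush_def)
qed

lemma a_label_sibling: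
  assumes "drawing v" "sibling_of_leaf i u v"
  shows "a_label i v = least_label u"
  unfolding a_label_def spine_sibling(2)[OF assms] by (simp add: least_label_of_bush_def least_label_def)

text \<open>There is no second bush here, so \<open>b\<close> takes the value 0.\<close>

lemma kill_label_root:
  assumes "drawing v" "sibling_of_leaf i u v"
  shows "kill_label i v = max i (least_label u)"
  unfolding kill_label_def a_label_sibling[OF assms] b_label_def spine_sibling(1)[OF assms]
  using spine_sibling(5)[OF assms] by (simp add: max_def)

text \<open>The second bush consists of the siblings of \<open>v\<close>. This is the case excluded
  by \<open>deep\<close>, where \<open>v\<close> alone does not determine the killed label.\<close>

lemma kill_label_binary:
  assumes "drawing (PNode (xs @ v # ys))" "sibling_of_leaf i u v"
  shows "kill_label i (PNode (xs @ v # ys)) =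
    Max {i, least_label u, Min (least_label ` set (xs @ ys))}"
proof -
  have dv: "drawing v" using assms(1) by simp
  note s = spine_sibling[OF dv assms(2)]
  have "b_label i (PNode (xs @ v # ys)) = least_label_of_bush (set (xs @ ys))"
    unfolding b_label_def spine_mid[OF assms(1) s(3)] s(1)
    using s(5) spinal_bush_last[OF assms(1) s(3), of 2] s(1) by simp
  also have "\<dots> = Min (least_label ` set (xs @ ys))"
    using assms(1) by (intro least_label_of_bush_eq) auto
  finally show ?thesis
    using a_label_child[OF assms(1) s(3,4)] a_label_sibling[OF dv assms(2)]
    by (simp add: kill_label_def)
qed

lemma drawing_leaf_facts:
  assumes "drawing (PNode (xs @ PLeaf i # ys))"
  shows "spine i (PNode (xs @ PLeaf i # ys)) = [PNode (xs @ PLeaf i # ys)]"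
    "spinal_bush 1 i (PNode (xs @ PLeaf i # ys)) = set (xs @ ys)"
    "a_label i (PNode (xs @ PLeaf i # ys)) = Min (least_label ` set (xs @ ys))"
    "takeWhile (\<lambda>s. s \<noteq> PLeaf i) (xs @ PLeaf i # ys) = xs"
    "tl (dropWhile (\<lambda>s. s \<noteq> PLeaf i) (xs @ PLeaf i # ys)) = ys"
proof -
  note o = drawing_PNode_others[OF assms, of i, simplified]
  show 1: "spine i (PNode (xs @ PLeaf i # ys)) = [PNode (xs @ PLeaf i # ys)]"
    using spine_mid[OF assms, of i] by simp
  show 2: "spinal_bush 1 i (PNode (xs @ PLeaf i # ys)) = set (xs @ ys)"
    using spinal_bush_last[OF assms, of i] by simp
  show "a_label i (PNode (xs @ PLeaf i # ys)) = Min (least_label ` set (xs @ ys))"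
    unfolding a_label_def 2 using assms by (intro least_label_of_bush_eq) auto
  show "takeWhile (\<lambda>s. s \<noteq> PLeaf i) (xs @ PLeaf i # ys) = xs"
    using o by (subst takeWhile_append2) auto
  show "tl (dropWhile (\<lambda>s. s \<noteq> PLeaf i) (xs @ PLeaf i # ys)) = ys"
    using o by (subst dropWhile_append2) auto
qed

text \<open>Leaf \<open>i\<close> is one of the two leftmost subtrees, so its rank is at most 2. The
  other one supplies \<open>a\<close> and the third subtree supplies \<open>b\<close>, which is
  largest because the two leading least labels are the smallest.\<close>

lemma kill_label_leaf_left:
  assumes "drawing (PNode (xs @ PLeaf i # ys))" "xs @ ys = u # w # zs" "length xs \<le> 1"
  shows "kill_label i (PNode (xs @ PLeaf i # ys)) = least_label w"
proof -
  let ?ts = "xs @ PLeaf i # ys"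
  have ts: "?ts = PLeaf i # u # w # zs \<or> ?ts = u # PLeaf i # w # zs"
    using assms(2,3) by (cases xs) auto
  have dd: "drawing (PNode (PLeaf i # u # w # zs)) \<or> drawing (PNode (u # PLeaf i # w # zs))"
    using assms(1) ts by metis
  then have lt: "least_label u < least_label t" "i < least_label t" if "t \<in> set (w # zs)" for t
    using that by auto
  have a: "a_label i (PNode ?ts) = least_label u"
    unfolding drawing_leaf_facts(3)[OF assms(1)] assms(2) using lt by (intro Min_eqI) force+
  have sub: "{s \<in> set ?ts. least_label s \<le> i} \<subseteq> {PLeaf i, u}"
  proof
    fix s assume s: "s \<in> {s \<in> set ?ts. least_label s \<le> i}"
    then have "s \<notin> set (w # zs)" using lt(2)[of s] by fastforce
    moreover have "set ?ts = {PLeaf i, u} \<union> set (w # zs)" using ts by (elim disjE) (simp_all add: insert_commute)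
    ultimately show "s \<in> {PLeaf i, u}" using s by blast
  qed
  have "card {s \<in> set ?ts. least_label s \<le> i} \<le> 2"
    using card_mono[OF _ sub] card_insert_le_m1[of 2 "{u}" "PLeaf i"] by simp
  moreover have "least_label (hd (filter (\<lambda>s. a_label i (PNode ?ts) \<notin> plabels s) ys)) = least_label w"
  proof -
    have "least_label u \<in> plabels u" "least_label u \<notin> plabels w"
      using dd least_label_in[of u] by auto
    then show ?thesis unfolding a using assms(2,3) by (cases xs) auto
  qed
  moreover have "length ?ts \<noteq> 2" using arg_cong[OF assms(2), of length] by simp
  ultimately have "b_label i (PNode ?ts) = least_label w"
    unfolding b_label_def drawing_leaf_facts(1)[OF assms(1)]
    using drawing_leaf_facts(4,5)[OF assms(1)] by (simp add: Let_def del: length_append)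
  then show ?thesis using a lt[of w] by (simp add: kill_label_def)
qed

text \<open>The two leading subtrees and \<open>i\<close> itself make the rank at least 3, and
  \<open>a\<close> is below \<open>i\<close>. So the left neighbour of \<open>i\<close> decides, and
  it matters only if it is not a leading subtree.\<close>

lemma kill_label_leaf_right:
  assumes "drawing (PNode (xs @ PLeaf i # ys))" "xs = u # w # zs"
  shows "kill_label i (PNode (xs @ PLeaf i # ys)) = (if zs = [] then i else max i (least_label (last zs)))"
proof -
  let ?ts = "xs @ PLeaf i # ys"
  let ?a = "a_label i (PNode ?ts)"
  have lt: "least_label u < least_label t" "least_label w < least_label t" if "t \<in> set (zs @ PLeaf i # ys)" for t
    using assms that by auto
  then have lti: "least_label u < i" "least_label w < i" by force+
  have a: "?a = min (least_label u) (least_label w)"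
    unfolding drawing_leaf_facts(3)[OF assms(1)] using lt assms(2) by (intro Min_eqI) (force simp: min_def)+
  have d: "drawing u" "drawing w" "plabels u \<inter> plabels w = {}" using assms by auto
  have lab: "least_label u \<in> plabels u" "least_label w \<in> plabels w" using d least_label_in by auto
  have "u \<noteq> w" "u \<noteq> PLeaf i" "w \<noteq> PLeaf i" using d lab lti by auto
  then have "card {u, w, PLeaf i} = 3" using lti by auto
  moreover have "{u, w, PLeaf i} \<subseteq> {s \<in> set ?ts. least_label s \<le> i}" using lti assms(2) by auto
  ultimately have "\<not> card {s \<in> set ?ts. least_label s \<le> i} \<le> 2"
    using card_mono[of "{s \<in> set ?ts. least_label s \<le> i}" "{u, w, PLeaf i}"] by simp
  moreover have "length ?ts \<noteq> 2" using assms(2) by auto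
  ultimately have b: "b_label i (PNode ?ts) = least_label (last (filter (\<lambda>s. ?a \<notin> plabels s) xs))"
    unfolding b_label_def drawing_leaf_facts(1)[OF assms(1)]
    using drawing_leaf_facts(4,5)[OF assms(1)] by (simp add: Let_def del: length_append)
  show ?thesis
  proof (cases "zs = []")
    case True
    \<comment> \<open>Dropping the subtree that contains \<open>a\<close> leaves the other leading
      one, whose least label is below \<open>i\<close>.\<close>
    have "last (filter (\<lambda>s. ?a \<notin> plabels s) xs) \<in> {u, w}"
      unfolding a using lab d(3) True assms(2) by (auto simp: min_def)
    then have "b_label i (PNode ?ts) < i" using b lti by auto
    then show ?thesis using a lti True by (simp add: kill_label_def min_def)
  next
    case False
    then have "last zs \<in> set zs" by simp
    then have "plabels (last zs) \<inter> plabels u = {}" "plabels (last zs) \<inter> plabels w = {}"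
      using assms by (auto simp: sorted_wrt_append)
    then have "?a \<notin> plabels (last zs)" unfolding a using lab by (auto simp: min_def)
    moreover have "xs = (u # w # butlast zs) @ [last zs]" using False assms(2) by simp
    ultimately have "last (filter (\<lambda>s. ?a \<notin> plabels s) xs) = last zs"
      by (metis (no_types, lifting) filter.simps filter_append last_snoc)
    then have "b_label i (PNode ?ts) = least_label (last zs)" using b by simp
    moreover have "?a < i" using a lti by (simp add: min_def)
    ultimately show ?thesis using False by (simp add: kill_label_def)
  qed
qed

lemma deepE:
  assumes "drawing p" "i \<in> plabels p" "p \<noteq> PLeaf i" "\<not> deep i p"
  obtains u where "sibling_of_leaf i u p"
proof -
  obtain ts where ts: "p = PNode ts" using assms by (cases p) auto
  then have "length ts = 2" "PLeaf i \<in> set ts" using assms by (auto simp: deep_def)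
  then obtain x y where "ts = [x, y]" "x = PLeaf i \<or> y = PLeaf i"
    by (auto simp: length_Suc_conv numeral_2_eq_2)
  then show thesis using that ts unfolding sibling_of_leaf_def by blast
qed

lemma delete_leaf_sibling:
  assumes "drawing v" "sibling_of_leaf i u v"
  shows "delete_leaf i v = u"
  using delete_leaf_parent[of "[]" i "[u]"] delete_leaf_parent[of "[u]" i "[]"] assms
  by (auto simp: sibling_of_leaf_def)

section \<open>Insertion followed by the down-step\<close>

text \<open>
  When the inserted leaf \<open>j\<close> is killed, the original drawing comes back only up to the order of two
  leftmost subtrees, which carries no information.
\<close>

inductive swapped :: "nat \<Rightarrow> nat ptree \<Rightarrow> nat ptree \<Rightarrow> bool" for j where
  swap: "drawing x \<Longrightarrow> \<forall>k\<in>plabels x. k < j \<Longrightarrow>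
    swapped j (PNode (x # PLeaf j # zs)) (PNode (PLeaf j # x # zs))"
| inside: "swapped j v w \<Longrightarrow> swapped j (PNode (us @ v # vs)) (PNode (us @ w # vs))"

lemma map_ptree_transpose_id:
  "i \<notin> plabels t \<Longrightarrow> j \<notin> plabels t \<Longrightarrow> map_ptree (Transposition.transpose i j) t = t"
  by (rule ptree.map_ident_strong) (auto simp: Transposition.transpose_def)

lemma map_transpose_mid:
  assumes "drawing (PNode (xs @ v # ys))" "i \<in> plabels v" "\<forall>k\<in>plabels (PNode (xs @ v # ys)). k < j"
  shows "map_ptree (Transposition.transpose i j) (PNode (xs @ v # ys)) =
    PNode (xs @ map_ptree (Transposition.transpose i j) v # ys)"
  using drawing_PNode_others[OF assms(1,2)] assms(3)
  by (auto intro!: map_idI map_ptree_transpose_id)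

lemma Min_grow:
  assumes "finite A" "A \<noteq> {}" "\<forall>a\<in>A. a < (j::nat)"
  shows "Min (insert j A) = Min A"
  using assms Min_in[OF assms(1,2)] by (simp add: min_def) force

context insertion_weights
begin

definition locs_sum :: "nat \<Rightarrow> (nat ptree list \<Rightarrow> real) \<Rightarrow> nat ptree list \<Rightarrow> real" where
  "locs_sum j F ts = (if 2 \<le> length ts then loc_sum j (\<lambda>u. F (take 2 ts @ u)) (drop 2 ts) else 0)"

lemma ins_sum_PNode:
  "ins_sum j f (PNode ts) = \<gamma> * f (PNode [PNode ts, PLeaf j]) +
     locs_sum j (\<lambda>u. f (PNode u)) ts + ins_sums j (\<lambda>u. f (PNode u)) ts"
  by (simp add: locs_sum_def)

lemma ins_sums_mid:
  "ins_sums j F (xs @ v # ys) = ins_sums j (\<lambda>w. F (w @ v # ys)) xs +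
     ins_sum j (\<lambda>s. F (xs @ s # ys)) v + ins_sums j (\<lambda>w. F (xs @ v # w)) ys"
  by (simp add: ins_sums_append)

text \<open>Insertion positions start after the two leftmost subtrees. Hence the cases:
  \<open>v\<close> is first, second, or further right with positions on both sides of it.\<close>

lemma locs_sum_replace:
  assumes "\<And>a b. xs = a @ b \<Longrightarrow> 2 \<le> length a \<Longrightarrow>
      F ((a @ PLeaf j # b) @ v # ys) = G ((a @ PLeaf j # b) @ w # ys)"
    and "\<And>a b. ys = a @ b \<Longrightarrow> 2 \<le> length (xs @ v # a) \<Longrightarrow>
      F (xs @ v # a @ PLeaf j # b) = G (xs @ w # a @ PLeaf j # b)"
  shows "locs_sum j F (xs @ v # ys) = locs_sum j G (xs @ w # ys)"
proof -
  consider "xs = []" | x where "xs = [x]" | x y us where "xs = x # y # us"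
    by (cases xs; cases "tl xs") auto
  then show ?thesis
  proof cases
    case 1
    show ?thesis
    proof (cases ys)
      case (Cons z zs)
      have "loc_sum j (\<lambda>u. F (v # z # u)) zs = loc_sum j (\<lambda>u. G (w # z # u)) zs"
        using assms(2)[of "z # _"] 1 Cons by (intro loc_sum_cong) simp
      then show ?thesis using 1 Cons by (simp add: locs_sum_def numeral_2_eq_2)
    qed (simp add: 1 locs_sum_def)
  next
    case 2
    have "loc_sum j (\<lambda>u. F (x # v # u)) ys = loc_sum j (\<lambda>u. G (x # w # u)) ys"
      using assms(2) 2 by (intro loc_sum_cong) simp
    then show ?thesis using 2 by (simp add: locs_sum_def numeral_2_eq_2)
  next
    case 3
    have "pre_sum j (\<lambda>u. F (x # y # u @ v # ys)) us = pre_sum j (\<lambda>u. G (x # y # u @ w # ys)) us"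
      using assms(1)[of "x # y # _"] 3 by (intro pre_sum_cong) simp
    moreover have "F (x # y # us @ PLeaf j # v # ys) = G (x # y # us @ PLeaf j # w # ys)"
      using assms(1)[of xs "[]"] 3 by simp
    moreover have "loc_sum j (\<lambda>u. F (x # y # us @ v # u)) ys = loc_sum j (\<lambda>u. G (x # y # us @ w # u)) ys"
      using assms(2) 3 by (intro loc_sum_cong) simp
    ultimately show ?thesis using 3 by (simp add: locs_sum_def numeral_2_eq_2 loc_sum_append)
  qed
qed

text \<open>Insertions into the distinguished child are subtracted on both sides; they are treated
  separately, by induction or by \<open>ins_sum_sibling\<close>.\<close>

lemma ins_sums_replace:
  assumes "\<And>us s q vs. xs = us @ s # vs \<Longrightarrow> grown j s q \<Longrightarrow>
      F ((us @ q # vs) @ v # ys) = G ((us @ q # vs) @ w # ys)"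
    and "\<And>us s q vs. ys = us @ s # vs \<Longrightarrow> grown j s q \<Longrightarrow>
      F (xs @ v # us @ q # vs) = G (xs @ w # us @ q # vs)"
  shows "ins_sums j F (xs @ v # ys) - ins_sum j (\<lambda>s. F (xs @ s # ys)) v =
    ins_sums j G (xs @ w # ys) - ins_sum j (\<lambda>s. G (xs @ s # ys)) w"
proof -
  have "ins_sums j (\<lambda>u. F (u @ v # ys)) xs = ins_sums j (\<lambda>u. G (u @ w # ys)) xs"
    using assms(1) by (intro ins_sum_cong(2)) simp
  moreover have "ins_sums j (\<lambda>u. F (xs @ v # u)) ys = ins_sums j (\<lambda>u. G (xs @ w # u)) ys"
    using assms(2) by (intro ins_sum_cong(2)) simp
  ultimately show ?thesis by (simp add: ins_sums_mid)
qed

text \<open>Insertions outside \<open>v\<close> commute with the down-step for a leaf inside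
  \<open>v\<close>. The killed label is either determined by \<open>v\<close> or involves the
  minimum over the siblings of \<open>v\<close>, and the new largest label does not change that
  minimum.\<close>

lemma ins_sum_frame:
  fixes h :: "nat \<Rightarrow> nat ptree \<Rightarrow> real" and i :: nat
  defines "\<Phi> \<equiv> \<lambda>q. h (kill_label i q) (delete_leaf i q)"
  assumes d: "drawing (PNode (xs @ v # ys))" and i: "i \<in> plabels v" "v \<noteq> PLeaf i"
    and j: "\<forall>k\<in>plabels (PNode (xs @ v # ys)). k < j"
    and k: "k = kill_label i (PNode (xs @ v # ys))"
  shows "ins_sum j \<Phi> (PNode (xs @ v # ys)) - ins_sum j (\<lambda>s. \<Phi> (PNode (xs @ s # ys))) v =
    ins_sum j (h k) (PNode (xs @ delete_leaf i v # ys)) -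
    ins_sum j (\<lambda>s. h k (PNode (xs @ s # ys))) (delete_leaf i v)"
proof -
  let ?p = "PNode (xs @ v # ys)" and ?w = "delete_leaf i v"
  have dv: "drawing v" using d by simp
  have w: "?w \<noteq> PLeaf i" using delete_leaf_not_PLeaf[OF dv i(2)] .
  have main: "\<Phi> (PNode (xs' @ v # ys')) = h k (PNode (xs' @ ?w # ys'))"
    if "grown j ?p (PNode (xs' @ v # ys'))"
      "least_label ` set (xs' @ ys') = least_label ` set (xs @ ys) \<or>
       least_label ` set (xs' @ ys') = insert j (least_label ` set (xs @ ys))" for xs' ys'
  proof -
    have d': "drawing (PNode (xs' @ v # ys'))" by (rule grown_drawing[OF that(1) d j])
    have "xs @ ys \<noteq> []" using d by auto
    moreover have "\<forall>k \<in> least_label ` set (xs @ ys). k < j" using d j least_label_in by force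
    ultimately have m: "Min (least_label ` set (xs' @ ys')) = Min (least_label ` set (xs @ ys))"
      using that(2) Min_grow[of "least_label ` set (xs @ ys)" j] by fastforce
    have "kill_label i (PNode (xs' @ v # ys')) = k"
    proof (cases "deep i v")
      case True
      then show ?thesis using kill_label_child[OF d i(1)] kill_label_child[OF d' i(1)] k by simp
    next
      case False
      then obtain u where "sibling_of_leaf i u v" using deepE[OF dv i] by blast
      then show ?thesis using kill_label_binary[OF d] kill_label_binary[OF d'] k m by simp
    qed
    then show ?thesis unfolding \<Phi>_def using delete_leaf_child[OF d' i(1) w] by simp
  qed
  have "locs_sum j (\<lambda>u. \<Phi> (PNode u)) (xs @ v # ys) = locs_sum j (\<lambda>u. h k (PNode u)) (xs @ ?w # ys)"
  proof (rule locs_sum_replace)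
    fix a b assume *: "xs = a @ b" "2 \<le> length a"
    show "\<Phi> (PNode ((a @ PLeaf j # b) @ v # ys)) = h k (PNode ((a @ PLeaf j # b) @ ?w # ys))"
      using grown.at[of a j "b @ v # ys"] * by (intro main) auto
  next
    fix a b assume *: "ys = a @ b" "2 \<le> length (xs @ v # a)"
    show "\<Phi> (PNode (xs @ v # a @ PLeaf j # b)) = h k (PNode (xs @ ?w # a @ PLeaf j # b))"
      using grown.at[of "xs @ v # a" j b] * by (intro main) auto
  qed
  moreover have "ins_sums j (\<lambda>u. \<Phi> (PNode u)) (xs @ v # ys) - ins_sum j (\<lambda>s. \<Phi> (PNode (xs @ s # ys))) v =
      ins_sums j (\<lambda>u. h k (PNode u)) (xs @ ?w # ys) - ins_sum j (\<lambda>s. h k (PNode (xs @ s # ys))) ?w"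
  proof (rule ins_sums_replace)
    fix us s q vs assume *: "xs = us @ s # vs" "grown j s q"
    have "least_label q = least_label s" using * d j by (intro grown_least_label) auto
    then show "\<Phi> (PNode ((us @ q # vs) @ v # ys)) = h k (PNode ((us @ q # vs) @ ?w # ys))"
      using grown.below[OF *(2), of us "vs @ v # ys"] * by (intro main) auto
  next
    fix us s q vs assume *: "ys = us @ s # vs" "grown j s q"
    have "least_label q = least_label s" using * d j by (intro grown_least_label) auto
    then show "\<Phi> (PNode (xs @ v # us @ q # vs)) = h k (PNode (xs @ ?w # us @ q # vs))"
      using grown.below[OF *(2), of "xs @ v # us" "vs"] * by (intro main) auto
  qed
  moreover have root: "\<Phi> (PNode [?p, PLeaf j]) = h k (PNode [PNode (xs @ ?w # ys), PLeaf j])"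
  proof -
    have d2: "drawing (PNode ([] @ ?p # [PLeaf j]))" using d j by auto
    \<comment> \<open>Insertion above the whole tree: as \<open>i\<close> is not a child of its top
      branch point, the second bush does not come from the new one.\<close>
    have "PLeaf i \<notin> set (xs @ v # ys)" using drawing_PNode_others[OF d i(1)] i by auto
    then have "deep i ?p" by (auto simp: deep_def)
    then have "kill_label i (PNode ([] @ ?p # [PLeaf j])) = k"
      using kill_label_child[OF d2] i(1) k by simp
    moreover have "delete_leaf i (PNode ([] @ ?p # [PLeaf j])) = PNode [PNode (xs @ ?w # ys), PLeaf j]"
      using delete_leaf_child[OF d2, of i] delete_leaf_child[OF d i(1) w] i(1) by simp
    ultimately show ?thesis by (simp add: \<Phi>_def)
  qed
  ultimately show ?thesis unfolding ins_sum_PNode root by linarith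
qed

text \<open>The three ways of attaching \<open>j\<close> near a leaf \<open>i\<close> with a single sibling have total weight 1.\<close>

lemma ins_sum_sibling:
  fixes \<Phi> :: "nat ptree \<Rightarrow> real"
  assumes d: "drawing v" and s: "sibling_of_leaf i u v" and j: "\<forall>k\<in>plabels v. k < j"
    and 1: "\<And>q. kill_label i q = j \<Longrightarrow> deep i q \<Longrightarrow> grown j v q \<Longrightarrow> \<Phi> q = g (delete_leaf i q)"
    and 2: "\<And>q r. sibling_of_leaf i r q \<Longrightarrow> grown j v q \<Longrightarrow> grown j u r \<Longrightarrow> \<Phi> q = f r"
    and g: "\<And>q q'. swapped j q q' \<Longrightarrow> g q = g q'"
  shows "ins_sum j \<Phi> v = g (map_ptree (Transposition.transpose i j) v) + ins_sum j f u"
proof -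
  note u = spine_sibling(6,7)[OF d s]
  have lt: "\<forall>k\<in>plabels u. k < j" "i < j" using s j by (auto simp: sibling_of_leaf_def)
  then have ju: "j \<notin> plabels u" by auto
  have mu: "map_ptree (Transposition.transpose i j) u = u" using u ju by (rule_tac map_ptree_transpose_id)
  \<comment> \<open>Deleting \<open>i\<close> leaves \<open>u\<close> and \<open>j\<close> side by
    side, in an order that \<open>g\<close> does not see.\<close>
  have sw: "g (PNode [u, PLeaf j]) = g (PNode [PLeaf j, u])"
    using swapped.swap[of u j "[]"] u lt by (intro g) simp
  \<comment> \<open>The three ways are the edge above \<open>v\<close> (\<gamma>), the only location
    at \<open>v\<close> (\<alpha> - \<gamma>) and the edge above leaf \<open>i\<close> (1 -
    \<alpha>); the last two alternatives are the third way for the two orders of \<open>i\<close>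
    and \<open>u\<close>. In each of them \<open>j\<close> supplies \<open>a\<close> or
    \<open>b\<close>.\<close>
  have val: "\<Phi> q = g (delete_leaf i q)" if gq: "grown j v q" and qq: "q = PNode [v, PLeaf j] \<or> q = PNode (psubs v @ [PLeaf j])
     \<or> q = PNode [PNode [PLeaf i, PLeaf j], u] \<or> q = PNode [u, PNode [PLeaf i, PLeaf j]]" for q
  proof (rule 1)
    have dq: "drawing q" by (rule grown_drawing[OF gq d j])
    show "deep i q" using qq s u lt by (auto simp: deep_def sibling_of_leaf_def)
    show "grown j v q" by fact
    have lu: "least_label u < j" using lt least_label_in u by auto
    consider "q = PNode ([] @ v # [PLeaf j])" | "q = PNode (psubs v @ [PLeaf j])"
      | "q = PNode ([] @ PNode [PLeaf i, PLeaf j] # [u])" | "q = PNode ([u] @ PNode [PLeaf i, PLeaf j] # [])"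
      using qq by auto
    then show "kill_label i q = j"
    proof cases
      case 1
      then show ?thesis using kill_label_binary[of "[]" v "[PLeaf j]" i u] dq s lt lu by (simp add: max_def)
    next
      case 2
      then have "q = PNode ([] @ PLeaf i # [u, PLeaf j]) \<or> q = PNode ([u] @ PLeaf i # [PLeaf j])"
        using s by (auto simp: sibling_of_leaf_def)
      then show ?thesis
        using kill_label_leaf_left[of "[]" i "[u, PLeaf j]"] kill_label_leaf_left[of "[u]" i "[PLeaf j]"] dq
        by auto
    next
      case 3
      then show ?thesis using kill_label_binary[of "[]" "PNode [PLeaf i, PLeaf j]" "[u]" i "PLeaf j"] dq lt lu
        by (simp add: max_def sibling_of_leaf_def)
    next
      case 4
      then show ?thesis using kill_label_binary[of "[u]" "PNode [PLeaf i, PLeaf j]" "[]" i "PLeaf j"] dq lt lu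
        by (simp add: max_def sibling_of_leaf_def)
    qed
  qed
  have dl: "delete_leaf i (PNode [PLeaf i, PLeaf j]) = PLeaf j"
    using delete_leaf_parent[of "[]" i "[PLeaf j]"] lt by simp
  have g1: "grown j v (PNode [v, PLeaf j])" by (rule grown.above)
  have d1: "drawing (PNode ([] @ v # [PLeaf j]))" using grown_drawing[OF g1 d j] by simp
  have dv: "delete_leaf i v = u" by (rule delete_leaf_sibling[OF d s])
  have "u \<noteq> PLeaf i" using u by auto
  then have "delete_leaf i (PNode [v, PLeaf j]) = PNode [u, PLeaf j]"
    using delete_leaf_child[OF d1, of i] dv spine_sibling(3)[OF d s] by simp
  then have e1: "\<Phi> (PNode [v, PLeaf j]) = g (PNode [u, PLeaf j])" using val[OF g1] by simp
  have s2: "v = PNode (psubs v)" "length (psubs v) = 2" using s by (auto simp: sibling_of_leaf_def)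
  have g2: "grown j v (PNode (psubs v @ [PLeaf j]))"
    using grown.at[of "psubs v" j "[]"] s2 by simp
  have d2: "drawing (PNode (psubs v @ [PLeaf j]))" using grown_drawing[OF g2 d j] by simp
  have "delete_leaf i (PNode (psubs v @ [PLeaf j])) = PNode [u, PLeaf j]"
    using delete_leaf_parent[of "[]" i "[u, PLeaf j]"] delete_leaf_parent[of "[u]" i "[PLeaf j]"] s d2
    by (auto simp: sibling_of_leaf_def)
  then have e2: "\<Phi> (PNode (psubs v @ [PLeaf j])) = g (PNode [u, PLeaf j])" using val[OF g2] by simp
  from s show ?thesis unfolding sibling_of_leaf_def
  proof
    assume v: "v = PNode [PLeaf i, u]"
    have g3: "grown j v (PNode [PNode [PLeaf i, PLeaf j], u])"
      using grown.below[of j "PLeaf i" "PNode [PLeaf i, PLeaf j]" "[]" "[u]"] v by (simp add: grown.above)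
    have "delete_leaf i (PNode [PNode [PLeaf i, PLeaf j], u]) = PNode [PLeaf j, u]"
      using delete_leaf_child[of "[]" "PNode [PLeaf i, PLeaf j]" "[u]" i] grown_drawing[OF g3 d j] dl lt by simp
    then have e3: "\<Phi> (PNode [PNode [PLeaf i, PLeaf j], u]) = g (PNode [u, PLeaf j])" using val[OF g3] sw by simp
    have "ins_sum j (\<lambda>s. \<Phi> (PNode [PLeaf i, s])) u = ins_sum j f u"
      using grown.below[of j u _ "[PLeaf i]" "[]"] v
      by (intro ins_sum_cong(1) 2) (auto simp: sibling_of_leaf_def)
    then show ?thesis using e1 e2 e3 v mu sw lt
      by (simp add: ins_sum_PNode locs_sum_def algebra_simps)
  next
    assume v: "v = PNode [u, PLeaf i]"
    have g3: "grown j v (PNode [u, PNode [PLeaf i, PLeaf j]])"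
      using grown.below[of j "PLeaf i" "PNode [PLeaf i, PLeaf j]" "[u]" "[]"] v by (simp add: grown.above)
    have "delete_leaf i (PNode [u, PNode [PLeaf i, PLeaf j]]) = PNode [u, PLeaf j]"
      using delete_leaf_child[of "[u]" "PNode [PLeaf i, PLeaf j]" "[]" i] grown_drawing[OF g3 d j] dl lt by simp
    then have e3: "\<Phi> (PNode [u, PNode [PLeaf i, PLeaf j]]) = g (PNode [u, PLeaf j])" using val[OF g3] sw by simp
    have "ins_sum j (\<lambda>s. \<Phi> (PNode [s, PLeaf i])) u = ins_sum j f u"
      using grown.below[of j u _ "[]" "[PLeaf i]"] v
      by (intro ins_sum_cong(1) 2) (auto simp: sibling_of_leaf_def)
    then show ?thesis using e1 e2 e3 v mu sw lt
      by (simp add: ins_sum_PNode locs_sum_def algebra_simps)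
  qed
qed

text \<open>With at least two siblings, deletion of \<open>i\<close> leaves the branch point in
  place with one location fewer. The surplus location, of weight \<alpha>, and the edge above
  \<open>i\<close>, of weight 1 - \<alpha>, kill \<open>j\<close>; all other insertions correspond
  to each other in order.\<close>

lemma ins_sum_near_leaf:
  fixes h :: "nat \<Rightarrow> nat ptree \<Rightarrow> real" and i :: nat
  defines "\<Phi> \<equiv> \<lambda>q. h (kill_label i q) (delete_leaf i q)"
  assumes d: "drawing (PNode (xs @ PLeaf i # ys))" and l: "2 \<le> length (xs @ ys)"
    and j: "\<forall>k\<in>plabels (PNode (xs @ PLeaf i # ys)). k < j"
    and k: "k = kill_label i (PNode (xs @ PLeaf i # ys))"
    and h: "\<And>q q'. swapped j q q' \<Longrightarrow> h j q = h j q'"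
  shows "ins_sum j \<Phi> (PNode (xs @ PLeaf i # ys)) =
    h j (PNode (xs @ PLeaf j # ys)) + ins_sum j (h k) (PNode (xs @ ys))"
proof -
  let ?p = "PNode (xs @ PLeaf i # ys)"
  have main: "\<Phi> (PNode (xs' @ PLeaf i # ys')) = h k' (PNode (xs' @ ys'))"
    if "grown j ?p (PNode (xs' @ PLeaf i # ys'))" "2 \<le> length (xs' @ ys')"
      "kill_label i (PNode (xs' @ PLeaf i # ys')) = k'" for xs' ys' k'
    unfolding \<Phi>_def using delete_leaf_parent3[OF grown_drawing[OF that(1) d j] that(2)] that(3) by simp
  have root: "\<Phi> (PNode [?p, PLeaf j]) = h k (PNode [PNode (xs @ ys), PLeaf j])"
  proof -
    have d2: "drawing (PNode ([] @ ?p # [PLeaf j]))" using d j by auto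
    have "deep i ?p" using l by (auto simp: deep_def)
    then have "kill_label i (PNode ([] @ ?p # [PLeaf j])) = k"
      using kill_label_child[OF d2] k by simp
    moreover have "delete_leaf i (PNode ([] @ ?p # [PLeaf j])) = PNode [PNode (xs @ ys), PLeaf j]"
      using delete_leaf_child[OF d2, of i] delete_leaf_parent3[OF d l] by simp
    ultimately show ?thesis by (simp add: \<Phi>_def)
  qed
  have ij: "i < j" using j by simp
  have "grown j ?p (PNode (xs @ PNode [PLeaf i, PLeaf j] # ys))"
    by (intro grown.below grown.above)
  from grown_drawing[OF this d j]
  have dij: "drawing (PNode (xs @ PNode [PLeaf i, PLeaf j] # ys))" .
  have leaf: "\<Phi> (PNode (xs @ PNode [PLeaf i, PLeaf j] # ys)) = h j (PNode (xs @ PLeaf j # ys))"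
  proof -
    have "delete_leaf i (PNode [PLeaf i, PLeaf j]) = PLeaf j"
      using delete_leaf_parent[of "[]" i "[PLeaf j]"] ij by simp
    then have "delete_leaf i (PNode (xs @ PNode [PLeaf i, PLeaf j] # ys)) = PNode (xs @ PLeaf j # ys)"
      using delete_leaf_child[OF dij, of i] ij by simp
    moreover have "Min (least_label ` set (xs @ ys)) < j"
    proof -
      have "xs @ ys \<noteq> []" using l by auto
      then have "Min (least_label ` set (xs @ ys)) \<in> least_label ` set (xs @ ys)" by (intro Min_in) auto
      then show ?thesis using d j least_label_in by force
    qed
    then have "kill_label i (PNode (xs @ PNode [PLeaf i, PLeaf j] # ys)) = j"
      using kill_label_binary[OF dij, of i "PLeaf j"] ij by (simp add: sibling_of_leaf_def max_def)
    ultimately show ?thesis by (simp add: \<Phi>_def)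
  qed
  have kids_locs: "ins_sums j (\<lambda>w. \<Phi> (PNode (w @ PLeaf i # ys))) xs + ins_sums j (\<lambda>w. \<Phi> (PNode (xs @ PLeaf i # w))) ys =
      ins_sums j (\<lambda>u. h k (PNode u)) (xs @ ys) \<and>
      locs_sum j (\<lambda>u. \<Phi> (PNode u)) (xs @ PLeaf i # ys) =
      \<alpha> * h j (PNode (xs @ PLeaf j # ys)) + locs_sum j (\<lambda>u. h k (PNode u)) (xs @ ys)"
  proof (cases "length xs \<le> 1")
    \<comment> \<open>Leaf \<open>i\<close> is leading: the surplus location is the first one, just
      right of the two leftmost subtrees.\<close>
    case True
    obtain u w zs where uwz: "xs @ ys = u # w # zs" using l by (cases "xs @ ys"; cases "tl (xs @ ys)") auto
    have kw: "k = least_label w" using kill_label_leaf_left[OF d uwz True] k by simp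
    have kill: "kill_label i (PNode (xs' @ PLeaf i # ys')) = least_label ((xs' @ ys') ! 1)"
      if "grown j ?p (PNode (xs' @ PLeaf i # ys'))" "2 \<le> length (xs' @ ys')" "length xs' \<le> 1" for xs' ys'
    proof -
      obtain u' w' zs' where "xs' @ ys' = u' # w' # zs'"
        using \<open>2 \<le> length (xs' @ ys')\<close> by (cases "xs' @ ys'"; cases "tl (xs' @ ys')") auto
      then show ?thesis using kill_label_leaf_left[OF grown_drawing[OF that(1) d j] _ that(3)] by simp
    qed
    have kids: "\<Phi> (PNode (xs' @ PLeaf i # ys')) = h k (PNode (xs' @ ys'))"
      if "grown j ?p (PNode (xs' @ PLeaf i # ys'))" "length (xs' @ ys') = length (xs @ ys)" "length xs' = length xs"
        "least_label ((xs' @ ys') ! 1) = least_label ((xs @ ys) ! 1)" for xs' ys'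
      using kill[OF that(1)] that l True kw uwz by (intro main) auto
    have "\<Phi> (PNode ((us @ q # vs) @ PLeaf i # ys)) = h k (PNode ((us @ q # vs) @ ys))"
      if "xs = us @ s # vs" "grown j s q" for us s q vs
    proof -
      have "least_label q = least_label s" using that d j by (intro grown_least_label) auto
      then show ?thesis using grown.below[OF that(2), of us "vs @ PLeaf i # ys"] that
        by (intro kids) (auto simp: nth_append nth_Cons split: nat.splits)
    qed
    then have 1: "ins_sums j (\<lambda>w. \<Phi> (PNode (w @ PLeaf i # ys))) xs = ins_sums j (\<lambda>w. h k (PNode (w @ ys))) xs"
      by (intro ins_sum_cong(2)) simp
    have "\<Phi> (PNode (xs @ PLeaf i # us @ q # vs)) = h k (PNode (xs @ us @ q # vs))"
      if "ys = us @ s # vs" "grown j s q" for us s q vs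
    proof -
      have "least_label q = least_label s" using that d j by (intro grown_least_label) auto
      then show ?thesis using grown.below[OF that(2), of "xs @ PLeaf i # us" vs] that
        by (intro kids) (auto simp: nth_append nth_Cons split: nat.splits)
    qed
    then have 2: "ins_sums j (\<lambda>w. \<Phi> (PNode (xs @ PLeaf i # w))) ys = ins_sums j (\<lambda>w. h k (PNode (xs @ w))) ys"
      by (intro ins_sum_cong(2)) simp
    have pre: "xs = [] \<and> ys = u # w # zs \<or> xs = [u] \<and> ys = w # zs"
      using uwz True by (cases xs) auto
    \<comment> \<open>\<open>take (1 - length xs) ys\<close> is \<open>[u]\<close> if
      \<open>i\<close> comes first and empty if \<open>i\<close> comes second, so both orders are
      treated at once.\<close>
    have t2: "take 2 (xs @ PLeaf i # ys) = xs @ PLeaf i # take (1 - length xs) ys"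
        "xs @ take (1 - length xs) ys = [u]" "drop 2 (xs @ PLeaf i # ys) = w # zs" using pre by auto
    have eq: "xs @ PLeaf i # ys = (xs @ PLeaf i # take (1 - length xs) ys) @ w # zs" using pre by auto
    have len: "2 \<le> length (xs @ PLeaf i # take (1 - length xs) ys)" using pre by auto
    have G0: "\<Phi> (PNode (xs @ PLeaf i # take (1 - length xs) ys @ PLeaf j # w # zs)) = h j (PNode (u # PLeaf j # w # zs))"
    proof -
      have "grown j ?p (PNode (xs @ PLeaf i # take (1 - length xs) ys @ PLeaf j # w # zs))"
        using grown.at[OF len, of j "w # zs"] eq by simp
      from main[OF this _ kill[OF this]] show ?thesis using pre by auto
    qed
    have G1: "\<Phi> (PNode (xs @ PLeaf i # take (1 - length xs) ys @ w # a @ PLeaf j # b)) = h k (PNode (u # w # a @ PLeaf j # b))"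
      if "zs = a @ b" for a b
    proof -
      have "grown j ?p (PNode (xs @ PLeaf i # take (1 - length xs) ys @ w # a @ PLeaf j # b))"
        using grown.at[of "xs @ PLeaf i # take (1 - length xs) ys @ w # a" j b] eq len that by simp
      from main[OF this _ kill[OF this]] show ?thesis using pre kw by auto
    qed
    have "locs_sum j (\<lambda>u. \<Phi> (PNode u)) (xs @ PLeaf i # ys) =
       \<alpha> * h j (PNode (u # PLeaf j # w # zs)) +
       loc_sum j (\<lambda>z. \<Phi> (PNode (xs @ PLeaf i # take (1 - length xs) ys @ w # z))) zs"
      unfolding locs_sum_def t2 using G0 l by simp
    also have "loc_sum j (\<lambda>z. \<Phi> (PNode (xs @ PLeaf i # take (1 - length xs) ys @ w # z))) zs =
        loc_sum j (\<lambda>z. h k (PNode (u # w # z))) zs"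
      using G1 by (intro loc_sum_cong) simp
    also have "\<dots> = locs_sum j (\<lambda>u. h k (PNode u)) (xs @ ys)" by (simp add: uwz locs_sum_def numeral_2_eq_2)
    \<comment> \<open>If \<open>i\<close> was first, deletion moves \<open>u\<close> to the front
      with \<open>j\<close> behind it, while relabelling \<open>i\<close> as \<open>j\<close> puts
      \<open>j\<close> in front: exactly a \<open>swapped\<close> pair.\<close>
    also have "h j (PNode (u # PLeaf j # w # zs)) = h j (PNode (xs @ PLeaf j # ys))"
    proof (cases xs)
      case Nil
      have "drawing u" "\<forall>k\<in>plabels u. k < j" using pre Nil d j by auto
      then show ?thesis using h[OF swapped.swap[of u j "w # zs"]] pre Nil by auto
    qed (use pre in auto)
    finally show ?thesis using 1 2 by (simp add: ins_sums_append)
  next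
    \<comment> \<open>Leaf \<open>i\<close> stands further right: the surplus location is the one
      just left of \<open>i\<close>.\<close>
    case False
    obtain u w zs where uwz: "xs = u # w # zs" using False by (cases xs; cases "tl xs") auto
    have kz: "k = (if zs = [] then i else max i (least_label (last zs)))"
      using kill_label_leaf_right[OF d uwz] k by simp
    have kids: "\<Phi> (PNode (xs' @ PLeaf i # ys')) = h k' (PNode (xs' @ ys'))"
      if "grown j ?p (PNode (xs' @ PLeaf i # ys'))" "xs' = u' # w' # zs'"
        "k' = (if zs' = [] then i else max i (least_label (last zs')))" for xs' ys' u' w' zs' k'
      using kill_label_leaf_right[OF grown_drawing[OF that(1) d j] that(2)] that by (intro main) auto
    have "\<Phi> (PNode ((us @ q # vs) @ PLeaf i # ys)) = h k (PNode ((us @ q # vs) @ ys))"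
      if "xs = us @ s # vs" "grown j s q" for us s q vs
    proof -
      have ll: "least_label q = least_label s" using that d j by (intro grown_least_label) auto
      have lenq: "length (us @ q # vs) = length zs + 2" using arg_cong[OF that(1), of length] uwz by simp
      then obtain u' w' zs' where z': "us @ q # vs = u' # w' # zs'" "length zs' = length zs"
        by (cases "us @ q # vs"; cases "tl (us @ q # vs)") auto
      have "map least_label (us @ q # vs) = map least_label xs" using ll that by simp
      then have "map least_label zs' = map least_label zs" unfolding uwz z' by simp
      then have "zs' \<noteq> [] \<Longrightarrow> least_label (last zs') = least_label (last zs)"
        using z'(2) by (metis last_map length_0_conv)
      then have "k = (if zs' = [] then i else max i (least_label (last zs')))" using kz z' by auto
      moreover have "grown j ?p (PNode ((us @ q # vs) @ PLeaf i # ys))"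
        using grown.below[OF that(2), of us "vs @ PLeaf i # ys"] that by simp
      ultimately show ?thesis by (intro kids[OF _ z'(1)])
    qed
    then have 1: "ins_sums j (\<lambda>w. \<Phi> (PNode (w @ PLeaf i # ys))) xs = ins_sums j (\<lambda>w. h k (PNode (w @ ys))) xs"
      by (intro ins_sum_cong(2)) simp
    have "\<Phi> (PNode (xs @ PLeaf i # us @ q # vs)) = h k (PNode (xs @ us @ q # vs))"
      if "ys = us @ s # vs" "grown j s q" for us s q vs
      using grown.below[OF that(2), of "xs @ PLeaf i # us" vs] that kz
      by (intro kids[OF _ uwz]) auto
    then have 2: "ins_sums j (\<lambda>w. \<Phi> (PNode (xs @ PLeaf i # w))) ys = ins_sums j (\<lambda>w. h k (PNode (xs @ w))) ys"
      by (intro ins_sum_cong(2)) simp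
    have "\<Phi> (PNode (u # w # (a @ PLeaf j # b) @ PLeaf i # ys)) = h k (PNode (u # w # (a @ PLeaf j # b) @ ys))"
      if "zs = a @ b" "b \<noteq> []" for a b
      using grown.at[of "u # w # a" j "b @ PLeaf i # ys"] kids[of "u # w # a @ PLeaf j # b" ys u w "a @ PLeaf j # b" k]
        that kz uwz by auto
    then have p: "pre_sum j (\<lambda>z. \<Phi> (PNode (u # w # z @ PLeaf i # ys))) zs = pre_sum j (\<lambda>z. h k (PNode (u # w # z @ ys))) zs"
      by (intro pre_sum_cong) simp
    have m: "\<Phi> (PNode (u # w # zs @ PLeaf j # PLeaf i # ys)) = h j (PNode (xs @ PLeaf j # ys))"
      using grown.at[of xs j "PLeaf i # ys"] kids[of "u # w # zs @ [PLeaf j]" ys u w "zs @ [PLeaf j]" j]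
        uwz ij by auto
    have "\<Phi> (PNode (u # w # zs @ PLeaf i # a @ PLeaf j # b)) = h k (PNode (u # w # zs @ a @ PLeaf j # b))"
      if "ys = a @ b" for a b
      using grown.at[of "xs @ PLeaf i # a" j b] kids[of xs "a @ PLeaf j # b" u w zs k] that kz uwz by auto
    then have r: "loc_sum j (\<lambda>z. \<Phi> (PNode (u # w # zs @ PLeaf i # z))) ys =
        loc_sum j (\<lambda>z. h k (PNode (u # w # zs @ z))) ys"
      by (intro loc_sum_cong) simp
    show ?thesis using 1 2 p m r by (simp add: ins_sums_append locs_sum_def uwz loc_sum_append numeral_2_eq_2)
  qed
  then show ?thesis
    unfolding ins_sum_PNode root using leaf by (simp add: ins_sums_mid algebra_simps)
qed

lemma grown_deep:
  assumes "grown j p q" "deep i p" "i \<noteq> j"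
  shows "deep i q"
  using assms by cases (auto simp: deep_def dest: grown_not_PLeaf)

text \<open>Induction along the path to \<open>i\<close>. The function \<open>h\<close> absorbs
  everything outside the current subtree and therefore varies; its first argument is the killed
  label because the later renaming depends on it. A child on the path that is not
  \<open>deep\<close> and is not \<open>i\<close> itself consists of \<open>i\<close> and one
  sibling, and its killed label is known at the level of its parent.\<close>

lemma ins_sum_deep:
  fixes h :: "nat \<Rightarrow> nat ptree \<Rightarrow> real" and i :: nat
  assumes "drawing p" "i \<in> plabels p" "deep i p" "\<forall>k\<in>plabels p. k < j"
    and "\<And>q q'. swapped j q q' \<Longrightarrow> h j q = h j q'"
  shows "ins_sum j (\<lambda>q. h (kill_label i q) (delete_leaf i q)) p =
    h j (map_ptree (Transposition.transpose i j) p) + ins_sum j (h (kill_label i p)) (delete_leaf i p)"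
  using assms
proof (induction p arbitrary: h)
  case (PLeaf k)
  then show ?case by (simp add: deep_def)
next
  case (PNode ts)
  let ?\<Phi> = "\<lambda>q. h (kill_label i q) (delete_leaf i q)"
  obtain xs v ys where ts: "ts = xs @ v # ys" "i \<in> plabels v" using PNode.prems(2) by (rule split_child)
  have d: "drawing (PNode (xs @ v # ys))" and j: "\<forall>k\<in>plabels (PNode (xs @ v # ys)). k < j"
    using PNode.prems ts by auto
  have dv: "drawing v" "\<forall>k\<in>plabels v. k < j" using d j by auto
  note mt = map_transpose_mid[OF d ts(2) j]
  let ?k = "kill_label i (PNode (xs @ v # ys))"
  show ?case
  proof (cases "v = PLeaf i")
    case True
    have "2 \<le> length (xs @ ys)" using PNode.prems(3) ts True by (auto simp: deep_def)
    then show ?thesis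
      using ins_sum_near_leaf[where h = h, OF d[unfolded True] _ j[unfolded True] refl] PNode.prems(5)
        delete_leaf_parent3[OF d[unfolded True]] mt
      unfolding ts(1) True by simp
  next
    case False
    have del: "delete_leaf i (PNode (xs @ v # ys)) = PNode (xs @ delete_leaf i v # ys)"
      using delete_leaf_child[OF d ts(2)] delete_leaf_not_PLeaf[OF dv(1) False] by simp
    have "ins_sum j (\<lambda>s. ?\<Phi> (PNode (xs @ s # ys))) v =
      h j (PNode (xs @ map_ptree (Transposition.transpose i j) v # ys)) +
      ins_sum j (\<lambda>s. h ?k (PNode (xs @ s # ys))) (delete_leaf i v)"
    proof (cases "deep i v")
      case True
      have "ins_sum j (\<lambda>s. ?\<Phi> (PNode (xs @ s # ys))) v =
          ins_sum j (\<lambda>s. h (kill_label i s) (PNode (xs @ delete_leaf i s # ys))) v"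
      proof (rule ins_sum_cong(1))
        fix s assume s: "grown j v s"
        then have ds: "drawing (PNode (xs @ s # ys))"
          using grown_drawing[OF grown.below[OF s]] d j by blast
        have iq: "i \<in> plabels s" using grown_plabels[OF s] ts(2) by simp
        have "deep i s" using grown_deep[OF s True] ts(2) dv(2) by auto
        then show "?\<Phi> (PNode (xs @ s # ys)) = h (kill_label i s) (PNode (xs @ delete_leaf i s # ys))"
          using kill_label_child[OF ds iq] delete_leaf_child[OF ds iq]
            delete_leaf_not_PLeaf[of s i] ds grown_not_PLeaf[OF s] by simp
      qed
      also have "\<dots> = h j (PNode (xs @ map_ptree (Transposition.transpose i j) v # ys)) +
          ins_sum j (\<lambda>s. h (kill_label i v) (PNode (xs @ s # ys))) (delete_leaf i v)"
        using PNode.IH[of v "\<lambda>m s. h m (PNode (xs @ s # ys))"] ts dv True PNode.prems(5) swapped.inside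
        by (simp add: ts)
      finally show ?thesis using kill_label_child[OF d ts(2) True] by simp
    next
      case nd: False
      then obtain u where u: "sibling_of_leaf i u v" using deepE[OF dv(1) ts(2) False] by blast
      have u': "drawing u" "\<forall>k\<in>plabels u. k < j" "i < j"
        using u dv by (auto simp: sibling_of_leaf_def)
      have "ins_sum j (\<lambda>s. ?\<Phi> (PNode (xs @ s # ys))) v =
        h j (PNode (xs @ map_ptree (Transposition.transpose i j) v # ys)) +
        ins_sum j (\<lambda>s. h ?k (PNode (xs @ s # ys))) u"
      proof (rule ins_sum_sibling[OF dv(1) u dv(2)])
        fix q assume q: "kill_label i q = j" "deep i q" "grown j v q"
        have dq: "drawing (PNode (xs @ q # ys))" by (rule grown_drawing[OF grown.below[OF q(3)] d j])
        have "i \<in> plabels q" using grown_plabels[OF q(3)] ts(2) by simp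
        then show "?\<Phi> (PNode (xs @ q # ys)) = h j (PNode (xs @ delete_leaf i q # ys))"
          using kill_label_child[OF dq] delete_leaf_child[OF dq] q dq
            delete_leaf_not_PLeaf[of q i] grown_not_PLeaf[OF q(3)] by simp
      next
        fix q r assume q: "sibling_of_leaf i r q" "grown j v q" "grown j u r"
        have dq: "drawing (PNode (xs @ q # ys))" by (rule grown_drawing[OF grown.below[OF q(2)] d j])
        have "i \<in> plabels q" using grown_plabels[OF q(2)] ts(2) by simp
        moreover have "delete_leaf i q = r" using delete_leaf_sibling[of q i r] q(1) dq by simp
        ultimately show "?\<Phi> (PNode (xs @ q # ys)) = h ?k (PNode (xs @ r # ys))"
          using kill_label_binary[OF dq q(1)] kill_label_binary[OF d u] delete_leaf_child[OF dq]
            grown_not_PLeaf[OF q(3)] grown_least_label[OF q(3) u'(1,2)] by simp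
      next
        fix q q' assume "swapped j q q'"
        then show "h j (PNode (xs @ q # ys)) = h j (PNode (xs @ q' # ys))"
          by (intro PNode.prems(5) swapped.inside)
      qed
      then show ?thesis using delete_leaf_sibling[OF dv(1) u] by simp
    qed
    then show ?thesis
      using ins_sum_frame[where h = h, OF d ts(2) False j refl] unfolding ts(1) del mt by simp
  qed
qed

text \<open>What \<open>ins_sum_deep\<close> leaves open is a drawing with \<open>i\<close> and one
  sibling at the top branch point, where there is no second bush.\<close>

lemma ins_sum_down:
  fixes h :: "nat \<Rightarrow> nat ptree \<Rightarrow> real" and i :: nat
  assumes d: "drawing p" and i: "i \<in> plabels p" "p \<noteq> PLeaf i" and j: "\<forall>k\<in>plabels p. k < j"
    and h: "\<And>q q'. swapped j q q' \<Longrightarrow> h j q = h j q'"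
  shows "ins_sum j (\<lambda>q. h (kill_label i q) (delete_leaf i q)) p =
    h j (map_ptree (Transposition.transpose i j) p) + ins_sum j (h (kill_label i p)) (delete_leaf i p)"
proof (cases "deep i p")
  case True
  then show ?thesis using ins_sum_deep[where h = h, OF d i(1) _ j] h by simp
next
  case False
  then obtain u where u: "sibling_of_leaf i u p" using deepE[OF d i] by blast
  have u': "drawing u" "\<forall>k\<in>plabels u. k < j" using u d j by (auto simp: sibling_of_leaf_def)
  have "ins_sum j (\<lambda>q. h (kill_label i q) (delete_leaf i q)) p =
    h j (map_ptree (Transposition.transpose i j) p) + ins_sum j (h (kill_label i p)) u"
  proof (rule ins_sum_sibling[OF d u j])
    fix q r assume q: "sibling_of_leaf i r q" "grown j p q" "grown j u r"
    have dq: "drawing q" by (rule grown_drawing[OF q(2) d j])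
    show "h (kill_label i q) (delete_leaf i q) = h (kill_label i p) r"
      using kill_label_root[OF dq q(1)] kill_label_root[OF d u] delete_leaf_sibling[OF dq q(1)]
        grown_least_label[OF q(3) u'] by simp
  qed (use h in auto)
  then show ?thesis using delete_leaf_sibling[OF d u] by simp
qed

end

section \<open>The down-step preserves drawings\<close>

abbreviation relabel :: "nat \<Rightarrow> nat \<Rightarrow> nat ptree \<Rightarrow> nat ptree" where
  "relabel i k \<equiv> map_ptree (Transposition.transpose i k)"

lemma plabels_map [simp]: "plabels (map_ptree f p) = f ` plabels p"
  by (rule ptree.set_map)

lemma least_label_map:
  assumes "drawing p" "strict_mono_on (plabels p) f"
  shows "least_label (map_ptree f p) = f (least_label p)"
proof -
  have m: "mono_on (plabels p) f" using assms(2) by (rule strict_mono_on_imp_mono_on)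
  have min: "Min (plabels p) \<in> plabels p" using drawing_plabels_nonempty[OF assms(1)] by simp
  then have "f (Min (plabels p)) \<le> f x" if "x \<in> plabels p" for x
    using mono_onD[OF m min that] that by simp
  then show ?thesis unfolding least_label_def plabels_map
    using min by (intro Min_eqI) auto
qed

lemma disjoint_labels_map:
  assumes "inj_on f (\<Union>t\<in>set ts. plabels t)" "disjoint_labels ts"
  shows "disjoint_labels (map (map_ptree f) ts)"
  using assms
proof (induction ts)
  case (Cons t ts)
  have "inj_on f (\<Union>t\<in>set ts. plabels t)" using Cons.prems(1) by (rule inj_on_subset) auto
  moreover have "f ` plabels t \<inter> f ` plabels s = {}" if "s \<in> set ts" for s
  proof -
    have "f ` plabels t \<inter> f ` plabels s = f ` (plabels t \<inter> plabels s)"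
      using Cons.prems(1) that by (intro inj_on_image_Int[symmetric]) auto
    then show ?thesis using Cons.prems(2) that by auto
  qed
  ultimately show ?case using Cons by auto
qed simp

lemma drawing_map:
  "drawing p \<Longrightarrow> strict_mono_on (plabels p) f \<Longrightarrow> drawing (map_ptree f p)"
proof (induction p)
  case (PNode ts)
  have sm: "strict_mono_on (plabels t) f" if "t \<in> set ts" for t
    using PNode.prems(2) that by (auto intro: monotone_on_subset)
  have "map least_label (map (map_ptree f) ts) = map f (map least_label ts)"
    using sm PNode.prems(1) by (auto intro!: least_label_map)
  moreover have "lead2 (map f (map least_label ts))"
    unfolding lead2_def
  proof (intro ballI)
    fix s t assume "s \<in> set (take 2 (map f (map least_label ts)))" "t \<in> set (drop 2 (map f (map least_label ts)))"
    then obtain s' t' where st: "s' \<in> set (take 2 ts)" "t' \<in> set (drop 2 ts)" "s = f (least_label s')" "t = f (least_label t')"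
      by (auto simp: take_map drop_map)
    then have "s' \<in> set ts" "t' \<in> set ts" by (auto dest: in_set_takeD in_set_dropD)
    moreover have "least_label s' < least_label t'"
      using PNode.prems(1) st by (auto simp: lead2_def take_map drop_map)
    ultimately show "s < t"
      unfolding st using PNode.prems least_label_in
      by (intro strict_mono_onD[OF PNode.prems(2)]) auto
  qed
  moreover have "disjoint_labels (map (map_ptree f) ts)"
    using PNode.prems strict_mono_on_imp_inj_on[OF PNode.prems(2)] by (intro disjoint_labels_map) auto
  ultimately have "lead2 (map least_label (map (map_ptree f) ts))" "disjoint_labels (map (map_ptree f) ts)"
    by (simp_all only:)
  then show ?case using PNode sm by auto
qed simp

text \<open>Only the minimum is replaced, and by something smaller, so the order of the labels
  survives.\<close>

lemma relabel_least_strict_mono: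
  assumes "k = least_label t" "i \<notin> plabels t" "i < k"
  shows "strict_mono_on (plabels t) (Transposition.transpose i k)"
proof (rule strict_mono_onI)
  fix r s assume rs: "r \<in> plabels t" "s \<in> plabels t" "r < s"
  then have "k \<le> r" "k < s" "r \<noteq> i" "s \<noteq> i" using assms least_label_le[of r t] by auto
  then show "Transposition.transpose i k r < Transposition.transpose i k s"
    using assms(3) rs(3) by (auto simp: Transposition.transpose_def)
qed

lemma relabel_id: "i \<notin> plabels t \<Longrightarrow> k \<notin> plabels t \<Longrightarrow> relabel i k t = t"
  by (rule map_ptree_transpose_id)

lemma relabel_child:
  assumes "drawing t" "i \<notin> plabels t" "k \<in> plabels t \<Longrightarrow> k = least_label t \<and> i < k"
  shows "drawing (relabel i k t)" "least_label (relabel i k t) = Transposition.transpose i k (least_label t)"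
proof -
  have *: "drawing (relabel i k t) \<and> least_label (relabel i k t) = Transposition.transpose i k (least_label t)"
  proof (cases "k \<in> plabels t")
    case True
    then have "strict_mono_on (plabels t) (Transposition.transpose i k)"
      using relabel_least_strict_mono assms by auto
    then show ?thesis using drawing_map least_label_map assms(1) by auto
  next
    case False
    moreover have "least_label t \<noteq> i" "least_label t \<noteq> k"
      using False assms(2) least_label_in[OF assms(1)] by auto
    ultimately show ?thesis using relabel_id assms by simp
  qed
  then show "drawing (relabel i k t)" "least_label (relabel i k t) = Transposition.transpose i k (least_label t)"
    by auto
qed

text \<open>The strict inequality serves \<open>drawing_down\<close>: a down-step that takes place
  inside a subtree does not change its least label, so its parent notices nothing.\<close>

lemma kill_label_in:
  "drawing p \<Longrightarrow> i \<in> plabels p \<Longrightarrow> p \<noteq> PLeaf i \<Longrightarrow>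
    kill_label i p \<in> plabels p \<and> least_label p < kill_label i p"
proof (induction p)
  case (PNode ts)
  show ?case
  proof (cases "deep i (PNode ts)")
    case False
    then obtain u where u: "sibling_of_leaf i u (PNode ts)" using deepE[OF PNode.prems] by blast
    note s = spine_sibling[OF PNode.prems(1) u]
    have lu: "least_label u \<in> plabels u" using s least_label_in by auto
    then have "{i, least_label u} \<subseteq> plabels (PNode ts)" "least_label u \<noteq> i"
      using u s(6) by (auto simp: sibling_of_leaf_def)
    then show ?thesis using kill_label_root[OF PNode.prems(1) u]
        least_label_le[of i "PNode ts"] least_label_le[of "least_label u" "PNode ts"]
      by (auto simp: max_def)
  next
    case True
    obtain xs v ys where ts: "ts = xs @ v # ys" "i \<in> plabels v" using PNode.prems(2) by (rule split_child)
    have d: "drawing (PNode (xs @ v # ys))" using PNode.prems(1) ts(1) by simp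
    have dv: "drawing v" using d by simp
    have ll: "least_label t \<in> plabels (PNode ts)" "least_label (PNode ts) \<le> least_label t" if "t \<in> set ts" for t
    proof -
      show "least_label t \<in> plabels (PNode ts)" using that PNode.prems(1) least_label_in by force
      then show "least_label (PNode ts) \<le> least_label t" by (rule least_label_le)
    qed
    show ?thesis
    proof (cases "v = PLeaf i")
      case leaf: True
      note d' = d[unfolded leaf] and ts' = ts(1)[unfolded leaf]
      have len: "2 \<le> length (xs @ ys)" using True ts' by (auto simp: deep_def)
      have i: "i \<in> plabels (PNode ts)" "least_label (PNode ts) \<le> i" using ll[of "PLeaf i"] ts' by auto
      show ?thesis
      proof (cases "length xs \<le> 1")
        case True
        obtain u w zs where uwz: "xs @ ys = u # w # zs" using len by (cases "xs @ ys"; cases "tl (xs @ ys)") auto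
        then have "xs = [] \<and> ys = u # w # zs \<or> xs = [u] \<and> ys = w # zs" using True by (cases xs) auto
        then have "i < least_label w" "w \<in> set ts" using d' ts' by auto
        then show ?thesis using kill_label_leaf_left[OF d' uwz True] ll[of w] i ts' by simp
      next
        case False
        obtain u w zs where uwz: "xs = u # w # zs" using False by (cases xs; cases "tl xs") auto
        have "least_label u < i" "u \<in> set ts" using d' ts' uwz by auto
        moreover have "zs \<noteq> [] \<Longrightarrow> last zs \<in> set ts" using uwz ts' by simp
        ultimately show ?thesis using kill_label_leaf_right[OF d' uwz] ll[of u] ll[of "last zs"] i ts'
          by (auto simp: max_def)
      qed
    next
      case False
      show ?thesis
      proof (cases "deep i v")
        case True
        have "kill_label i v \<in> plabels v \<and> least_label v < kill_label i v"
          using PNode.IH[of v] ts dv False by simp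
        then show ?thesis using kill_label_child[OF d ts(2) True] ts ll[of v] by auto
      next
        case nd: False
        then obtain u where u: "sibling_of_leaf i u v" using deepE[OF dv ts(2) False] by blast
        note s = spine_sibling[OF dv u]
        have lu: "least_label u \<in> plabels u" using s least_label_in by auto
        then have *: "{i, least_label u} \<subseteq> plabels (PNode ts)" "least_label u \<noteq> i"
          using u s(6) ts by (auto simp: sibling_of_leaf_def)
        have "xs @ ys \<noteq> []" using d by auto
        then have "Min (least_label ` set (xs @ ys)) \<in> least_label ` set (xs @ ys)" by (intro Min_in) auto
        then obtain t where t: "t \<in> set (xs @ ys)" "Min (least_label ` set (xs @ ys)) = least_label t"
          by (elim imageE)
        then have "t \<in> set ts" using ts(1) by auto
        then have "Min (least_label ` set (xs @ ys)) \<in> plabels (PNode ts)" using ll(1) t(2) by simp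
        then have "kill_label i (PNode ts) \<in> plabels (PNode ts)"
          unfolding ts(1) kill_label_binary[OF d u] using * unfolding ts(1) by (auto simp: max_def)
        moreover have "i \<le> kill_label i (PNode ts)" "least_label u \<le> kill_label i (PNode ts)"
          unfolding ts(1) kill_label_binary[OF d u] by auto
        ultimately show ?thesis using * least_label_le[of i "PNode ts"] least_label_le[of "least_label u" "PNode ts"] by auto
      qed
    qed
  qed
qed auto

lemma plabels_down:
  assumes "drawing p" "i \<in> plabels p" "p \<noteq> PLeaf i" "k \<in> plabels p"
  shows "plabels (relabel i k (delete_leaf i p)) = plabels p - {k}"
  unfolding plabels_map plabels_delete_leaf[OF assms(1,3)]
  using assms(2,4) by (auto simp: Transposition.transpose_def image_iff)

text \<open>\<open>A\<close> and \<open>B\<close> list the least labels of the siblings of a branch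
  point whose two subtrees are \<open>i\<close> and one with least label \<open>a\<close>. If
  \<open>k\<close> is \<open>max i a\<close>, the subtree left over inherits \<open>min i a\<close>.
  Otherwise \<open>k\<close> is the minimum over the siblings and exceeds both; then this branch
  point and the sibling with \<open>k\<close> are the two leading subtrees, and they stay leading
  with the keys \<open>a\<close> and \<open>i\<close>.\<close>

lemma lead2_binary:
  assumes l: "lead2 (A @ min i a # B)" and n: "i \<notin> set (A @ B)" "a \<notin> set (A @ B)" "i \<noteq> a" "A @ B \<noteq> []"
    and k: "k = Max {i, a, Min (set (A @ B))}"
  shows "lead2 (map (Transposition.transpose i k) (A @ a # B))"
proof (cases "k = max i a")
  case True
  then have "k \<notin> set (A @ B)" using n by (auto simp: max_def)
  then have "map (Transposition.transpose i k) A = A" "map (Transposition.transpose i k) B = B"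
    using n by (auto intro!: map_idI simp: Transposition.transpose_def)
  moreover have "Transposition.transpose i k a = min i a" using True by (auto simp: max_def min_def)
  ultimately show ?thesis using l by simp
next
  case False
  then have k': "k = Min (set (A @ B))" "i < k" "a < k" using k by (auto simp: max_def split: if_splits)
  have ge: "k \<le> x" if "x \<in> set (A @ B)" for x using that k' by simp
  have "k \<in> set (A @ B)" using n(4) k'(1) Min_in[of "set (A @ B)"] by simp
  consider "A = []" | x where "A = [x]" | x y C where "A = x # y # C"
    by (cases A; cases "tl A") auto
  then show ?thesis
  proof cases
    case 1
    then obtain x C where B: "B = x # C" using n(4) by (cases B) auto
    then have "\<forall>t\<in>set C. x < t" using l 1 by simp
    then have "x = k" "\<forall>t\<in>set C. k < t" using \<open>k \<in> set (A @ B)\<close> ge[of x] 1 B by auto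
    moreover from this have "map (Transposition.transpose i k) C = C"
      using k' by (auto intro!: map_idI simp: Transposition.transpose_def)
    ultimately show ?thesis using 1 B k' n by (auto simp: Transposition.transpose_def)
  next
    case 2
    then have "\<forall>t\<in>set B. x < t" using l by simp
    then have "x = k" "\<forall>t\<in>set B. k < t" using \<open>k \<in> set (A @ B)\<close> ge[of x] 2 by auto
    moreover from this have "map (Transposition.transpose i k) B = B"
      using k' by (auto intro!: map_idI simp: Transposition.transpose_def)
    ultimately show ?thesis using 2 k' n by (auto simp: Transposition.transpose_def)
  next
    case 3
    then have "x < min i a" using l by simp
    then show ?thesis using ge[of x] 3 k' by simp
  qed
qed

text \<open>Deletion may promote a third subtree to a leading place. The killed label is chosen such
  that the two leftmost subtrees still have the smallest least labels once \<open>i\<close> has been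
  written in its place.\<close>

lemma drawing_down:
  "drawing p \<Longrightarrow> i \<in> plabels p \<Longrightarrow> p \<noteq> PLeaf i \<Longrightarrow>
    drawing (relabel i (kill_label i p) (delete_leaf i p))"
proof (induction p)
  case (PNode ts)
  show ?case
  proof (cases "deep i (PNode ts)")
    case False
    then obtain u where u: "sibling_of_leaf i u (PNode ts)" using deepE[OF PNode.prems] by blast
    note s = spine_sibling[OF PNode.prems(1) u]
    show ?thesis
      unfolding delete_leaf_sibling[OF PNode.prems(1) u] kill_label_root[OF PNode.prems(1) u]
      using s least_label_in[of u] by (intro relabel_child) (auto simp: max_def split: if_splits)
  next
    case True
    obtain xs v ys where ts: "ts = xs @ v # ys" "i \<in> plabels v" using PNode.prems(2) by (rule split_child)
    have d: "drawing (PNode (xs @ v # ys))" using PNode.prems(1) ts(1) by simp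
    have dv: "drawing v" using d by simp
    let ?k = "kill_label i (PNode (xs @ v # ys))"
    note oth = drawing_PNode_others[OF d ts(2)]
    show ?thesis
    proof (cases "v = PLeaf i")
      case leaf: True
      note d' = d[unfolded leaf] and ts' = ts(1)[unfolded leaf]
      let ?k = "kill_label i (PNode (xs @ PLeaf i # ys))"
      have len: "2 \<le> length (xs @ ys)" using True ts' by (auto simp: deep_def)
      have del: "delete_leaf i (PNode ts) = PNode (xs @ ys)" unfolding ts' by (rule delete_leaf_parent3[OF d' len])
      have dis: "disjoint_labels (xs @ ys)" using d'[unfolded drawing.simps disjoint_labels_mid] by blast
      \<comment> \<open>The killed label is the least label of a sibling \<open>t\<close> and
        exceeds \<open>i\<close>, so the relabelling just lowers the key of \<open>t\<close> to
        \<open>i\<close>. What is left in each case is to check that the right subtrees lead with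
        this new key.\<close>
      have swap: "drawing (PNode (map (relabel i ?k) (xs @ ys)))"
        if t: "t \<in> set (xs @ ys)" "?k = least_label t" "i < ?k"
          and lead: "lead2 (map (\<lambda>s. if s = t then i else least_label s) (xs @ ys))" for t
      proof -
        have k: "s = t" if "s \<in> set (xs @ ys)" "?k \<in> plabels s" for s
        proof (rule disjoint_labels_unique[OF dis that(1) t(1) that(2)])
          show "?k \<in> plabels t" unfolding t(2) using t(1) d' least_label_in by auto
        qed
        then have c: "drawing (relabel i ?k s) \<and> least_label (relabel i ?k s) = (if s = t then i else least_label s)"
          if "s \<in> set (xs @ ys)" for s
        proof -
          have s: "drawing s" "i \<notin> plabels s" using that oth leaf by auto
          moreover have "?k \<in> plabels s \<Longrightarrow> ?k = least_label s \<and> i < ?k" using k[OF that] t by auto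
          ultimately have "drawing (relabel i ?k s)" "least_label (relabel i ?k s) = Transposition.transpose i ?k (least_label s)"
            using relabel_child by auto
          moreover have "Transposition.transpose i ?k (least_label s) = (if s = t then i else least_label s)"
            using k[OF that] t s least_label_in[OF s(1)] by (auto simp: Transposition.transpose_def)
          ultimately show ?thesis by simp
        qed
        then have "map least_label (map (relabel i ?k) (xs @ ys)) = map (\<lambda>s. if s = t then i else least_label s) (xs @ ys)"
          by auto
        then have "lead2 (map least_label (map (relabel i ?k) (xs @ ys)))" using lead by (simp only:)
        moreover have "disjoint_labels (map (relabel i ?k) (xs @ ys))"
          using dis by (intro disjoint_labels_map) (auto intro: inj_on_subset[OF inj_on_transpose])
        ultimately show ?thesis using c len by auto
      qed
      have "drawing (PNode (map (relabel i ?k) (xs @ ys)))"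
      proof (cases "length xs \<le> 1")
        case True
        obtain u w zs where uwz: "xs @ ys = u # w # zs" using len by (cases "xs @ ys"; cases "tl (xs @ ys)") auto
        have k: "?k = least_label w" by (rule kill_label_leaf_left[OF d' uwz True])
        have "xs = [] \<and> ys = u # w # zs \<or> xs = [u] \<and> ys = w # zs" using True uwz by (cases xs) auto
        then have lt: "i < least_label w" "\<forall>t\<in>set zs. least_label u < least_label t \<and> i < least_label t" using d' by auto
        have "distinct (xs @ ys)"
          using d' by (intro disjoint_labels_distinct[OF dis] drawing_plabels_nonempty) auto
        then have dist: "w \<noteq> u" "w \<notin> set zs" unfolding uwz by auto
        show ?thesis using lt k dist uwz by (intro swap[of w]) auto
      next
        case False
        obtain u w zs where uwz: "xs = u # w # zs" using False by (cases xs; cases "tl xs") auto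
        have k: "?k = (if zs = [] then i else max i (least_label (last zs)))" by (rule kill_label_leaf_right[OF d' uwz])
        have lt: "\<forall>t\<in>set (zs @ PLeaf i # ys). least_label u < least_label t \<and> least_label w < least_label t" using d' uwz by auto
        show ?thesis
        proof (cases "?k = i")
          case True
          then have "map (relabel i ?k) (xs @ ys) = xs @ ys" by (auto simp: ptree.map_id0)
          then show ?thesis using d' dis lt uwz by auto
        next
          case False
          then have k: "?k = least_label (last zs)" "i < ?k" "zs \<noteq> []" using k by (auto simp: max_def split: if_splits)
          then have "last zs \<noteq> u" "last zs \<noteq> w" using lt by (metis UnCI last_in_set less_irrefl set_append)+
          then show ?thesis using lt k uwz by (intro swap[of "last zs"]) auto
        qed
      qed
      then show ?thesis using del ts' by simp
    next
      case False
      have del: "delete_leaf i (PNode ts) = PNode (xs @ delete_leaf i v # ys)"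
        unfolding ts(1) using delete_leaf_child[OF d ts(2)] delete_leaf_not_PLeaf[OF dv False] by simp
      show ?thesis
      proof (cases "deep i v")
        case True
        let ?k = "kill_label i v" and ?w = "relabel i (kill_label i v) (delete_leaf i v)"
        note k = kill_label_in[OF dv ts(2) False]
        have dw: "drawing ?w" using PNode.IH[of v] ts dv False by simp
        have pw: "plabels ?w = plabels v - {?k}" using plabels_down[OF dv ts(2) False] k by simp
        have lw: "least_label ?w = least_label v"
          unfolding least_label_def[of ?w] pw using k least_label_in[OF dv] least_label_le[of _ v]
          by (intro Min_eqI) auto
        have nk: "\<forall>t\<in>set (xs @ ys). ?k \<notin> plabels t"
          using drawing_PNode_others[OF d, of ?k] k by auto
        have "drawing (PNode (xs @ ?w # ys))"
          using nk by (intro drawing_replace[OF d dw _ lw, of ?k]) (unfold pw, blast+)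
        moreover have "map (relabel i ?k) xs = xs" "map (relabel i ?k) ys = ys"
          using oth nk by (auto intro!: map_idI relabel_id)
        ultimately show ?thesis using del kill_label_child[OF d ts(2) True] ts(1) by simp
      next
        case nd: False
        then obtain u where u: "sibling_of_leaf i u v" using deepE[OF dv ts(2) False] by blast
        note s = spine_sibling[OF dv u]
        have du: "delete_leaf i v = u" by (rule delete_leaf_sibling[OF dv u])
        have pu: "plabels v = insert i (plabels u)" using u by (auto simp: sibling_of_leaf_def)
        have lv: "least_label v = min i (least_label u)"
          unfolding least_label_def pu using drawing_plabels_nonempty[OF s(7)] by simp
        have dis: "disjoint_labels (xs @ u # ys)"
          using d pu unfolding drawing.simps disjoint_labels_mid by auto
        have k: "?k = Max {i, least_label u, Min (least_label ` set (xs @ ys))}" by (rule kill_label_binary[OF d u])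
        have ne: "xs @ ys \<noteq> []" using d by auto
        have c: "drawing (relabel i ?k t) \<and> least_label (relabel i ?k t) = Transposition.transpose i ?k (least_label t)"
          if "t \<in> set (xs @ u # ys)" for t
        proof -
          have t: "drawing t" "i \<notin> plabels t" using that oth s by auto
          moreover have "?k = least_label t \<and> i < ?k" if kt: "?k \<in> plabels t"
          proof -
            have "?k \<noteq> i" using kt t by auto
            moreover have "Min (least_label ` set (xs @ ys)) \<in> least_label ` set (xs @ ys)" using ne by (intro Min_in) auto
            ultimately have "?k \<in> least_label ` set (xs @ u # ys)" "i < ?k" unfolding k by (auto simp: max_def split: if_splits)
            then obtain t' where t': "t' \<in> set (xs @ u # ys)" "?k = least_label t'" by auto
            moreover have "?k \<in> plabels t'" unfolding t'(2) using t'(1) oth s least_label_in by auto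
            ultimately have "t' = t" using disjoint_labels_unique[OF dis t'(1) \<open>t \<in> _\<close> _ kt] by simp
            then show ?thesis using t' \<open>i < ?k\<close> by simp
          qed
          ultimately show ?thesis using relabel_child by blast
        qed
        have "map least_label (map (relabel i ?k) (xs @ u # ys)) = map (Transposition.transpose i ?k) (map least_label xs @ least_label u # map least_label ys)"
          using c by auto
        moreover have "lead2 (map (Transposition.transpose i ?k) (map least_label xs @ least_label u # map least_label ys))"
        proof (rule lead2_binary)
          show "lead2 (map least_label xs @ min i (least_label u) # map least_label ys)"
            using d lv by simp
          have "least_label t \<noteq> i" if "t \<in> set (xs @ ys)" for t
            using that oth least_label_in by force
          then show "i \<notin> set (map least_label xs @ map least_label ys)" by auto
          have "least_label t \<noteq> least_label u" if "t \<in> set (xs @ ys)" for t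
          proof -
            have "plabels t \<inter> plabels u = {}" "drawing t" using that dis oth unfolding disjoint_labels_mid by auto
            then show ?thesis using least_label_in[of t] least_label_in[of u] s(7) by auto
          qed
          then show "least_label u \<notin> set (map least_label xs @ map least_label ys)" by force
          show "i \<noteq> least_label u" using s least_label_in by auto
          show "map least_label xs @ map least_label ys \<noteq> []" using ne by simp
          show "?k = Max {i, least_label u, Min (set (map least_label xs @ map least_label ys))}" using k by (simp add: image_Un)
        qed
        ultimately have "lead2 (map least_label (map (relabel i ?k) (xs @ u # ys)))" by (simp only:)
        moreover have "disjoint_labels (map (relabel i ?k) (xs @ u # ys))"
          using dis by (intro disjoint_labels_map) (auto intro: inj_on_subset[OF inj_on_transpose])
        ultimately have "drawing (PNode (map (relabel i ?k) (xs @ u # ys)))" using c ne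
          by (auto simp: Suc_le_eq)
        then show ?thesis using del du ts(1) by simp
      qed
    qed
  qed
qed auto

section \<open>Normal form: ordering the two leftmost subtrees\<close>

lemma plabels_order_leftmost [simp]: "plabels (order_leftmost p) = plabels p"
proof (induction p)
  case (PNode ts)
  have "set (take 2 (map order_leftmost ts)) \<union> set (drop 2 (map order_leftmost ts)) = order_leftmost ` set ts"
    by (metis append_take_drop_id list.set_map set_append)
  then show ?case using PNode by (simp add: Let_def flip: image_Un image_UN)
qed simp

lemma least_label_order_leftmost [simp]: "least_label (order_leftmost p) = least_label p"
  by (simp add: least_label_def)

lemma order_leftmost_PNode:
  "order_leftmost (PNode (x # y # zs)) =
    PNode ((if least_label x \<le> least_label y then [order_leftmost x, order_leftmost y]
            else [order_leftmost y, order_leftmost x]) @ map order_leftmost zs)"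
  by (simp add: Let_def numeral_2_eq_2)

lemma order_leftmost_short: "order_leftmost (PNode [x]) = PNode [order_leftmost x]" "order_leftmost (PNode []) = PNode []"
  by (simp_all add: Let_def)

declare order_leftmost.simps(2) [simp del]

lemma list_cases2:
  obtains "ts = []" | x where "ts = [x]" | x y zs where "ts = x # y # zs"
  by (cases ts; cases "tl ts") auto

lemma order_leftmost_idem [simp]: "order_leftmost (order_leftmost p) = order_leftmost p"
proof (induction p)
  case (PNode ts)
  have "map (order_leftmost \<circ> order_leftmost) zs = map order_leftmost zs" if "set zs \<subseteq> set ts" for zs
    using PNode that by auto
  then show ?case using PNode
    by (cases ts rule: list_cases2) (auto simp: order_leftmost_PNode order_leftmost_short)
qed simp

lemma drawing_order_leftmost: "drawing p \<Longrightarrow> drawing (order_leftmost p)"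
proof (induction p)
  case (PNode ts)
  from PNode.prems obtain x y zs where ts: "ts = x # y # zs"
    by (cases ts rule: list_cases2) auto
  have "map (least_label \<circ> order_leftmost) zs = map least_label zs" by simp
  moreover have "disjoint_labels (map order_leftmost zs)"
    using PNode.prems ts by (simp add: sorted_wrt_map)
  ultimately show ?case using PNode unfolding ts order_leftmost_PNode by auto
qed simp

lemma order_leftmost_cong:
  "map order_leftmost us = map order_leftmost vs \<Longrightarrow>
    order_leftmost (PNode us) = order_leftmost (PNode vs)"
  by (simp only: order_leftmost.simps)

lemma order_leftmost_swap:
  "least_label x \<noteq> least_label y \<Longrightarrow>
    order_leftmost (PNode (x # y # zs)) = order_leftmost (PNode (y # x # zs))"
  by (auto simp: order_leftmost_PNode)

text \<open>After an injective renaming the two exchanged subtrees still have different least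
  labels, so sorting puts them in the same order.\<close>

lemma swapped_order_leftmost:
  assumes "swapped j q q'" "inj_on f {..j}"
  shows "order_leftmost (map_ptree f q) = order_leftmost (map_ptree f q')"
  using assms(1)
proof (induction rule: swapped.induct)
  case (swap x zs)
  have x: "plabels x \<noteq> {}" using swap by (intro drawing_plabels_nonempty)
  then have "least_label (map_ptree f x) \<in> f ` plabels x"
    unfolding least_label_def plabels_map by (intro Min_in) auto
  then obtain a where "a \<in> plabels x" "least_label (map_ptree f x) = f a" by auto
  moreover from this have "f a \<noteq> f j" using swap(2) inj_onD[OF assms(2), of a j] by auto
  ultimately show ?case by (simp add: order_leftmost_swap)
next
  case (inside v w us vs)
  then show ?case by (auto intro!: order_leftmost_cong)
qed

section \<open>Insertion sums under renaming and reordering\<close>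

context insertion_weights begin

lemma loc_sum_map:
  "g (PLeaf j) = PLeaf k \<Longrightarrow> loc_sum k F (map g zs) = loc_sum j (\<lambda>u. F (map g u)) zs"
  by (induction zs arbitrary: F) auto

lemma ins_sum_map: "ins_sum (f j) g (map_ptree f p) = ins_sum j (\<lambda>q. g (map_ptree f q)) p"
proof (induction p arbitrary: g)
  case (PNode ts)
  have "ins_sums (f j) F (map (map_ptree f) us) = ins_sums j (\<lambda>u. F (map (map_ptree f) u)) us"
    if "set us \<subseteq> set ts" for us F
    using that PNode by (induction us arbitrary: F) auto
  then show ?case by (simp add: take_map drop_map loc_sum_map[of "map_ptree f" j])
qed simp

lemma loc_sum_const: "loc_sum j (\<lambda>_. 1) zs = length zs * \<alpha> + \<alpha> - \<gamma>"
  by (induction zs) (auto simp: algebra_simps)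

text \<open>A branch point with \<open>c\<close> children and the edge above it contribute (c - 1)
  \<alpha>. Its subtrees, with m leaves in all, contribute m - c \<alpha> by induction.\<close>

lemma ins_sum_total:
  "drawing p \<Longrightarrow> ins_sum j (\<lambda>_. 1) p = card (plabels p) - \<alpha>"
proof (induction p)
  case (PNode ts)
  have "ins_sums j (\<lambda>_. 1) us = card (\<Union>t\<in>set us. plabels t) - length us * \<alpha>"
    if "set us \<subseteq> set ts" "disjoint_labels us" for us
    using that
  proof (induction us)
    case (Cons u us)
    have "card (plabels u \<union> (\<Union>t\<in>set us. plabels t)) = card (plabels u) + card (\<Union>t\<in>set us. plabels t)"
      using Cons.prems by (intro card_Un_disjoint) auto
    moreover have "ins_sum j (\<lambda>_. 1) u = card (plabels u) - \<alpha>"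
      using PNode Cons.prems by auto
    ultimately show ?case using Cons by (simp add: algebra_simps)
  qed simp
  from this[of ts] show ?case using PNode.prems
    by (simp add: loc_sum_const algebra_simps)
qed simp

text \<open>No location lies between or before the two leftmost subtrees, and \<open>f\<close> does
  not see their order. As the new label is the largest, inserting it into one of them does not
  change which has the smaller least label.\<close>

lemma ins_sum_order_leftmost:
  assumes "drawing p" "\<forall>k\<in>plabels p. k < j" "\<And>q. f (order_leftmost q) = f q"
  shows "ins_sum j f (order_leftmost p) = ins_sum j f p"
  using assms
proof (induction p arbitrary: f)
  case (PNode ts)
  from PNode.prems obtain x y zs where ts: "ts = x # y # zs"
    by (cases ts rule: list_cases2) auto
  let ?o = "order_leftmost" and ?l = "least_label"
  note f = PNode.prems(3)
  have fcong: "f q = f q'" if "?o q = ?o q'" for q q' using f[of q] f[of q'] that by simp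
  have IH: "ins_sum j (\<lambda>s. f (PNode (us @ s # vs))) (?o t) = ins_sum j (\<lambda>s. f (PNode (us @ s # vs))) t"
    if "t \<in> set ts" for us vs t
    using PNode.prems that
    by (intro PNode.IH) (auto intro!: fcong order_leftmost_cong)
  have kids: "ins_sums j (\<lambda>u. f (PNode (us @ u))) (map ?o ws) = ins_sums j (\<lambda>u. f (PNode (us @ u))) ws"
    if "set ws \<subseteq> set ts" for us ws
    using that
  proof (induction ws arbitrary: us)
    case (Cons w ws)
    have "ins_sums j (\<lambda>u. f (PNode (us @ ?o w # u))) (map ?o ws) = ins_sums j (\<lambda>u. f (PNode (us @ ?o w # u))) ws"
      using Cons.IH[of "us @ [?o w]"] Cons.prems by simp
    also have "\<dots> = ins_sums j (\<lambda>u. f (PNode (us @ w # u))) ws"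
      by (intro ins_sum_cong(2) fcong order_leftmost_cong) simp
    moreover have "ins_sum j (\<lambda>s. f (PNode (us @ s # map ?o ws))) (?o w) = ins_sum j (\<lambda>s. f (PNode (us @ s # ws))) w"
      using IH[of w us "map ?o ws"] Cons.prems
      by (simp, intro ins_sum_cong(1) fcong order_leftmost_cong) simp
    ultimately show ?case by simp
  qed simp
  let ?ts = "(if ?l x \<le> ?l y then [?o x, ?o y] else [?o y, ?o x]) @ map ?o zs"
  have o: "?o (PNode ts) = PNode ?ts" unfolding ts by (rule order_leftmost_PNode)
  have pair: "?o (PNode ((if ?l x \<le> ?l y then [?o x, ?o y] else [?o y, ?o x]) @ map ?o u)) = ?o (PNode (x # y # u))" for u
    by (auto simp: order_leftmost_PNode)
  have root: "f (PNode [PNode ?ts, PLeaf j]) = f (PNode [PNode ts, PLeaf j])"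
    using o by (intro fcong order_leftmost_cong) (metis list.simps(8,9) order_leftmost_idem)
  have "loc_sum j (\<lambda>u. f (PNode ((if ?l x \<le> ?l y then [?o x, ?o y] else [?o y, ?o x]) @ u))) (map ?o zs) =
      loc_sum j (\<lambda>u. f (PNode (x # y # u))) zs"
    unfolding loc_sum_map[of ?o j, OF order_leftmost.simps(1)] by (intro loc_sum_cong fcong pair)
  then have locs: "locs_sum j (\<lambda>u. f (PNode u)) ?ts = locs_sum j (\<lambda>u. f (PNode u)) ts"
    by (simp add: locs_sum_def ts numeral_2_eq_2)
  have "ins_sums j (\<lambda>u. f (PNode u)) ?ts = ins_sums j (\<lambda>u. f (PNode u)) ts"
  proof (cases "?l x \<le> ?l y")
    case True
    then show ?thesis using kids[of ts "[]"] ts by simp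
  next
    \<comment> \<open>The two leading subtrees change places, so the sums over insertions into them
      are matched crosswise.\<close>
    case False
    have g: "?l s \<noteq> ?l y" if "grown j x s" for s
      using grown_least_label[OF that] PNode.prems ts False by simp
    have g': "?l x \<noteq> ?l s" if "grown j y s" for s
      using grown_least_label[OF that] PNode.prems ts False by simp
    have "ins_sum j (\<lambda>s. f (PNode (s # ?o x # map ?o zs))) (?o y) = ins_sum j (\<lambda>s. f (PNode (s # ?o x # map ?o zs))) y"
      using IH[of y "[]" "?o x # map ?o zs"] ts by simp
    also have "\<dots> = ins_sum j (\<lambda>s. f (PNode (x # s # zs))) y"
      by (intro ins_sum_cong(1) fcong) (force dest: g' simp: order_leftmost_PNode)
    finally have 1: "ins_sum j (\<lambda>s. f (PNode (s # ?o x # map ?o zs))) (?o y) = \<dots>" .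
    have "ins_sum j (\<lambda>s. f (PNode (?o y # s # map ?o zs))) (?o x) = ins_sum j (\<lambda>s. f (PNode (?o y # s # map ?o zs))) x"
      using IH[of x "[?o y]" "map ?o zs"] ts by simp
    also have "\<dots> = ins_sum j (\<lambda>s. f (PNode (s # y # zs))) x"
      using g by (intro ins_sum_cong(1) fcong) (force simp: order_leftmost_PNode)
    finally have 2: "ins_sum j (\<lambda>s. f (PNode (?o y # s # map ?o zs))) (?o x) = \<dots>" .
    have "ins_sums j (\<lambda>u. f (PNode (?o y # ?o x # u))) (map ?o zs) = ins_sums j (\<lambda>u. f (PNode (?o y # ?o x # u))) zs"
      using kids[of zs "[?o y, ?o x]"] ts by auto
    also have "\<dots> = ins_sums j (\<lambda>u. f (PNode (x # y # u))) zs"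
      using False by (intro ins_sum_cong(2) fcong) (auto simp: order_leftmost_PNode)
    finally have 3: "ins_sums j (\<lambda>u. f (PNode (?o y # ?o x # u))) (map ?o zs) = \<dots>" .
    show ?thesis using False 1 2 3 ts by simp
  qed
  then show ?case unfolding o unfolding ins_sum_PNode root locs by simp
qed simp

end

section \<open>Semi-planar trees and their drawings\<close>

lemma leaf_labels_shape [simp]: "leaf_labels (shape p) = plabels p"
  by (induction p) (auto simp: fset_of_list.rep_eq)

lemma shape_inj:
  assumes "disjoint_labels ts" "\<And>t. t \<in> set ts \<Longrightarrow> plabels t \<noteq> {}"
  shows "inj_on shape (set ts)"
proof (rule inj_onI)
  fix s t assume st: "s \<in> set ts" "t \<in> set ts" "shape s = shape t"
  then have "plabels s = plabels t" by (metis leaf_labels_shape)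
  moreover obtain x where "x \<in> plabels s" using assms(2) st by blast
  ultimately show "s = t" using disjoint_labels_unique[OF assms(1)] st by metis
qed

lemma fset_shape: "fset (fset_of_list (map shape ts)) = shape ` set ts"
  by (simp add: fset_of_list.rep_eq)

lemma drawing_children:
  assumes "drawing (PNode ts)"
  shows "distinct ts" "inj_on shape (set ts)" "fcard (fset_of_list (map shape ts)) = length ts"
    "inj_on least_label (set ts)"
proof -
  have ne: "t \<in> set ts \<Longrightarrow> plabels t \<noteq> {}" for t using assms drawing_plabels_nonempty by auto
  show "distinct ts" using assms by (intro disjoint_labels_distinct ne) auto
  show inj: "inj_on shape (set ts)" using assms by (intro shape_inj ne) auto
  show "fcard (fset_of_list (map shape ts)) = length ts"
    using card_image[OF inj] distinct_card[OF \<open>distinct ts\<close>]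
    by (simp add: fcard.rep_eq fset_of_list.rep_eq)
  show "inj_on least_label (set ts)"
    using drawing_least_label_inj[OF assms] by (auto intro: inj_onI)
qed

lemma finite_leaf_labels [simp]: "finite (leaf_labels t)"
  by (induction t) auto

lemma is_tree_leaf_labels_nonempty: "is_tree t \<Longrightarrow> leaf_labels t \<noteq> {}"
proof (induction rule: is_tree.induct)
  case (2 F)
  then have "F \<noteq> {||}" by (auto simp: fcard.rep_eq)
  then show ?case using 2 by auto
qed simp

lemma subtrees_leaf_labels: "v \<in> subtrees t \<Longrightarrow> leaf_labels v \<subseteq> leaf_labels t"
  by (induction t) auto

lemma subtrees_is_tree: "is_tree t \<Longrightarrow> v \<in> subtrees t \<Longrightarrow> is_tree v"
  by (induction rule: is_tree.induct) (auto intro: is_tree.intros)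

lemma is_tree_NodeD:
  assumes "is_tree (Node F)"
  shows "2 \<le> fcard F" "t |\<in>| F \<Longrightarrow> is_tree t" "disjoint_family_on leaf_labels (fset F)"
  using assms by (auto elim: is_tree.cases)

lemma subtrees_children_disjoint:
  assumes "is_tree (Node F)" "s |\<in>| F" "t |\<in>| F" "v \<in> subtrees s" "v \<in> subtrees t"
  shows "s = t"
proof (rule ccontr)
  assume "s \<noteq> t"
  then have "leaf_labels s \<inter> leaf_labels t = {}"
    using is_tree_NodeD(3)[OF assms(1)] assms(2,3) by (auto simp: disjoint_family_on_def)
  moreover have "leaf_labels v \<noteq> {}"
    using subtrees_is_tree is_tree_NodeD(2)[OF assms(1)] assms is_tree_leaf_labels_nonempty by blast
  ultimately show False using subtrees_leaf_labels[OF assms(4)] subtrees_leaf_labels[OF assms(5)] by blast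
qed

text \<open>A child lacks the labels of its siblings, hence cannot contain the whole tree.\<close>

lemma Node_notin_subtrees:
  assumes "is_tree (Node F)" "t |\<in>| F"
  shows "Node F \<notin> subtrees t"
proof
  assume "Node F \<in> subtrees t"
  then have sub: "leaf_labels (Node F) \<subseteq> leaf_labels t" by (rule subtrees_leaf_labels)
  have "\<not> fset F \<subseteq> {t}"
    using is_tree_NodeD(1)[OF assms(1)] card_mono[of "{t}" "fset F"] by (auto simp: fcard.rep_eq)
  then obtain s where "s |\<in>| F" "s \<noteq> t" by auto
  then show False
    using subtrees_children_disjoint[OF assms(1) _ assms(2), of s] sub is_tree_NodeD[OF assms(1)] assms(2)
      is_tree_leaf_labels_nonempty[of s] by (force simp: disjoint_family_on_def)
qed

lemma branch_points_Node:
  "branch_points (Node F) = insert (Node F) (\<Union>t\<in>fset F. branch_points t)"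
  by (auto simp: branch_points_def)

lemma branch_points_Leaf [simp]: "branch_points (Leaf i) = {}"
  by (auto simp: branch_points_def)

lemma finite_subtrees [simp]: "finite (subtrees t)"
  by (induction t) auto

lemma finite_branch_points [simp]: "finite (branch_points t)"
  by (simp add: branch_points_def)

text \<open>List positions count from 0, while the permutations act on a set starting at 1; hence
  the shift.\<close>

lemma layout_permute:
  assumes "\<sigma> permutes {1..length zs}"
  shows "layout \<sigma> (x # y # zs) = x # y # permute_list (\<lambda>k. inv \<sigma> (Suc k) - 1) zs"
    "(\<lambda>k. inv \<sigma> (Suc k) - 1) permutes {..<length zs}"
proof -
  have i: "inv \<sigma> permutes {1..length zs}" using assms by (rule permutes_inv)
  have pos: "inv \<sigma> (Suc k) \<ge> 1" for k
    using permutes_in_image[OF i, of "Suc k"] permutes_not_in[OF i, of "Suc k"]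
    by (cases "Suc k \<in> {1..length zs}") auto
  show "layout \<sigma> (x # y # zs) = x # y # permute_list (\<lambda>k. inv \<sigma> (Suc k) - 1) zs"
  proof (rule nth_equalityI)
    fix k assume "k < length (layout \<sigma> (x # y # zs))"
    then have k: "k < Suc (Suc (length zs))" by (simp add: layout_def)
    show "layout \<sigma> (x # y # zs) ! k = (x # y # permute_list (\<lambda>k. inv \<sigma> (Suc k) - 1) zs) ! k"
    proof (cases "k < 2")
      case True
      then consider "k = 0" | "k = 1" by linarith
      then show ?thesis by cases (simp_all add: layout_def del: upt_Suc)
    next
      case False
      then obtain m where m: "k = Suc (Suc m)" by (metis add_2_eq_Suc le_add_diff_inverse not_less)
      obtain r where "inv \<sigma> (Suc m) = Suc r" using pos[of m] by (cases "inv \<sigma> (Suc m)") auto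
      then show ?thesis using k m by (simp add: layout_def permute_list_def del: upt_Suc)
    qed
  qed (simp add: layout_def)
  show "(\<lambda>k. inv \<sigma> (Suc k) - 1) permutes {..<length zs}"
  proof (rule bij_imp_permutes)
    have "inj_on (\<lambda>k. inv \<sigma> (Suc k) - 1) {..<length zs}"
    proof (rule inj_onI)
      fix a b assume "inv \<sigma> (Suc a) - 1 = inv \<sigma> (Suc b) - 1"
      then have "inv \<sigma> (Suc a) = inv \<sigma> (Suc b)" using pos[of a] pos[of b] by linarith
      then show "a = b" using permutes_inj[OF i] by (auto dest: injD)
    qed
    moreover have "(\<lambda>k. inv \<sigma> (Suc k) - 1) ` {..<length zs} \<subseteq> {..<length zs}"
    proof (rule image_subsetI)
      fix k assume "k \<in> {..<length zs}"
      then have "inv \<sigma> (Suc k) \<in> {1..length zs}" using permutes_in_image[OF i, of "Suc k"] by simp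
      then show "inv \<sigma> (Suc k) - 1 \<in> {..<length zs}" by auto
    qed
    ultimately show "bij_betw (\<lambda>k. inv \<sigma> (Suc k) - 1) {..<length zs} {..<length zs}"
      by (simp add: bij_betw_def endo_inj_surj)
  next
    fix k assume "k \<notin> {..<length zs}"
    then show "inv \<sigma> (Suc k) - 1 = k" using permutes_not_in[OF i, of "Suc k"] by simp
  qed
qed

lemma layout_mset:
  assumes "\<sigma> permutes {1..length zs}"
  obtains ws where "layout \<sigma> (x # y # zs) = x # y # ws" "mset ws = mset zs"
  using layout_permute[OF assms] mset_permute_list by blast

lemma layout_surj:
  assumes "mset ws = mset zs"
  obtains \<sigma> where "\<sigma> permutes {1..length zs}" "layout \<sigma> (x # y # zs) = x # y # ws"
proof -
  obtain p where p: "p permutes {..<length zs}" "permute_list p zs = ws"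
    using mset_eq_permutation[OF assms] by blast
  \<comment> \<open>This is \<open>p\<close> shifted to indices from 1. As \<open>layout\<close>
    uses inverse permutations, the witness is \<open>inv \<rho>\<close>.\<close>
  define \<rho> where "\<rho> k = (case k of 0 \<Rightarrow> 0 | Suc m \<Rightarrow> Suc (p m))" for k
  have r: "\<rho> permutes {1..length zs}"
  proof (rule bij_imp_permutes)
    have "inj_on \<rho> {1..length zs}"
    proof (rule inj_onI)
      fix a b assume "\<rho> a = \<rho> b"
      then show "a = b" by (cases a; cases b) (simp_all add: \<rho>_def inj_eq[OF permutes_inj[OF p(1)]])
    qed
    moreover have "\<rho> ` {1..length zs} \<subseteq> {1..length zs}"
    proof (rule image_subsetI)
      fix k assume "k \<in> {1..length zs}"
      then obtain m where "k = Suc m" "m < length zs" by (cases k) auto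
      then show "\<rho> k \<in> {1..length zs}" using permutes_in_image[OF p(1), of m] by (simp add: \<rho>_def)
    qed
    ultimately show "bij_betw \<rho> {1..length zs} {1..length zs}"
      by (simp add: bij_betw_def endo_inj_surj)
  next
    fix k assume "k \<notin> {1..length zs}"
    then show "\<rho> k = k" using permutes_not_in[OF p(1)] by (auto simp: \<rho>_def split: nat.splits)
  qed
  have i: "inv \<rho> permutes {1..length zs}" using r by (rule permutes_inv)
  have "inv (inv \<rho>) = \<rho>" using r by (rule permutes_inv_inv)
  then have "layout (inv \<rho>) (x # y # zs) = x # y # ws"
    using layout_permute(1)[OF i, of x y] p(2) by (simp add: \<rho>_def)
  then show thesis using that i by blast
qed

lemma layout_inj:
  assumes "\<sigma> permutes {1..length zs}" "\<sigma>' permutes {1..length zs}" "distinct zs"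
    "layout \<sigma> (x # y # zs) = layout \<sigma>' (x # y # zs)"
  shows "\<sigma> = \<sigma>'"
proof -
  note i = permutes_inv[OF assms(1)] and i' = permutes_inv[OF assms(2)]
  have "inv \<sigma> (Suc k) = inv \<sigma>' (Suc k)" if k: "k < length zs" for k
  proof -
    have "permute_list (\<lambda>k. inv \<sigma> (Suc k) - 1) zs ! k = permute_list (\<lambda>k. inv \<sigma>' (Suc k) - 1) zs ! k"
      using assms(4) layout_permute(1)[OF assms(1), of x y] layout_permute(1)[OF assms(2), of x y] by simp
    then have e: "zs ! (inv \<sigma> (Suc k) - 1) = zs ! (inv \<sigma>' (Suc k) - 1)"
      using k by (simp add: permute_list_def)
    have r: "inv \<sigma> (Suc k) \<in> {1..length zs}" "inv \<sigma>' (Suc k) \<in> {1..length zs}"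
      using permutes_in_image[OF i, of "Suc k"] permutes_in_image[OF i', of "Suc k"] k by simp_all
    then have "inv \<sigma> (Suc k) - 1 < length zs" "inv \<sigma>' (Suc k) - 1 < length zs" by auto
    then have "inv \<sigma> (Suc k) - 1 = inv \<sigma>' (Suc k) - 1"
      using e nth_eq_iff_index_eq[OF assms(3)] by blast
    then show ?thesis using r by auto
  qed
  moreover have "inv \<sigma> k = inv \<sigma>' k" if "k \<notin> {1..length zs}" for k
    using permutes_not_in[OF i that] permutes_not_in[OF i' that] by simp
  ultimately have "inv \<sigma> k = inv \<sigma>' k" for k
    by (cases "k \<in> {1..length zs}"; cases k) auto
  then have "inv \<sigma> = inv \<sigma>'" by auto
  then show ?thesis using permutes_inv_inv[OF assms(1)] permutes_inv_inv[OF assms(2)] by metis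
qed

text \<open>\<open>least_label\<close> is injective on disjointly labelled siblings but not
  globally, so the theory of sorted key lists is interpreted for the set at hand.\<close>

lemma (in linorder) sorted_key_list_of_set_inj:
  assumes "inj_on f A" "finite A"
  shows "sorted_wrt (<) (map f l) \<and> set l = A \<and> length l = card A \<longleftrightarrow> sorted_key_list_of_set f A = l"
proof -
  interpret folding_insort_key "(\<le>)" "(<)" A f by standard (rule assms(1))
  show ?thesis by (rule sorted_key_list_of_set_unique[OF subset_refl assms(2)])
qed

text \<open>A form independent of the order of the siblings, for lists that a layout has
  permuted.\<close>

lemma disjoint_labels_iff:
  "distinct ts \<Longrightarrow> disjoint_labels ts \<longleftrightarrow> (\<forall>s\<in>set ts. \<forall>t\<in>set ts. s \<noteq> t \<longrightarrow> plabels s \<inter> plabels t = {})"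
proof (induction ts)
  case (Cons a ts)
  have aux: "((\<forall>t\<in>S. D a t) \<and> (\<forall>s\<in>S. \<forall>t\<in>S. s \<noteq> t \<longrightarrow> D s t)) =
      (\<forall>s\<in>insert a S. \<forall>t\<in>insert a S. s \<noteq> t \<longrightarrow> D s t)"
    if "\<And>s t. D s t \<Longrightarrow> D t s" "a \<notin> S" for D :: "'a ptree \<Rightarrow> 'a ptree \<Rightarrow> bool" and S
  proof
    assume L: "(\<forall>t\<in>S. D a t) \<and> (\<forall>s\<in>S. \<forall>t\<in>S. s \<noteq> t \<longrightarrow> D s t)"
    show "\<forall>s\<in>insert a S. \<forall>t\<in>insert a S. s \<noteq> t \<longrightarrow> D s t"
    proof (intro ballI impI)
      fix s t assume "s \<in> insert a S" "t \<in> insert a S" "s \<noteq> t"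
      then consider "s = a" "t \<in> S" | "t = a" "s \<in> S" | "s \<in> S" "t \<in> S" by blast
      then show "D s t" using L \<open>s \<noteq> t\<close> by cases (auto intro: that(1))
    qed
  qed (use that(2) in auto)
  have "plabels t \<inter> plabels s = {}" if "plabels s \<inter> plabels t = {}" for s t :: "'a ptree"
    by (subst Int_commute) (rule that)
  note sym = this
  have a: "a \<notin> set ts" and d: "distinct ts" using Cons.prems by auto
  show ?case unfolding sorted_wrt.simps(2) Cons.IH[OF d] list.set(2) by (rule aux[OF sym a])
qed simp

text \<open>Without extensionality, unlike \<open>semiplanar_trees\<close>, so that the same
  \<open>\<sigma>\<close> serves all subtrees.\<close>

definition arranges :: "(nat ltree \<Rightarrow> nat \<Rightarrow> nat) \<Rightarrow> nat ltree \<Rightarrow> bool" where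
  "arranges \<sigma> t \<longleftrightarrow> (\<forall>v\<in>branch_points t. \<sigma> v permutes {1..fcard (children v) - 2})"

definition sorted_children :: "(nat ltree \<Rightarrow> nat \<Rightarrow> nat) \<Rightarrow> nat ltree fset \<Rightarrow> nat ptree list" where
  "sorted_children \<sigma> F = sorted_key_list_of_set least_label (fset (draw_with \<sigma> |`| F))"

lemma draw_with_Node: "draw_with \<sigma> (Node F) = PNode (layout (\<sigma> (Node F)) (sorted_children \<sigma> F))"
  by (simp add: sorted_children_def)

lemma sorted_children_props:
  assumes "is_tree (Node F)"
    and IH: "\<And>t. t |\<in>| F \<Longrightarrow> drawing (draw_with \<sigma> t) \<and> plabels (draw_with \<sigma> t) = leaf_labels t"
  obtains x y zs where "sorted_children \<sigma> F = x # y # zs" "length zs = fcard F - 2"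
    "set (x # y # zs) = draw_with \<sigma> ` fset F" "sorted_wrt (<) (map least_label (x # y # zs))"
    "distinct (x # y # zs)" "\<And>s t. s \<in> set (x # y # zs) \<Longrightarrow> t \<in> set (x # y # zs) \<Longrightarrow> s \<noteq> t \<Longrightarrow> plabels s \<inter> plabels t = {}"
proof -
  have disj: "leaf_labels s \<inter> leaf_labels t = {}" if "s |\<in>| F" "t |\<in>| F" "s \<noteq> t" for s t
    using is_tree_NodeD(3)[OF assms(1)] that by (auto simp: disjoint_family_on_def)
  have inj1: "s = t" if "s |\<in>| F" "t |\<in>| F" "least_label (draw_with \<sigma> s) = least_label (draw_with \<sigma> t)" for s t
    using disj[OF that(1,2)] IH[OF that(1)] IH[OF that(2)] that(3)
      least_label_in[of "draw_with \<sigma> s"] least_label_in[of "draw_with \<sigma> t"] by auto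
  let ?D = "draw_with \<sigma> ` fset F"
  have "inj_on least_label ?D" using inj1 by (auto intro!: inj_onI)
  moreover have "inj_on (draw_with \<sigma>) (fset F)" using inj1 by (auto intro!: inj_onI)
  then have c: "card ?D = fcard F" by (simp add: card_image fcard.rep_eq)
  ultimately have l: "sorted_wrt (<) (map least_label (sorted_children \<sigma> F))" "set (sorted_children \<sigma> F) = ?D"
      "length (sorted_children \<sigma> F) = fcard F"
    using sorted_key_list_of_set_inj[of least_label ?D "sorted_children \<sigma> F"] by (auto simp: sorted_children_def)
  then have "2 \<le> length (sorted_children \<sigma> F)" using is_tree_NodeD(1)[OF assms(1)] by simp
  then obtain x y zs where xyz: "sorted_children \<sigma> F = x # y # zs"
    by (cases "sorted_children \<sigma> F" rule: list_cases2) simp_all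
  have dist: "distinct (x # y # zs)" using l(1) xyz by (metis distinct_map strict_sorted_iff)
  show thesis
  proof (rule that[OF xyz])
    show "length zs = fcard F - 2" "set (x # y # zs) = ?D" "sorted_wrt (<) (map least_label (x # y # zs))"
      "distinct (x # y # zs)" using l dist unfolding xyz by auto
    show "\<And>s t. s \<in> set (x # y # zs) \<Longrightarrow> t \<in> set (x # y # zs) \<Longrightarrow> s \<noteq> t \<Longrightarrow> plabels s \<inter> plabels t = {}"
      using disj IH l(2) unfolding xyz by (metis imageE)
  qed
qed

lemma draw_with_props:
  "is_tree t \<Longrightarrow> arranges \<sigma> t \<Longrightarrow> drawing (draw_with \<sigma> t) \<and> order_leftmost (draw_with \<sigma> t) = draw_with \<sigma> t \<and>
     shape (draw_with \<sigma> t) = t \<and> plabels (draw_with \<sigma> t) = leaf_labels t"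
proof (induction rule: is_tree.induct)
  case (2 F)
  have tr: "is_tree (Node F)" by (rule is_tree.intros(2)[OF 2(1,2,3)])
  have IH: "drawing (draw_with \<sigma> t) \<and> order_leftmost (draw_with \<sigma> t) = draw_with \<sigma> t \<and>
     shape (draw_with \<sigma> t) = t \<and> plabels (draw_with \<sigma> t) = leaf_labels t" if "t |\<in>| F" for t
    using 2 that by (auto simp: arranges_def branch_points_Node)
  obtain x y zs where s: "sorted_children \<sigma> F = x # y # zs" "length zs = fcard F - 2"
    "set (x # y # zs) = draw_with \<sigma> ` fset F" "sorted_wrt (<) (map least_label (x # y # zs))"
    "distinct (x # y # zs)" "\<And>s t. s \<in> set (x # y # zs) \<Longrightarrow> t \<in> set (x # y # zs) \<Longrightarrow> s \<noteq> t \<Longrightarrow> plabels s \<inter> plabels t = {}"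
    by (rule sorted_children_props[OF tr, of \<sigma>]) (use IH in auto)
  have perm: "\<sigma> (Node F) permutes {1..length zs}"
    using 2(5) s(2) by (auto simp: arranges_def branch_points_Node)
  obtain ws where ws: "layout (\<sigma> (Node F)) (x # y # zs) = x # y # ws" "mset ws = mset zs"
    by (rule layout_mset[OF perm])
  have sw: "set ws = set zs" using ws(2) by (metis set_mset_mset)
  have d: "draw_with \<sigma> (Node F) = PNode (x # y # ws)" unfolding draw_with_Node s(1) ws(1) ..
  have set: "set (x # y # ws) = draw_with \<sigma> ` fset F" using s(3) sw by simp
  have "distinct (x # y # ws)" using s(5) ws(2) sw mset_eq_imp_distinct_iff[OF ws(2)] by auto
  then have "disjoint_labels (x # y # ws)" using disjoint_labels_iff[of "x # y # ws"] s(6) sw by simp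
  moreover have "lead2 (map least_label (x # y # ws))" "least_label x \<le> least_label y"
    using s(4) sw by auto
  moreover have "\<forall>t\<in>set (x # y # ws). drawing t \<and> order_leftmost t = t" using set IH by auto
  ultimately have "drawing (PNode (x # y # ws))" "order_leftmost (PNode (x # y # ws)) = PNode (x # y # ws)"
    by (auto simp: order_leftmost_PNode intro: map_idI)
  moreover have "shape (PNode (x # y # ws)) = Node F"
  proof -
    have "shape ` set (x # y # ws) = fset F" unfolding set using IH by (force simp: image_image)
    then show ?thesis unfolding shape.simps using fset_shape[of "x # y # ws"] by (simp only: fset_inject)
  qed
  moreover have "plabels (PNode (x # y # ws)) = leaf_labels (Node F)"
  proof -
    have "plabels (PNode (x # y # ws)) = (\<Union>t\<in>draw_with \<sigma> ` fset F. plabels t)"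
      using set by simp
    then show ?thesis using IH by auto
  qed
  ultimately show ?case unfolding d by blast
qed simp

lemma draw_with_cong:
  "(\<And>v. v \<in> branch_points t \<Longrightarrow> \<sigma> v = \<sigma>' v) \<Longrightarrow> draw_with \<sigma> t = draw_with \<sigma>' t"
proof (induction t)
  case (Node F)
  have "draw_with \<sigma> t = draw_with \<sigma>' t" if "t |\<in>| F" for t
    using Node that by (auto simp: branch_points_Node)
  then have "draw_with \<sigma> |`| F = draw_with \<sigma>' |`| F" by (intro fimage_cong) auto
  then show ?case using Node.prems[of "Node F"] by (simp add: branch_points_Node)
qed simp

text \<open>Shapes tell which drawn subtree belongs to which child, so equal drawings agree child by
  child. Then both permutations lay out the same sorted list without repetitions in the same
  way.\<close>

lemma draw_with_inj:
  "is_tree t \<Longrightarrow> arranges \<sigma> t \<Longrightarrow> arranges \<sigma>' t \<Longrightarrow> draw_with \<sigma> t = draw_with \<sigma>' t \<Longrightarrow>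
     v \<in> branch_points t \<Longrightarrow> \<sigma> v = \<sigma>' v"
proof (induction arbitrary: v rule: is_tree.induct)
  case (2 F)
  have tr: "is_tree (Node F)" by (rule is_tree.intros(2)[OF 2(1,2,3)])
  have ar: "arranges \<sigma> t" "arranges \<sigma>' t" if "t |\<in>| F" for t
    using 2(5,6) that by (auto simp: arranges_def branch_points_Node)
  note p = draw_with_props[OF is_tree_NodeD(2)[OF tr]]
  obtain x y zs where s: "sorted_children \<sigma> F = x # y # zs" "length zs = fcard F - 2"
    "set (x # y # zs) = draw_with \<sigma> ` fset F" "sorted_wrt (<) (map least_label (x # y # zs))"
    "distinct (x # y # zs)"
    by (rule sorted_children_props[OF tr, of \<sigma>]) (use p ar in auto)
  obtain x' y' zs' where s': "sorted_children \<sigma>' F = x' # y' # zs'" "length zs' = fcard F - 2"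
    "set (x' # y' # zs') = draw_with \<sigma>' ` fset F"
    by (rule sorted_children_props[OF tr, of \<sigma>']) (use p ar in auto)
  have perm: "\<sigma> (Node F) permutes {1..length zs}" "\<sigma>' (Node F) permutes {1..length zs}"
    using 2(5,6) s(2) by (auto simp: arranges_def branch_points_Node)
  have eq: "layout (\<sigma> (Node F)) (x # y # zs) = layout (\<sigma>' (Node F)) (x' # y' # zs')"
    using 2(7) unfolding draw_with_Node s(1) s'(1) by simp
  obtain ws where ws: "layout (\<sigma> (Node F)) (x # y # zs) = x # y # ws" "mset ws = mset zs"
    by (rule layout_mset[OF perm(1)])
  obtain ws' where ws': "layout (\<sigma>' (Node F)) (x' # y' # zs') = x' # y' # ws'" "mset ws' = mset zs'"
    using layout_mset[of "\<sigma>' (Node F)" zs' x' y'] perm(2) s(2) s'(2) by metis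
  have "draw_with \<sigma> ` fset F = draw_with \<sigma>' ` fset F"
    using eq ws ws' s(3) s'(3) by (metis list.simps(15) set_mset_mset)
  note images = this
  have sub: "draw_with \<sigma> t = draw_with \<sigma>' t" if "t |\<in>| F" for t
  proof -
    have "draw_with \<sigma> t \<in> draw_with \<sigma>' ` fset F" using images that by blast
    then obtain t' where t': "t' |\<in>| F" "draw_with \<sigma> t = draw_with \<sigma>' t'" by auto
    then have "t = t'" using p[OF that ar(1)[OF that]] p[OF t'(1) ar(2)[OF t'(1)]] by metis
    then show ?thesis using t' by simp
  qed
  then have "draw_with \<sigma> |`| F = draw_with \<sigma>' |`| F" by (intro fimage_cong) auto
  then have "sorted_children \<sigma> F = sorted_children \<sigma>' F" by (simp add: sorted_children_def)
  then have "\<sigma> (Node F) = \<sigma>' (Node F)"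
    using layout_inj[OF perm, of x y] eq s(1,5) s'(1) by simp
  moreover have "\<sigma> v = \<sigma>' v" if "t |\<in>| F" "v \<in> branch_points t" for t
    using 2(4)[OF that(1)] ar that sub by blast
  ultimately show ?case using 2(8) by (auto simp: branch_points_Node)
qed simp

lemma drawing_is_tree: "drawing p \<Longrightarrow> is_tree (shape p)"
proof (induction p)
  case (PNode ts)
  have "disjoint_family_on leaf_labels (shape ` set ts)"
    unfolding disjoint_family_on_def
    using PNode.prems disjoint_labels_iff[OF drawing_children(1)[OF PNode.prems]] by fastforce
  then show ?case using PNode drawing_children(3)[OF PNode.prems]
    by (auto intro!: is_tree.intros simp: fset_of_list_elem fset_of_list.rep_eq)
qed (simp add: is_tree.intros)

lemma draw_with_surj:
  "drawing p \<Longrightarrow> order_leftmost p = p \<Longrightarrow> \<exists>\<sigma>. arranges \<sigma> (shape p) \<and> draw_with \<sigma> (shape p) = p"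
proof (induction p)
  case (PLeaf i)
  then show ?case by (auto simp: arranges_def)
next
  case (PNode ts)
  let ?F = "fset_of_list (map shape ts)"
  obtain x y zs where ts: "ts = x # y # zs" using PNode.prems by (cases ts rule: list_cases2) auto
  note ch = drawing_children[OF PNode.prems(1)]
  have tr: "is_tree (Node ?F)" using drawing_is_tree[OF PNode.prems(1)] by simp
  have ol: "least_label x \<le> least_label y" "order_leftmost x = x" "order_leftmost y = y" "map order_leftmost zs = zs"
    using PNode.prems(2) unfolding ts order_leftmost_PNode
    by (auto split: if_splits)
  have "\<exists>\<sigma>. arranges \<sigma> (shape t) \<and> draw_with \<sigma> (shape t) = t" if "t \<in> set ts" for t
  proof (rule PNode.IH[OF that])
    show "drawing t" using PNode.prems that by auto
    show "order_leftmost t = t" using ol that ts by (auto simp: map_idI dest: map_eq_conv[THEN iffD1, of _ _ "\<lambda>x. x", simplified])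
  qed
  then obtain s where s: "\<And>t. t \<in> set ts \<Longrightarrow> arranges (s t) (shape t) \<and> draw_with (s t) (shape t) = t" by metis
  have ll: "least_label x \<noteq> least_label y" "\<forall>t\<in>set zs. least_label x < least_label t \<and> least_label y < least_label t"
    using PNode.prems(1) ch(1,4) ts by auto
  have sk: "sorted_key_list_of_set least_label (set ts) = x # y # sort_key least_label zs"
  proof -
    have "distinct (map least_label zs)" using ch(1,4) ts by (auto simp: distinct_map)
    then have "sorted_wrt (<) (map least_label (sort_key least_label zs))"
      by (simp add: strict_sorted_iff distinct_map)
    then have "sorted_wrt (<) (map least_label (x # y # sort_key least_label zs))" using ol(1) ll by auto
    moreover have "length (x # y # sort_key least_label zs) = card (set ts)" using distinct_card[OF ch(1)] ts by simp
    ultimately show ?thesis using sorted_key_list_of_set_inj[OF ch(4), of "x # y # sort_key least_label zs"] ts by simp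
  qed
  obtain \<tau> where \<tau>: "\<tau> permutes {1..length (sort_key least_label zs)}"
      "layout \<tau> (x # y # sort_key least_label zs) = x # y # zs"
    by (rule layout_surj[of zs "sort_key least_label zs"]) simp
  \<comment> \<open>The permutations chosen for the children can be glued, because each branch point
    below the top one occurs in exactly one child.\<close>
  define \<sigma> where "\<sigma> v = (if v = Node ?F then \<tau> else s (THE t. t \<in> set ts \<and> v \<in> subtrees (shape t)) v)" for v
  have \<sigma>: "\<sigma> v = s t v" if "t \<in> set ts" "v \<in> branch_points (shape t)" for t v
  proof -
    have v: "v \<in> subtrees (shape t)" using that by (simp add: branch_points_def)
    then have "v \<noteq> Node ?F" using Node_notin_subtrees[OF tr, of "shape t"] that by (auto simp: fset_of_list_elem)
    moreover have "(THE t. t \<in> set ts \<and> v \<in> subtrees (shape t)) = t"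
    proof (rule the_equality)
      fix t' assume t': "t' \<in> set ts \<and> v \<in> subtrees (shape t')"
      then have "shape t' = shape t"
        using subtrees_children_disjoint[OF tr _ _ _ v] that by (auto simp: fset_of_list_elem)
      then show "t' = t" using ch(2) t' that by (auto dest: inj_onD)
    qed (use that v in auto)
    ultimately show ?thesis by (simp add: \<sigma>_def)
  qed
  have dw: "draw_with \<sigma> (shape t) = t" if "t \<in> set ts" for t
    using draw_with_cong[of "shape t" \<sigma> "s t"] \<sigma>[OF that] s[OF that] by simp
  have "arranges \<sigma> (Node ?F)"
    unfolding arranges_def branch_points_Node
  proof (intro ballI, elim insertE UN_E)
    fix v t assume t: "t \<in> fset ?F" "v \<in> branch_points t"
    then obtain t' where t': "t = shape t'" "t' \<in> set ts" by (auto simp: fset_of_list_elem)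
    then show "\<sigma> v permutes {1..fcard (children v) - 2}"
      using \<sigma>[OF t'(2)] s[OF t'(2)] t by (simp add: arranges_def)
  next
    fix v assume "v = Node ?F"
    then show "\<sigma> v permutes {1..fcard (children v) - 2}" using \<tau>(1) ch(3) ts by (simp add: \<sigma>_def)
  qed
  moreover have "draw_with \<sigma> (Node ?F) = PNode ts"
  proof -
    have "fset (draw_with \<sigma> |`| ?F) = set ts" using dw by (simp add: fset_shape image_image del: fset_of_list_map)
    then have "sorted_children \<sigma> ?F = x # y # sort_key least_label zs" using sk by (simp add: sorted_children_def)
    then show ?thesis unfolding draw_with_Node using \<tau>(2) ts by (simp add: \<sigma>_def)
  qed
  ultimately show ?case by auto
qed

lemma semiplanar_trees_iff:
  "(t, \<sigma>) \<in> semiplanar_trees A \<longleftrightarrow>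
    is_tree t \<and> leaf_labels t = A \<and> arranges \<sigma> t \<and> \<sigma> \<in> extensional (branch_points t)"
  by (auto simp: semiplanar_trees_def labelled_trees_def arranges_def PiE_iff)

text \<open>This makes \<open>read_off\<close> an inverse of \<open>draw\<close> up to
  normalisation, so that everything can be computed on drawings. Injectivity uses that the
  permutations are extensional.\<close>

lemma draw_bij:
  "bij_betw draw (semiplanar_trees A) {p. drawing p \<and> order_leftmost p = p \<and> plabels p = A}"
  unfolding bij_betw_def
proof
  show "inj_on draw (semiplanar_trees A)"
  proof (rule inj_onI)
    fix s s' assume *: "s \<in> semiplanar_trees A" "s' \<in> semiplanar_trees A" "draw s = draw s'"
    obtain t \<sigma> t' \<sigma>' where s: "s = (t, \<sigma>)" "s' = (t', \<sigma>')" by (metis surj_pair)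
    note p = *(1)[unfolded s semiplanar_trees_iff] *(2)[unfolded s semiplanar_trees_iff]
    have e: "draw_with \<sigma> t = draw_with \<sigma>' t'" using *(3) s by (simp add: draw_def)
    have "t = t'" using e draw_with_props[of t \<sigma>] draw_with_props[of t' \<sigma>'] p by metis
    moreover have "\<sigma> = \<sigma>'"
      using p e \<open>t = t'\<close> draw_with_inj[of t \<sigma> \<sigma>'] by (intro extensionalityI[of _ "branch_points t"]) auto
    ultimately show "s = s'" using s by simp
  qed
  show "draw ` semiplanar_trees A = {p. drawing p \<and> order_leftmost p = p \<and> plabels p = A}"
  proof (intro equalityI subsetI)
    fix p assume "p \<in> draw ` semiplanar_trees A"
    then show "p \<in> {p. drawing p \<and> order_leftmost p = p \<and> plabels p = A}"
      using draw_with_props by (auto simp: draw_def semiplanar_trees_iff)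
  next
    fix p assume p: "p \<in> {p. drawing p \<and> order_leftmost p = p \<and> plabels p = A}"
    then obtain \<sigma> where \<sigma>: "arranges \<sigma> (shape p)" "draw_with \<sigma> (shape p) = p" using draw_with_surj by auto
    let ?\<sigma> = "restrict \<sigma> (branch_points (shape p))"
    have "draw_with ?\<sigma> (shape p) = p" using draw_with_cong[of "shape p" ?\<sigma> \<sigma>] \<sigma> by simp
    moreover have "(shape p, ?\<sigma>) \<in> semiplanar_trees A"
      using \<sigma> p drawing_is_tree by (auto simp: semiplanar_trees_iff arranges_def)
    ultimately show "p \<in> draw ` semiplanar_trees A" by (force simp: draw_def)
  qed
qed

lemma draw_props:
  assumes "s \<in> semiplanar_trees A"
  shows "drawing (draw s)" "order_leftmost (draw s) = draw s" "plabels (draw s) = A" "shape (draw s) = proj s"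
proof -
  show "drawing (draw s)" "order_leftmost (draw s) = draw s" "plabels (draw s) = A"
    using bij_betwE[OF draw_bij, of A] assms by auto
  obtain t \<sigma> where "s = (t, \<sigma>)" by (metis surj_pair)
  then show "shape (draw s) = proj s"
    using assms draw_with_props[of t \<sigma>] by (auto simp: semiplanar_trees_iff draw_def proj_def)
qed

lemma read_off_props:
  assumes "drawing p"
  shows "read_off p \<in> semiplanar_trees (plabels p)" "draw (read_off p) = order_leftmost p"
proof -
  have p: "order_leftmost p \<in> draw ` semiplanar_trees (plabels p)"
    using draw_bij[of "plabels p"] drawing_order_leftmost[OF assms] by (auto simp: bij_betw_def)
  then show "read_off p \<in> semiplanar_trees (plabels p)" unfolding read_off_def
    using bij_betw_imp_inj_on[OF draw_bij] by (intro the_inv_into_into) auto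
  show "draw (read_off p) = order_leftmost p" unfolding read_off_def
    using bij_betw_imp_inj_on[OF draw_bij] p by (intro f_the_inv_into_f) auto
qed

lemma read_off_draw: "s \<in> semiplanar_trees A \<Longrightarrow> read_off (draw s) = s"
  unfolding read_off_def using draw_props[of s A] bij_betw_imp_inj_on[OF draw_bij]
  by (simp add: the_inv_into_f_f)

lemma read_off_order_leftmost [simp]: "read_off (order_leftmost p) = read_off p"
  by (simp add: read_off_def)

lemma shape_order_leftmost [simp]: "shape (order_leftmost p) = shape p"
proof (induction p)
  case (PNode ts)
  have "fset_of_list (map shape (take 2 us)) |\<union>| fset_of_list (map shape (drop 2 us)) = fset_of_list (map shape us)" for us :: "nat ptree list"
    by (metis append_take_drop_id map_append fset_of_list_append)
  then show ?case using PNode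
    by (cases ts rule: list_cases2) (auto simp: order_leftmost_PNode order_leftmost_short cong: map_cong)
qed simp

lemma proj_read_off: "drawing p \<Longrightarrow> proj (read_off p) = shape p"
  using draw_props(4)[OF read_off_props(1)] read_off_props(2) by simp

section \<open>Locations\<close>

lemma canonical_iff:
  assumes "drawing (PNode (x # y # zs))"
  shows "order_leftmost (PNode (x # y # zs)) = PNode (x # y # zs) \<longleftrightarrow>
    (\<forall>t\<in>set (x # y # zs). order_leftmost t = t) \<and> least_label x \<le> least_label y"
proof -
  have "map order_leftmost zs = zs \<longleftrightarrow> (\<forall>t\<in>set zs. order_leftmost t = t)"
    by (induction zs) auto
  moreover have "least_label x = least_label y" if "order_leftmost y = x" using that by auto
  ultimately show ?thesis by (auto simp: order_leftmost_PNode)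
qed

text \<open>The largest label changes no least label, so an insertion result needs no reordering and
  is recovered by \<open>draw\<close> after \<open>read_off\<close>.\<close>

lemma grown_canonical:
  "grown j p q \<Longrightarrow> drawing p \<Longrightarrow> \<forall>k\<in>plabels p. k < j \<Longrightarrow> order_leftmost p = p \<Longrightarrow> order_leftmost q = q"
proof (induction rule: grown.induct)
  case (above p)
  have "drawing (PNode [p, PLeaf j])" by (rule grown_drawing[OF grown.above above(1,2)])
  moreover have "least_label p \<le> j" using above least_label_in by fastforce
  ultimately show ?case using above canonical_iff[of p "PLeaf j" "[]"] by simp
next
  case (at us vs)
  then obtain x y zs where us: "us = x # y # zs" by (cases us rule: list_cases2) auto
  have d: "drawing (PNode (us @ PLeaf j # vs))" by (rule grown_drawing[OF grown.at at(2,3)]) fact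
  show ?case using canonical_iff[of x y "zs @ PLeaf j # vs"] canonical_iff[of x y "zs @ vs"] d at us by auto
next
  case (below v q us vs)
  have d: "drawing (PNode (us @ q # vs))" by (rule grown_drawing[OF grown.below[OF below.hyps] below.prems(1,2)])
  obtain x y zs where ts: "us @ v # vs = x # y # zs" using below.prems(1) by (cases "us @ v # vs" rule: list_cases2) auto
  obtain x' y' zs' where ts': "us @ q # vs = x' # y' # zs'" using d by (cases "us @ q # vs" rule: list_cases2) auto
  have c: "(\<forall>t\<in>set (us @ v # vs). order_leftmost t = t) \<and> least_label x \<le> least_label y"
    using canonical_iff[of x y zs] below.prems ts by simp
  have dv: "drawing v" "\<forall>k\<in>plabels v. k < j" using below.prems by auto
  have "map least_label (us @ q # vs) = map least_label (us @ v # vs)"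
    using grown_least_label[OF below.hyps dv] by simp
  then have "least_label x' = least_label x" "least_label y' = least_label y" unfolding ts ts' by auto
  moreover have "order_leftmost q = q" using below.IH dv c by auto
  ultimately have "(\<forall>t\<in>set (us @ q # vs). order_leftmost t = t) \<and> least_label x' \<le> least_label y'" using c by auto
  then show ?case using canonical_iff[of x' y' zs'] d ts' by simp
qed

lemma subtrees_shape_PNode:
  "subtrees (shape (PNode ts)) = insert (shape (PNode ts)) (\<Union>t\<in>set ts. subtrees (shape t))"
  by (auto simp: fset_of_list.rep_eq)

lemma pmodify_at_id: "v \<notin> subtrees (shape p) \<Longrightarrow> pmodify_at v f p = p"
proof (induction p)
  case (PNode ts)
  then have "map (pmodify_at v f) ts = ts" unfolding subtrees_shape_PNode by (intro map_idI) auto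
  then show ?case using PNode.prems unfolding subtrees_shape_PNode by auto
qed auto

lemma locations_Leaf [simp]: "locations (Leaf i) = {(Edge (Leaf i), 0)}"
  by (auto simp: locations_def)

lemma locations_Node:
  "locations (Node F) = insert (Edge (Node F), 0)
    (Pair (Branch (Node F)) ` {1..fcard F - 1} \<union> (\<Union>t\<in>fset F. locations t))"
  by (auto simp: locations_def branch_points_Node)

primrec site_tree :: "site \<Rightarrow> nat ltree" where
  "site_tree (Edge v) = v"
| "site_tree (Branch v) = v"

lemma locations_site_tree: "(x, l) \<in> locations t \<Longrightarrow> site_tree x \<in> subtrees t"
  by (auto simp: locations_def branch_points_def)

text \<open>Locations fibred over sites, the form in which they are compared with non-planar
  insertion.\<close>

lemma locations_eq_Sigma:
  "locations t = (SIGMA x:ins t. case x of Edge v \<Rightarrow> {0} | Branch v \<Rightarrow> {1..fcard (children v) - 1})"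
  by (auto simp: locations_def ins_def)

lemma finite_ins [simp]: "finite (ins t)"
  by (simp add: ins_def)

lemma finite_locations [simp]: "finite (locations t)"
  unfolding locations_eq_Sigma by (intro finite_SigmaI) (auto split: site.splits)

text \<open>The site is found by shape, and a shape occurring in one child occurs neither in another
  child nor as the whole tree.\<close>

lemma pinsert_child:
  assumes d: "drawing (PNode ts)" and t: "t \<in> set ts" and x: "(x, l) \<in> locations (shape t)"
  shows "pinsert j x l (PNode ts) = PNode (map (\<lambda>s. if s = t then pinsert j x l t else s) ts)"
proof -
  let ?F = "fset_of_list (map shape ts)"
  have tr: "is_tree (Node ?F)" using drawing_is_tree[OF d] by simp
  have x': "site_tree x \<in> subtrees (shape t)" by (rule locations_site_tree[OF x])
  have "shape (PNode ts) \<noteq> site_tree x"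
    using Node_notin_subtrees[OF tr, of "shape t"] x' t by (auto simp: fset_of_list_elem)
  moreover have "pmodify_at (site_tree x) f s = s" if "s \<in> set ts" "s \<noteq> t" for f s
  proof (rule pmodify_at_id)
    have "shape s \<noteq> shape t" using drawing_children(2)[OF d] that t by (auto dest: inj_onD)
    then show "site_tree x \<notin> subtrees (shape s)"
      using subtrees_children_disjoint[OF tr _ _ x', of "shape s"] that t
      by (auto simp: fset_of_list_elem)
  qed
  ultimately show ?thesis by (cases x) auto
qed

lemma grown_pinsert:
  "drawing p \<Longrightarrow> (x, l) \<in> locations (shape p) \<Longrightarrow> grown j p (pinsert j x l p)"
proof (induction p)
  case (PLeaf i)
  then show ?case using grown.above[of j "PLeaf i"] by simp
next
  case (PNode ts)
  let ?F = "fset_of_list (map shape ts)"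
  consider "x = Edge (Node ?F)" "l = 0" | "x = Branch (Node ?F)" "l \<in> {1..length ts - 1}"
    | t where "t \<in> set ts" "(x, l) \<in> locations (shape t)"
    using PNode.prems(2) drawing_children(3)[OF PNode.prems(1)]
    unfolding shape.simps locations_Node fset_shape by auto
  then show ?case
  proof cases
    case 1
    then show ?thesis using grown.above[of j "PNode ts"] by simp
  next
    case 2
    have "grown j (PNode (take (l + 1) ts @ drop (l + 1) ts)) (PNode (take (l + 1) ts @ PLeaf j # drop (l + 1) ts))"
      using 2 by (intro grown.at) auto
    then show ?thesis using 2 by simp
  next
    case (3 t)
    obtain us vs where ts: "ts = us @ t # vs" using 3(1) by (meson split_list)
    have "t \<notin> set us" "t \<notin> set vs" using drawing_children(1)[OF PNode.prems(1)] ts by auto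
    then have "map (\<lambda>s. if s = t then pinsert j x l t else s) ts = us @ pinsert j x l t # vs"
      unfolding ts by (auto intro!: map_idI)
    then show ?thesis
      unfolding pinsert_child[OF PNode.prems(1) 3] using PNode 3 ts by (auto intro: grown.below)
  qed
qed

lemma shape_pmodify_at:
  "(\<And>s. shape s = v \<Longrightarrow> shape (f s) = g v) \<Longrightarrow> shape (pmodify_at v f p) = modify_at v g (shape p)"
proof (induction p)
  case (PNode ts)
  have "map shape (map (pmodify_at v f) ts) = map (modify_at v g) (map shape ts)" using PNode by auto
  then have "fset_of_list (map shape (map (pmodify_at v f) ts)) = modify_at v g |`| fset_of_list (map shape ts)"
    by (simp only: fset_of_list_map)
  then show ?case using PNode.prems[of "PNode ts"] by simp
qed auto

lemma shape_pinsert: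
  assumes "(x, l) \<in> locations t"
  shows "shape (pinsert j x l p) = insert_leaf j x (shape p)"
proof (cases x)
  case (Edge v)
  then show ?thesis
    unfolding Edge pinsert.simps insert_leaf.simps by (intro shape_pmodify_at) (auto simp: finsert_commute)
next
  case (Branch v)
  then have v: "\<not> is_leaf v" using assms by (auto simp: locations_def branch_points_def)
  show ?thesis unfolding Branch pinsert.simps insert_leaf.simps
  proof (intro shape_pmodify_at)
    fix s assume s: "shape s = v"
    obtain us where us: "s = PNode us" using s v by (cases s) auto
    have "set us = set (take (l + 1) us) \<union> set (drop (l + 1) us)" by (metis append_take_drop_id set_append)
    then show "shape (PNode (take (l + 1) (psubs s) @ [PLeaf j] @ drop (l + 1) (psubs s))) =
        Node (finsert (Leaf j) (children v))"
      unfolding s[symmetric] us by (auto simp: fset_eq_iff fset_of_list_elem image_Un)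
  qed
qed

section \<open>The down-step on semi-planar trees\<close>

lemma delete_leaf_map:
  assumes "inj f"
  shows "delete_leaf (f i) (map_ptree f p) = map_ptree f (delete_leaf i p)"
proof (induction p)
  case (PNode ts)
  have inj: "map_ptree f s = PLeaf (f i) \<longleftrightarrow> s = PLeaf i" for s
    using inj_eq[OF assms] by (cases s) auto
  have "filter (\<lambda>s. s \<noteq> PLeaf (f i)) (map (delete_leaf (f i)) (map (map_ptree f) ts)) =
      map (map_ptree f) (filter (\<lambda>s. s \<noteq> PLeaf i) (map (delete_leaf i) ts))"
    using PNode inj by (induction ts) auto
  then show ?case by (auto simp: delete_leaf_PNode Let_def length_Suc_conv)
qed simp

definition close_gap :: "nat \<Rightarrow> nat \<Rightarrow> nat" where
  "close_gap m k = (if k > m then k - 1 else k)"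

text \<open>Swapping two labels and deleting the second one amounts to deleting the first one and renaming.\<close>

lemma down_eq:
  "down i s = read_off (map_ptree (close_gap (kill_label i (draw s)))
     (relabel i (kill_label i (draw s)) (delete_leaf i (draw s))))"
proof -
  let ?k = "kill_label i (draw s)"
  have "delete_leaf ?k (relabel i ?k (draw s)) = relabel i ?k (delete_leaf i (draw s))"
    using delete_leaf_map[of "Transposition.transpose i ?k" i "draw s"] by simp
  then show ?thesis by (simp add: down_def Let_def kill_label_def close_gap_def[abs_def])
qed

lemma close_gap_strict_mono: "m \<notin> A \<Longrightarrow> strict_mono_on A (close_gap m)"
proof (rule strict_mono_onI)
  fix r s assume "m \<notin> A" "r \<in> A" "s \<in> A" "r < s"
  then have "r \<noteq> m" "s \<noteq> m" by auto
  then show "close_gap m r < close_gap m s" using \<open>r < s\<close> by (auto simp: close_gap_def)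
qed

lemma drawing_close_gap_down:
  assumes "drawing p" "i \<in> plabels p" "p \<noteq> PLeaf i" "plabels p = {1..n}"
  defines "p' \<equiv> map_ptree (close_gap (kill_label i p)) (relabel i (kill_label i p) (delete_leaf i p))"
  shows "drawing p'" "plabels p' = {1..n - 1}"
proof -
  let ?k = "kill_label i p"
  have k: "?k \<in> {1..n}" using kill_label_in[OF assms(1-3)] assms(4) by simp
  have l: "plabels (relabel i ?k (delete_leaf i p)) = {1..n} - {?k}"
    using plabels_down[OF assms(1-3)] k assms(4) by simp
  have d: "drawing (relabel i ?k (delete_leaf i p))" by (rule drawing_down[OF assms(1-3)])
  show "drawing p'" unfolding p'_def
    by (rule drawing_map[OF d]) (use l in \<open>auto intro!: close_gap_strict_mono\<close>)
  have "close_gap ?k ` ({1..n} - {?k}) = {1..n - 1}"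
  proof (intro equalityI subsetI)
    fix a assume "a \<in> {1..n - 1}"
    then show "a \<in> close_gap ?k ` ({1..n} - {?k})" using k
      by (intro image_eqI[of _ _ "if a < ?k then a else a + 1"]) (auto simp: close_gap_def)
  qed (use k in \<open>auto simp: close_gap_def\<close>)
  then show "plabels p' = {1..n - 1}" unfolding p'_def plabels_map[of "close_gap ?k"] l .
qed

lemma down_in:
  assumes s: "s \<in> semiplanar_trees {1..n}" and "2 \<le> n" "i \<in> {1..n}"
  shows "down i s \<in> semiplanar_trees {1..n - 1}"
    "draw (down i s) = order_leftmost (map_ptree (close_gap (kill_label i (draw s)))
     (relabel i (kill_label i (draw s)) (delete_leaf i (draw s))))"
proof -
  note p = draw_props[OF s]
  have "draw s \<noteq> PLeaf i"
  proof
    assume "draw s = PLeaf i"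
    then have "card {1..n} = 1" using p(3) by (metis is_singletonI is_singleton_altdef ptree.set(1))
    then show False using assms by simp
  qed
  moreover have "i \<in> plabels (draw s)" using p assms by simp
  ultimately have "drawing (map_ptree (close_gap (kill_label i (draw s)))
     (relabel i (kill_label i (draw s)) (delete_leaf i (draw s))))" "plabels (map_ptree (close_gap (kill_label i (draw s)))
     (relabel i (kill_label i (draw s)) (delete_leaf i (draw s)))) = {1..n - 1}"
    using drawing_close_gap_down[OF p(1) _ _ p(3)] by blast+
  then show "down i s \<in> semiplanar_trees {1..n - 1}"
    "draw (down i s) = order_leftmost (map_ptree (close_gap (kill_label i (draw s)))
     (relabel i (kill_label i (draw s)) (delete_leaf i (draw s))))"
    unfolding down_eq using read_off_props by metis+
qed

section \<open>From sums over locations to recursive insertion sums\<close>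

context insertion_weights begin

lemma loc_sum_index:
  "loc_sum j F zs = (\<Sum>m\<le>length zs. (if m = length zs then \<alpha> - \<gamma> else \<alpha>) * F (take m zs @ PLeaf j # drop m zs))"
  by (induction zs arbitrary: F) (simp_all add: sum.atMost_Suc_shift del: sum.atMost_Suc)

lemma ins_sums_distinct:
  "distinct ts \<Longrightarrow> ins_sums j F ts = (\<Sum>t\<in>set ts. ins_sum j (\<lambda>s. F (map (\<lambda>u. if u = t then s else u) ts)) t)"
proof (induction ts arbitrary: F)
  case (Cons y ys)
  have "map (\<lambda>u. if u = y then s else u) ys = ys" for s using Cons.prems by (intro map_idI) auto
  moreover have "(if y = t then s else y) = y" if "t \<in> set ys" for t s using Cons.prems that by auto
  ultimately show ?case using Cons by (simp cong: sum.cong)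
qed simp

text \<open>Locations split into the edge above the tree, those at its top branch point and those in
  the children, which are disjoint because children share no subtrees. These are the three summands
  of \<open>ins_sum_PNode\<close>.\<close>

lemma ins_sum_locations:
  "drawing p \<Longrightarrow> (\<Sum>(x, l)\<in>locations (shape p). semiplanar_weight \<alpha> \<gamma> x l * f (pinsert j x l p)) = ins_sum j f p"
proof (induction p arbitrary: f)
  case (PNode ts)
  let ?F = "fset_of_list (map shape ts)" and ?p = "PNode ts"
  let ?g = "\<lambda>(x, l). semiplanar_weight \<alpha> \<gamma> x l * f (pinsert j x l ?p)"
  note ch = drawing_children[OF PNode.prems]
  have tr: "is_tree (Node ?F)" using drawing_is_tree[OF PNode.prems] by simp
  obtain x y zs where ts: "ts = x # y # zs" using PNode.prems by (cases ts rule: list_cases2) auto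
  let ?A = "Pair (Branch (Node ?F)) ` {1..fcard ?F - 1}" and ?B = "\<Union>t\<in>fset ?F. locations t"
  have nB: "(z, l) \<notin> ?B" if "site_tree z = Node ?F" for z l
    using Node_notin_subtrees[OF tr] locations_site_tree that by (metis UN_E)
  have "?A \<inter> ?B = {}" using nB by auto
  moreover have "(Edge (Node ?F), 0) \<notin> ?A \<union> ?B" using nB by auto
  ultimately have split: "sum ?g (locations (Node ?F)) = ?g (Edge (Node ?F), 0) + (sum ?g ?A + sum ?g ?B)"
    unfolding locations_Node by (subst sum.insert) (auto simp: sum.union_disjoint)
  have 1: "?g (Edge (Node ?F), 0) = \<gamma> * f (PNode [?p, PLeaf j])" by simp
  have 2: "sum ?g ?A = locs_sum j (\<lambda>u. f (PNode u)) ts"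
  proof -
    have "sum ?g ?A = (\<Sum>l\<in>{1..Suc (length zs)}. ?g (Branch (Node ?F), l))"
      using ch(3) ts by (subst sum.reindex) (auto simp: inj_on_def)
    \<comment> \<open>Locations count from 1, the positions in \<open>loc_sum_index\<close> from
      0.\<close>
    also have "{1..Suc (length zs)} = Suc ` {..length zs}" by (auto simp: image_iff Suc_le_eq gr0_conv_Suc intro: Suc_pred[symmetric])
    also have "(\<Sum>l\<in>Suc ` {..length zs}. ?g (Branch (Node ?F), l)) = (\<Sum>m\<le>length zs. ?g (Branch (Node ?F), Suc m))"
      by (subst sum.reindex) auto
    also have "\<dots> = (\<Sum>m\<le>length zs. (if m = length zs then \<alpha> - \<gamma> else \<alpha>) * f (PNode (x # y # take m zs @ PLeaf j # drop m zs)))"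
      using ch(3) ts by (intro sum.cong) auto
    also have "\<dots> = locs_sum j (\<lambda>u. f (PNode u)) ts" by (simp add: locs_sum_def ts loc_sum_index numeral_2_eq_2)
    finally show ?thesis .
  qed
  have "sum ?g ?B = (\<Sum>t\<in>fset ?F. sum ?g (locations t))"
  proof (rule sum.UNION_disjoint)
    show "\<forall>s\<in>fset ?F. \<forall>t\<in>fset ?F. s \<noteq> t \<longrightarrow> locations s \<inter> locations t = {}"
    proof (intro ballI impI equals0I)
      fix s t z assume st: "s \<in> fset ?F" "t \<in> fset ?F" "s \<noteq> t" "z \<in> locations s \<inter> locations t"
      obtain a l where "z = (a, l)" by (cases z)
      then have "site_tree a \<in> subtrees s" "site_tree a \<in> subtrees t" using st(4) locations_site_tree by auto
      then show False using subtrees_children_disjoint[OF tr, of s t] st by auto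
    qed
  qed auto
  also have "\<dots> = (\<Sum>t\<in>set ts. sum ?g (locations (shape t)))"
    unfolding fset_shape using ch(2) by (subst sum.reindex) auto
  also have "\<dots> = (\<Sum>t\<in>set ts. ins_sum j (\<lambda>s. f (PNode (map (\<lambda>u. if u = t then s else u) ts))) t)"
  proof (rule sum.cong[OF refl])
    fix t assume t: "t \<in> set ts"
    have "sum ?g (locations (shape t)) = (\<Sum>(x, l)\<in>locations (shape t). semiplanar_weight \<alpha> \<gamma> x l *
       f (PNode (map (\<lambda>u. if u = t then pinsert j x l t else u) ts)))"
      using pinsert_child[OF PNode.prems t] by (intro sum.cong) auto
    also have "\<dots> = ins_sum j (\<lambda>s. f (PNode (map (\<lambda>u. if u = t then s else u) ts))) t"
      using PNode t by simp
    finally show "sum ?g (locations (shape t)) = \<dots>" .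
  qed
  also have "\<dots> = ins_sums j (\<lambda>u. f (PNode u)) ts" using ins_sums_distinct[OF ch(1), of j "\<lambda>u. f (PNode u)"] by simp
  finally show ?case using split 1 2 unfolding ins_sum_PNode by simp
qed simp

end

section \<open>The growth kernels\<close>

lemma embed_pmf_finite:
  fixes f :: "'a \<Rightarrow> real"
  assumes "finite A" "\<And>x. x \<in> A \<Longrightarrow> 0 \<le> f x" "sum f A = 1"
  shows "pmf (embed_pmf (\<lambda>x. if x \<in> A then f x else 0)) x = (if x \<in> A then f x else 0)"
proof (rule pmf_embed_pmf)
  have "(\<integral>\<^sup>+x. ennreal (if x \<in> A then f x else 0) \<partial>count_space UNIV) = (\<Sum>x\<in>A. ennreal (if x \<in> A then f x else 0))"
    using assms by (intro nn_integral_count_space') auto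
  also have "\<dots> = ennreal (sum f A)" using assms(2) by (subst sum_ennreal[symmetric]) auto
  finally show "(\<integral>\<^sup>+x. ennreal (if x \<in> A then f x else 0) \<partial>count_space UNIV) = 1" using assms(3) by simp
qed (use assms in auto)

lemma embed_pmf_finite_expectation:
  fixes f h :: "'a \<Rightarrow> real"
  assumes "finite A" "\<And>x. x \<in> A \<Longrightarrow> 0 \<le> f x" "sum f A = 1"
  shows "measure_pmf.expectation (embed_pmf (\<lambda>x. if x \<in> A then f x else 0)) h = (\<Sum>x\<in>A. f x * h x)"
    "set_pmf (embed_pmf (\<lambda>x. if x \<in> A then f x else 0)) \<subseteq> A"
proof -
  note p = embed_pmf_finite[of A f, OF assms]
  show s: "set_pmf (embed_pmf (\<lambda>x. if x \<in> A then f x else 0)) \<subseteq> A"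
    using p by (auto simp: set_pmf_iff split: if_splits)
  show "measure_pmf.expectation (embed_pmf (\<lambda>x. if x \<in> A then f x else 0)) h = (\<Sum>x\<in>A. f x * h x)"
    using s p by (subst integral_measure_pmf_real[of A]) (auto simp: assms(1) mult.commute)
qed

section \<open>Trees with one or two leaves; finiteness\<close>

lemma drawing_singleton: "drawing p \<Longrightarrow> plabels p = {a} \<Longrightarrow> p = PLeaf a"
proof (cases p)
  case (PNode ts)
  assume "drawing p" "plabels p = {a}"
  moreover from this obtain x y zs where ts: "ts = x # y # zs" using PNode by (cases ts rule: list_cases2) auto
  ultimately have "drawing x" "drawing y" "plabels x \<subseteq> {a}" "plabels y \<subseteq> {a}" "plabels x \<inter> plabels y = {}"
    using PNode by auto
  then show ?thesis using drawing_plabels_nonempty[of x] drawing_plabels_nonempty[of y] by blast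
qed simp

lemma semiplanar_trees_1: "\<exists>e. semiplanar_trees {1..1} = {e}"
proof -
  have "{p. drawing p \<and> order_leftmost p = p \<and> plabels p = {1..1}} = {PLeaf 1}"
    using drawing_singleton by auto
  then have "card (semiplanar_trees {1..1}) = 1" using bij_betw_same_card[OF draw_bij, of "{1..1}"] by simp
  then show ?thesis by (simp add: card_1_singleton_iff)
qed

lemma semiplanar_trees_2: "\<exists>e. semiplanar_trees {1..2} = {e}"
proof -
  have "p = PNode [PLeaf 1, PLeaf 2]" if p: "drawing p" "order_leftmost p = p" "plabels p = {1..2}" for p
  proof -
    have "{1..2} = {1, 2 :: nat}" by auto
    then have l: "plabels p = {1, 2}" by (simp only: p(3))
    obtain ts where ts: "p = PNode ts" using l by (cases p) auto
    obtain x y zs where ts': "ts = x # y # zs" using p(1) ts by (cases ts rule: list_cases2) auto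
    have o: "least_label x \<le> least_label y" using canonical_iff p ts ts' by blast
    have d: "drawing x" "drawing y" "plabels x \<inter> plabels y = {}" "\<forall>z\<in>set zs. drawing z \<and> plabels x \<inter> plabels z = {} \<and> plabels y \<inter> plabels z = {}"
      using p(1) ts ts' by auto
    note ll = least_label_in[OF d(1)] least_label_in[OF d(2)]
    have u: "plabels x \<union> plabels y \<union> (\<Union>z\<in>set zs. plabels z) = {1, 2}" using l ts ts' by auto
    then have "least_label x \<in> {1, 2}" "least_label y \<in> {1, 2}" "least_label x \<noteq> least_label y" using ll d(3) by auto
    then have "least_label x = 1" "least_label y = 2" using o by auto
    then have in12: "1 \<in> plabels x" "2 \<in> plabels y" using ll by auto
    then have "plabels x = {1}" "plabels y = {2}" using u d(3) by auto
    moreover have "zs = []"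
    proof (cases zs)
      case (Cons z zs')
      then have "plabels z \<noteq> {}" using d(4) drawing_plabels_nonempty by auto
      moreover have "plabels z \<subseteq> {1, 2}" using u Cons by auto
      moreover have "1 \<notin> plabels z" "2 \<notin> plabels z" using d(4) in12 Cons by auto
      ultimately show ?thesis by blast
    qed simp
    ultimately show ?thesis using drawing_singleton d(1,2) ts ts' by metis
  qed
  moreover have "drawing (PNode [PLeaf 1, PLeaf 2])" "order_leftmost (PNode [PLeaf 1, PLeaf 2]) = PNode [PLeaf 1, PLeaf 2]"
    by (auto simp: order_leftmost_PNode)
  ultimately have "{p. drawing p \<and> order_leftmost p = p \<and> plabels p = {1..2}} = {PNode [PLeaf 1, PLeaf 2]}"
    by (intro equalityI subsetI) (auto simp: numeral_2_eq_2 atLeastAtMostSuc_conv)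
  then have "card (semiplanar_trees {1..2}) = 1" using bij_betw_same_card[OF draw_bij, of "{1..2}"] by simp
  then show ?thesis by (simp add: card_1_singleton_iff)
qed

text \<open>Every tree carries a semi-planar structure, for instance the identity
  permutations.\<close>

lemma labelled_trees_eq_proj: "labelled_trees A = proj ` semiplanar_trees A"
proof (intro equalityI subsetI)
  fix t assume t: "t \<in> labelled_trees A"
  have "(t, restrict (\<lambda>_. id) (branch_points t)) \<in> semiplanar_trees A"
    using t by (auto simp: semiplanar_trees_def permutes_id)
  then show "t \<in> proj ` semiplanar_trees A" by (force simp: proj_def)
qed (auto simp: semiplanar_trees_def proj_def)

text \<open>Each child misses the labels of some other child, so its labels form a proper subset of
  \<open>A\<close>, to which the induction hypothesis applies.\<close>

lemma finite_labelled_trees: "finite A \<Longrightarrow> finite (labelled_trees A)"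
proof (induction A rule: finite_psubset_induct)
  case (psubset A)
  let ?U = "\<Union>B\<in>{B. B \<subset> A}. labelled_trees B"
  have fin: "finite ?U" using psubset
    by (intro finite_UN_I) (auto intro: finite_subset[of "{B. B \<subset> A}" "Pow A"])
  have "labelled_trees A \<subseteq> Leaf ` A \<union> (\<lambda>X. Node (Abs_fset X)) ` Pow ?U"
  proof
    fix t assume t: "t \<in> labelled_trees A"
    show "t \<in> Leaf ` A \<union> (\<lambda>X. Node (Abs_fset X)) ` Pow ?U"
    proof (cases t)
      case (Node F)
      have tr: "is_tree (Node F)" using t Node by (simp add: labelled_trees_def)
      have "s \<in> ?U" if s: "s |\<in>| F" for s
      proof -
        have sub: "leaf_labels s \<subseteq> A" using t Node s by (auto simp: labelled_trees_def)
        have "\<not> fset F \<subseteq> {s}"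
          using is_tree_NodeD(1)[OF tr] card_mono[of "{s}" "fset F"] by (auto simp: fcard.rep_eq)
        then obtain r where r: "r |\<in>| F" "r \<noteq> s" by auto
        have "leaf_labels r \<noteq> {}" "leaf_labels r \<inter> leaf_labels s = {}" "leaf_labels r \<subseteq> A"
          using r s is_tree_NodeD(2,3)[OF tr] t Node is_tree_leaf_labels_nonempty
          by (auto simp: disjoint_family_on_def labelled_trees_def)
        then have "leaf_labels s \<subset> A" using sub by blast
        moreover have "s \<in> labelled_trees (leaf_labels s)" using is_tree_NodeD(2)[OF tr s] by (simp add: labelled_trees_def)
        ultimately show ?thesis by blast
      qed
      then have "fset F \<in> Pow ?U" by auto
      then have "Node (Abs_fset (fset F)) \<in> (\<lambda>X. Node (Abs_fset X)) ` Pow ?U" by (rule imageI)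
      then show ?thesis using Node by (simp add: fset_inverse)
    qed (use t in \<open>auto simp: labelled_trees_def\<close>)
  qed
  moreover have "finite (Leaf ` A \<union> (\<lambda>X. Node (Abs_fset X)) ` Pow ?U)" using fin psubset by auto
  ultimately show ?case by (rule finite_subset)
qed

lemma finite_semiplanar_trees: "finite A \<Longrightarrow> finite (semiplanar_trees A)"
  unfolding semiplanar_trees_def
  by (intro finite_SigmaI finite_labelled_trees finite_PiE) (auto intro: finite_permutations)

section \<open>The growth kernel, the down-step and the projection\<close>

locale alpha_gamma = insertion_weights +
  assumes gamma_nonneg: "0 \<le> \<gamma>" and gamma_le: "\<gamma> \<le> \<alpha>" and alpha_le: "\<alpha> \<le> 1"
begin

abbreviation "G \<equiv> semiplanar_growth_step \<alpha> \<gamma>"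
abbreviation S :: "nat \<Rightarrow> semiplanar set" where "S n \<equiv> semiplanar_trees {1..n}"

lemma semiplanar_weight_nonneg: "0 \<le> semiplanar_weight \<alpha> \<gamma> x l"
  using gamma_nonneg gamma_le alpha_le by (cases x) auto

definition loc_weight :: "nat \<Rightarrow> site \<times> nat \<Rightarrow> real" where
  "loc_weight n = (\<lambda>(x, l). semiplanar_weight \<alpha> \<gamma> x l / (real n - \<alpha>))"

definition loc_pmf :: "nat \<Rightarrow> nat ltree \<Rightarrow> (site \<times> nat) pmf" where
  "loc_pmf n t = embed_pmf (\<lambda>y. if y \<in> locations t then loc_weight n y else 0)"

lemma G_eq: "2 \<le> n \<Longrightarrow> G n s = map_pmf (\<lambda>(x, l). semiplanar_insert (n + 1) x l s) (loc_pmf n (proj s))"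
  unfolding semiplanar_growth_step_def loc_pmf_def loc_weight_def
  by (auto intro!: arg_cong[where f = "map_pmf _"] arg_cong[where f = embed_pmf])

lemma loc_weight_props:
  assumes "2 \<le> n" "s \<in> S n"
  shows "\<And>y. y \<in> locations (proj s) \<Longrightarrow> 0 \<le> loc_weight n y" "sum (loc_weight n) (locations (proj s)) = 1"
proof -
  have pos: "0 < real n - \<alpha>" using assms(1) alpha_le by simp
  show "0 \<le> loc_weight n y" for y
    using pos semiplanar_weight_nonneg by (auto simp: loc_weight_def split: prod.split)
  note p = draw_props[OF assms(2)]
  have "sum (loc_weight n) (locations (proj s)) =
      (\<Sum>(x, l)\<in>locations (shape (draw s)). semiplanar_weight \<alpha> \<gamma> x l * 1) / (real n - \<alpha>)"
    unfolding p(4) by (simp add: loc_weight_def case_prod_unfold sum_divide_distrib)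
  also have "\<dots> = (card {1..n} - \<alpha>) / (real n - \<alpha>)"
    using ins_sum_locations[OF p(1), of "\<lambda>_. 1" "n + 1"] ins_sum_total[OF p(1), of "n + 1"] p(3) by simp
  finally show "sum (loc_weight n) (locations (proj s)) = 1" using pos by simp
qed

lemma insert_grown:
  assumes "2 \<le> n" "s \<in> S n" "(x, l) \<in> locations (proj s)"
  shows "semiplanar_insert (n + 1) x l s = read_off (pinsert (n + 1) x l (draw s))"
    "grown (n + 1) (draw s) (pinsert (n + 1) x l (draw s))"
  using assms draw_props[OF assms(2)] by (auto simp: semiplanar_insert_def intro!: grown_pinsert)

lemma grown_read_off:
  assumes "s \<in> S n" "grown (n + 1) (draw s) q"
  shows "drawing q" "draw (read_off q) = q" "read_off q \<in> S (n + 1)" "plabels q = {1..n + 1}"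
proof -
  note p = draw_props[OF assms(1)]
  have j: "\<forall>k\<in>plabels (draw s). k < n + 1" using p(3) by auto
  show d: "drawing q" by (rule grown_drawing[OF assms(2) p(1) j])
  then show "draw (read_off q) = q"
    using read_off_props(2)[OF d] grown_canonical[OF assms(2) p(1) j p(2)] by simp
  show l: "plabels q = {1..n + 1}" using grown_plabels[OF assms(2)] p(3) by auto
  show "read_off q \<in> S (n + 1)" using read_off_props(1)[OF d] l by simp
qed

lemma G_expectation:
  assumes "2 \<le> n" "s \<in> S n"
  shows "measure_pmf.expectation (G n s) f = ins_sum (n + 1) (\<lambda>q. f (read_off q)) (draw s) / (real n - \<alpha>)"
proof -
  note p = draw_props[OF assms(2)]
  have "measure_pmf.expectation (G n s) f =
     (\<Sum>y\<in>locations (proj s). loc_weight n y * f (case y of (x, l) \<Rightarrow> semiplanar_insert (n + 1) x l s))"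
    unfolding G_eq[OF assms(1)] loc_pmf_def integral_map_pmf
    using loc_weight_props[OF assms] by (intro embed_pmf_finite_expectation(1)) auto
  also have "\<dots> = (\<Sum>(x, l)\<in>locations (shape (draw s)). semiplanar_weight \<alpha> \<gamma> x l * f (read_off (pinsert (n + 1) x l (draw s)))) / (real n - \<alpha>)"
    unfolding p(4) sum_divide_distrib using insert_grown(1)[OF assms]
    by (intro sum.cong) (auto simp: loc_weight_def)
  also have "\<dots> = ins_sum (n + 1) (\<lambda>q. f (read_off q)) (draw s) / (real n - \<alpha>)"
    using ins_sum_locations[OF p(1), of "\<lambda>q. f (read_off q)"] by simp
  finally show ?thesis .
qed

lemma G_grown:
  assumes "2 \<le> n" "s \<in> S n" "z \<in> set_pmf (G n s)"
  obtains q where "grown (n + 1) (draw s) q" "z = read_off q"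
proof -
  have "set_pmf (loc_pmf n (proj s)) \<subseteq> locations (proj s)"
    unfolding loc_pmf_def using loc_weight_props[OF assms(1,2)] by (intro embed_pmf_finite_expectation(2)) auto
  then obtain x l where "(x, l) \<in> locations (proj s)" "z = semiplanar_insert (n + 1) x l s"
    using assms(3) unfolding G_eq[OF assms(1)] by auto
  then show thesis using that insert_grown[OF assms(1,2)] by metis
qed

lemma G_1: "set_pmf (G 1 s) = S 2"
proof -
  obtain e where e: "S 2 = {e}" using semiplanar_trees_2 by blast
  show ?thesis unfolding semiplanar_growth_step_def e by simp
qed

lemma G_in:
  assumes "1 \<le> n" "s \<in> S n"
  shows "set_pmf (G n s) \<subseteq> S (n + 1)"
proof (cases "n = 1")
  case True
  then show ?thesis using G_1[of s] by (simp add: numeral_2_eq_2)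
next
  case False
  then have "2 \<le> n" using assms(1) by simp
  then show ?thesis using G_grown[OF _ assms(2)] grown_read_off(3)[OF assms(2)] by blast
qed

text \<open>The killed label is at least the selected one, so the largest leaf is killed itself, and
  deletion undoes the insertion.\<close>

lemma down_top:
  assumes "1 \<le> n" "s \<in> S n" "z \<in> set_pmf (G n s)"
  shows "down (n + 1) z = s"
proof (cases "n = 1")
  case True
  have "z \<in> S (n + 1)" using G_in assms by blast
  then have "down (n + 1) z \<in> S (n + 1 - 1)" using True by (intro down_in(1)) auto
  then show ?thesis using semiplanar_trees_1 assms(2) True by auto
next
  case False
  then have "2 \<le> n" using assms(1) by simp
  then obtain q where q: "grown (n + 1) (draw s) q" "z = read_off q" using G_grown assms(2,3) by blast
  note g = grown_read_off[OF assms(2) q(1)] and p = draw_props[OF assms(2)]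
  have nl: "q \<noteq> PLeaf (n + 1)" by (rule grown_not_PLeaf[OF q(1)])
  have "kill_label (n + 1) q \<in> {1..n + 1}" "n + 1 \<le> kill_label (n + 1) q"
    using kill_label_in[OF g(1) _ nl] g(4) by (auto simp: kill_label_def)
  then have k: "kill_label (n + 1) q = n + 1" by simp
  have "delete_leaf (n + 1) q = draw s" using grown_delete_leaf[OF q(1) p(1)] p(3) by simp
  moreover have "map_ptree (close_gap (n + 1)) (draw s) = draw s"
    using p(3) by (intro ptree.map_ident_strong) (auto simp: close_gap_def)
  ultimately show ?thesis
    unfolding down_eq q(2) g(2) k using read_off_draw[OF assms(2)] by (simp add: ptree.map_id)
qed

lemma G_down:
  assumes n: "2 \<le> n" and s: "s \<in> S n" and i: "i \<in> {1..n}"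
  shows "measure_pmf.expectation (G n s) (\<lambda>z. f (down i z)) =
    f s / (real n - \<alpha>) + (real n - 1 - \<alpha>) / (real n - \<alpha>) * measure_pmf.expectation (G (n - 1) (down i s)) f"
proof -
  have pos: "0 < real n - \<alpha>" using n alpha_le by simp
  note p = draw_props[OF s] and ds = down_in[OF s n i]
  let ?p = "draw s" and ?j = "n + 1"
  let ?k = "kill_label i ?p"
  show ?thesis
  proof (cases "n = 2")
    \<comment> \<open>Here \<open>G 1\<close> is the unique possible step rather than a weighted
      one. As there is only one tree with two leaves, the identity reads 1 = 1 / (2 - \<alpha>) + (1
      - \<alpha>) / (2 - \<alpha>).\<close>
    case True
    obtain e where e: "S 2 = {e}" using semiplanar_trees_2 by blast
    have "f (down i z) = f s" if "z \<in> set_pmf (G n s)" for z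
    proof -
      have "z \<in> S (n + 1)" using G_in[OF _ s] n that by auto
      then have "down i z \<in> S (n + 1 - 1)" using i n by (intro down_in(1)) auto
      then show ?thesis using s e True by simp
    qed
    then have "measure_pmf.expectation (G n s) (\<lambda>z. f (down i z)) = measure_pmf.expectation (G n s) (\<lambda>z. f s)"
      by (intro integral_cong_AE) (auto simp: AE_measure_pmf_iff)
    moreover have "measure_pmf.expectation (G 1 (down i s)) f = f s"
      using e s True by (simp add: semiplanar_growth_step_def)
    moreover have "f s / (2 - \<alpha>) + (2 - 1 - \<alpha>) / (2 - \<alpha>) * f s = (2 - \<alpha>) * f s / (2 - \<alpha>)"
      by (simp add: add_divide_distrib[symmetric] algebra_simps)
    ultimately show ?thesis using True pos by simp
  next
    case False
    then have n3: "3 \<le> n" using n by simp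
    \<comment> \<open>What remains of the down-step once \<open>i\<close> is deleted and the killed
      label \<open>m\<close> is known.\<close>
    define h where "h m q = f (read_off (map_ptree (close_gap m) (relabel i m q)))" for m q
    have j: "\<forall>k\<in>plabels ?p. k < ?j" using p(3) by auto
    have nl: "?p \<noteq> PLeaf i"
    proof
      assume "?p = PLeaf i"
      then have "{1..n} = {i}" using p(3) by simp
      then have "card {1..n} = 1" by simp
      then show False using n by simp
    qed
    have ip: "i \<in> plabels ?p" using i p(3) by simp
    have k: "?k \<in> {1..n}" using kill_label_in[OF p(1) ip nl] p(3) by simp
    have hsw: "h ?j q = h ?j q'" if "swapped ?j q q'" for q q'
    proof -
      let ?f = "close_gap ?j \<circ> Transposition.transpose i ?j"
      \<comment> \<open>\<open>close_gap ?j\<close> sends \<open>?j\<close> and its successor to the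
        same number; up to \<open>?j\<close> it is the identity.\<close>
      have "inj_on ?f {..?j}"
        using i by (auto simp: inj_on_def close_gap_def Transposition.transpose_def split: if_splits)
      from swapped_order_leftmost[OF that this]
      have "read_off (map_ptree ?f q) = read_off (map_ptree ?f q')" by (metis read_off_order_leftmost)
      then show ?thesis by (simp add: h_def ptree.map_comp)
    qed
    have "measure_pmf.expectation (G n s) (\<lambda>z. f (down i z)) =
        ins_sum ?j (\<lambda>q. f (down i (read_off q))) ?p / (real n - \<alpha>)"
      by (rule G_expectation[OF n s])
    also have "ins_sum ?j (\<lambda>q. f (down i (read_off q))) ?p = ins_sum ?j (\<lambda>q. h (kill_label i q) (delete_leaf i q)) ?p"
      using grown_read_off[OF s] by (intro ins_sum_cong(1)) (simp add: down_eq h_def)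
    also have "\<dots> = h ?j (relabel i ?j ?p) + ins_sum ?j (h ?k) (delete_leaf i ?p)"
      by (rule ins_sum_down[where h = h, OF p(1) ip nl j hsw])
    also have "h ?j (relabel i ?j ?p) = f s"
    proof -
      have "relabel i ?j (relabel i ?j ?p) = ?p" by (simp add: ptree.map_comp ptree.map_id)
      moreover have "map_ptree (close_gap ?j) ?p = ?p"
        using p(3) by (intro ptree.map_ident_strong) (auto simp: close_gap_def)
      ultimately show ?thesis using read_off_draw[OF s] by (simp add: h_def)
    qed
    also have "ins_sum ?j (h ?k) (delete_leaf i ?p) = (real n - 1 - \<alpha>) * measure_pmf.expectation (G (n - 1) (down i s)) f"
    proof -
      let ?\<rho> = "close_gap ?k \<circ> Transposition.transpose i ?k"
      let ?q = "map_ptree (close_gap ?k) (relabel i ?k (delete_leaf i ?p))"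
      \<comment> \<open>Both \<open>i\<close> and the killed label are at most \<open>n\<close>, so
        the renaming takes the inserted \<open>n + 1\<close> to \<open>n\<close>: inserting
        \<open>n + 1\<close> before it is inserting \<open>n\<close> after it.\<close>
      have r: "?\<rho> ?j = n" using k i by (auto simp: close_gap_def Transposition.transpose_def)
      have "ins_sum ?j (h ?k) (delete_leaf i ?p) = ins_sum ?j (\<lambda>q. f (read_off (map_ptree ?\<rho> q))) (delete_leaf i ?p)"
        by (intro ins_sum_cong(1)) (simp add: h_def ptree.map_comp)
      also have "\<dots> = ins_sum n (\<lambda>q. f (read_off q)) ?q"
        using ins_sum_map[of ?\<rho> ?j "\<lambda>q. f (read_off q)" "delete_leaf i ?p"] r by (simp add: ptree.map_comp)
      also have "\<dots> = ins_sum n (\<lambda>q. f (read_off q)) (order_leftmost ?q)"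
        using drawing_close_gap_down[OF p(1) ip nl p(3)]
        by (intro ins_sum_order_leftmost[symmetric]) auto
      also have "\<dots> = (real (n - 1) - \<alpha>) * measure_pmf.expectation (G (n - 1) (down i s)) f"
        using G_expectation[OF _ ds(1), of f] ds(2) n3 alpha_le by (simp add: of_nat_diff)
      finally show ?thesis using n3 by (simp add: of_nat_diff)
    qed
    finally show ?thesis by (simp add: add_divide_distrib)
  qed
qed

text \<open>At a branch point with \<open>c\<close> children, (c - 2) \<alpha> + (\<alpha> -
  \<gamma>) = (c - 1) \<alpha> - \<gamma>.\<close>

lemma semiplanar_weight_sum:
  assumes "is_tree t" "x \<in> ins t"
  shows "(\<Sum>l\<in>(case x of Edge v \<Rightarrow> {0} | Branch v \<Rightarrow> {1..fcard (children v) - 1}). semiplanar_weight \<alpha> \<gamma> x l) = weight \<alpha> \<gamma> x"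
proof (cases x)
  case (Branch v)
  then have "is_tree v" "\<not> is_leaf v" using assms subtrees_is_tree by (auto simp: ins_def branch_points_def)
  then have "2 \<le> fcard (children v)" using is_tree_NodeD(1) by (cases v) auto
  then obtain m where m: "fcard (children v) = Suc (Suc m)" by (metis add_2_eq_Suc le_Suc_ex)
  have "(\<Sum>l\<in>{1..Suc m}. if l = Suc m then \<alpha> - \<gamma> else \<alpha>) = real m * \<alpha> + (\<alpha> - \<gamma>)"
    by simp
  then show ?thesis using Branch m by (simp add: algebra_simps)
qed simp

text \<open>The location within a site does not influence the projected tree, and the weights of the
  locations of a site add up to its non-planar weight. So the law of the projected next state
  depends on the projection alone.\<close>

lemma proj_G:
  assumes "1 \<le> n" "s \<in> S n"
  shows "map_pmf proj (G n s) = growth_step \<alpha> \<gamma> n (proj s)"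
proof (cases "n = 1")
  case True
  obtain e where "S 2 = {e}" using semiplanar_trees_2 by blast
  then show ?thesis using True by (simp add: semiplanar_growth_step_def growth_step_def labelled_trees_eq_proj)
next
  case False
  then have n: "2 \<le> n" using assms(1) by simp
  have pos: "0 < real n - \<alpha>" using n alpha_le by simp
  let ?t = "proj s"
  note p = draw_props[OF assms(2)] and w = loc_weight_props[OF n assms(2)]
  have tr: "is_tree ?t" using drawing_is_tree[OF p(1)] p(4) by simp
  let ?w = "\<lambda>x. weight \<alpha> \<gamma> x / (real n - \<alpha>)"
  let ?I = "embed_pmf (\<lambda>x. if x \<in> ins ?t then ?w x else 0)"
  have fib: "(\<Sum>y\<in>locations ?t. loc_weight n y * g (fst y)) = (\<Sum>x\<in>ins ?t. ?w x * g x)" for g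
  proof -
    have "(\<Sum>y\<in>locations ?t. loc_weight n y * g (fst y)) =
      (\<Sum>x\<in>ins ?t. \<Sum>l\<in>(case x of Edge v \<Rightarrow> {0} | Branch v \<Rightarrow> {1..fcard (children v) - 1}). semiplanar_weight \<alpha> \<gamma> x l * (g x / (real n - \<alpha>)))"
      unfolding locations_eq_Sigma
      by (subst sum.Sigma) (auto simp: loc_weight_def split: site.splits intro!: sum.cong)
    also have "\<dots> = (\<Sum>x\<in>ins ?t. ?w x * g x)"
      using semiplanar_weight_sum[OF tr] by (intro sum.cong) (simp_all add: sum_distrib_right[symmetric] sum_divide_distrib[symmetric])
    finally show ?thesis .
  qed
  have nonneg: "0 \<le> ?w x" if "x \<in> ins ?t" for x
    using pos semiplanar_weight_sum[OF tr that] semiplanar_weight_nonneg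
    by (intro divide_nonneg_pos) (metis sum_nonneg)+
  have sum: "sum ?w (ins ?t) = 1" using fib[of "\<lambda>_. 1"] w(2) by simp
  have "map_pmf fst (loc_pmf n ?t) = ?I"
  proof (rule pmf_eqI)
    fix x
    have "pmf (map_pmf fst (loc_pmf n ?t)) x = measure_pmf.expectation (loc_pmf n ?t) (indicator (fst -` {x}))"
      by (simp add: pmf_map)
    also have "\<dots> = (\<Sum>y\<in>locations ?t. loc_weight n y * indicator (fst -` {x}) y)"
      unfolding loc_pmf_def using w by (intro embed_pmf_finite_expectation(1)) auto
    also have "\<dots> = (\<Sum>y\<in>locations ?t. loc_weight n y * (if fst y = x then 1 else 0))"
      by (intro sum.cong) (auto simp: indicator_def)
    also have "\<dots> = (\<Sum>x'\<in>ins ?t. ?w x' * (if x' = x then 1 else 0))"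
      by (rule fib)
    also have "\<dots> = (if x \<in> ins ?t then ?w x else 0)"
      by (simp add: if_distrib[of "\<lambda>a. _ * a"] cong: if_cong)
    also have "\<dots> = pmf ?I x" using embed_pmf_finite[of "ins ?t" ?w] nonneg sum by simp
    finally show "pmf (map_pmf fst (loc_pmf n ?t)) x = pmf ?I x" .
  qed
  then have "growth_step \<alpha> \<gamma> n ?t = map_pmf (\<lambda>y. insert_leaf (n + 1) (fst y) ?t) (loc_pmf n ?t)"
    using n by (simp add: growth_step_def map_pmf_comp flip: \<open>_ = ?I\<close>)
  moreover have "map_pmf proj (G n s) = map_pmf (\<lambda>y. insert_leaf (n + 1) (fst y) ?t) (loc_pmf n ?t)"
    unfolding G_eq[OF n] map_pmf_comp
  proof (intro map_pmf_cong refl)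
    fix y assume "y \<in> set_pmf (loc_pmf n ?t)"
    moreover have "set_pmf (loc_pmf n ?t) \<subseteq> locations ?t"
      unfolding loc_pmf_def using w by (intro embed_pmf_finite_expectation(2)) auto
    moreover obtain x l where y: "y = (x, l)" by (cases y)
    ultimately have xl: "(x, l) \<in> locations ?t" by auto
    have "proj (semiplanar_insert (n + 1) x l s) = shape (pinsert (n + 1) x l (draw s))"
      using insert_grown[OF n assms(2) xl] grown_read_off[OF assms(2)] proj_read_off by metis
    also have "\<dots> = insert_leaf (n + 1) x ?t" using shape_pinsert[OF xl] p(4) by simp
    finally show "proj (case y of (x, l) \<Rightarrow> semiplanar_insert (n + 1) x l s) = insert_leaf (n + 1) (fst y) ?t"
      using y by simp
  qed
  ultimately show ?thesis by simp
qed

end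

section \<open>The limit theorem\<close>

lemma markov_process_law_pmf:
  assumes M: "markov_process M 1 S K X" and fin: "\<And>k. finite (S k)" and S1: "S 1 = {e}"
    and L: "L 1 = return_pmf e" "\<And>k. 1 \<le> k \<Longrightarrow> L (Suc k) = bind_pmf (L k) (K k)"
    and L_in: "\<And>k. 1 \<le> k \<Longrightarrow> set_pmf (L k) \<subseteq> S k" and k: "1 \<le> k"
  shows "\<P>(\<omega> in M. X k \<omega> = y) = pmf (L k) y"
  using k
proof (induction k arbitrary: y rule: dec_induct)
  case base
  interpret prob_space M using M by (simp add: markov_process_def)
  have X1: "X 1 \<in> M \<rightarrow>\<^sub>M count_space (S 1)" using M by (simp add: markov_process_def)
  have "X 1 \<omega> = e" if "\<omega> \<in> space M" for \<omega>
    using measurable_space[OF X1 that] unfolding S1 by simp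
  then have "{\<omega> \<in> space M. X 1 \<omega> = y} = (if y = e then space M else {})" by auto
  then show ?case using L(1) by (simp add: prob_space)
next
  case (step k)
  have "\<P>(\<omega> in M. X (Suc k) \<omega> = y) = (\<Sum>x\<in>S k. pmf (L k) x * pmf (K k x) y)"
    using markov_process_law[OF M fin] step by simp
  then show ?case using pmf_bind_sum[OF fin L_in, of k "K k" y] L(2) step by simp
qed

theorem theorem4p6:
  fixes \<alpha> \<gamma> :: real and n :: nat
    and M :: "'u measure" and N :: "'v measure" and L :: "'w measure"
    and chain :: "nat \<Rightarrow> 'u \<Rightarrow> semiplanar"
    and That :: "nat \<Rightarrow> 'v \<Rightarrow> semiplanar"
    and T :: "nat \<Rightarrow> 'w \<Rightarrow> nat ltree"
  assumes "0 \<le> \<gamma>" and "\<gamma> \<le> \<alpha>" and "\<alpha> \<le> 1" and "1 \<le> n"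
    and "semiplanar_chain \<alpha> \<gamma> n M chain"
    and "semiplanar_growth_process \<alpha> \<gamma> N That"
    and "growth_process \<alpha> \<gamma> L T"
  shows "converges_in_distribution M chain N (That n) \<and>
    distr N (count_space (labelled_trees {1..n})) (\<lambda>\<omega>. proj (That n \<omega>)) =
      distr L (count_space (labelled_trees {1..n})) (T n)"
proof
  interpret alpha_gamma \<alpha> \<gamma> using assms(1-3) by unfold_locales
  obtain e1 where e1: "S 1 = {e1}" using semiplanar_trees_1 by blast
  obtain e2 where e2: "S 2 = {e2}" using semiplanar_trees_2 by blast
  have finS: "finite (S k)" for k by (simp add: finite_semiplanar_trees)
  interpret du: down_up S G down \<alpha> e1 e2
  proof
    show "measure_pmf.expectation (G n s) (\<lambda>q. f (down i q)) = f s / (real n - \<alpha>) +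
        (real n - 1 - \<alpha>) / (real n - \<alpha>) * measure_pmf.expectation (G (n - 1) (down i s)) f"
      if "2 \<le> n" "i \<in> {1..n}" "s \<in> S n" for n i s f
      by (rule G_down[OF that(1,3,2)])
  qed (use finS e1 e2 alpha_le G_in down_in(1) down_top in auto)
  have M: "markov_process M 0 (\<lambda>_. S n) (\<lambda>_. du.chain n) chain"
    using assms(5) by (simp add: semiplanar_chain_def chain_step_def[abs_def] du.chain_def[abs_def])
  have N: "markov_process N 1 S G That" using assms(6) by (simp add: semiplanar_growth_process_def)
  have L: "markov_process L 1 (\<lambda>k. labelled_trees {1..k}) (growth_step \<alpha> \<gamma>) T"
    using assms(7) by (simp add: growth_process_def)
  have law1: "du.law 1 = return_pmf e1" by simp
  have law_Suc: "du.law (Suc k) = bind_pmf (du.law k) (G k)" if "1 \<le> k" for k using that by simp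
  have That: "\<P>(\<omega> in N. That n \<omega> = y) = pmf (du.law n) y" for y
    by (rule markov_process_law_pmf[where L = du.law, OF N finS e1 law1 law_Suc du.law_in assms(4)])
  \<comment> \<open>\<open>T\<close> lives on its own probability space and is compared through its
    laws only. The projected laws obey the recursion of the growth process because
    \<open>proj\<close> intertwines the two kernels.\<close>
  have T: "\<P>(\<omega> in L. T n \<omega> = t) = pmf (map_pmf proj (du.law n)) t" for t
  proof (rule markov_process_law_pmf[where L = "\<lambda>k. map_pmf proj (du.law k)", OF L _ _ _ _ _ assms(4)])
    show "labelled_trees {1..1} = {proj e1}" using e1 by (simp add: labelled_trees_eq_proj)
    show "map_pmf proj (du.law 1) = return_pmf (proj e1)" by simp
    show "map_pmf proj (du.law (Suc k)) = bind_pmf (map_pmf proj (du.law k)) (growth_step \<alpha> \<gamma> k)"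
      if "1 \<le> k" for k
    proof -
      have "map_pmf proj (du.law (Suc k)) = bind_pmf (du.law k) (\<lambda>s. map_pmf proj (G k s))"
        unfolding law_Suc[OF that] by (rule map_bind_pmf)
      also have "\<dots> = bind_pmf (du.law k) (\<lambda>s. growth_step \<alpha> \<gamma> k (proj s))"
        using du.law_in[OF that] proj_G[OF that] by (intro bind_pmf_cong) auto
      finally show ?thesis by (simp add: bind_map_pmf)
    qed
    show "set_pmf (map_pmf proj (du.law k)) \<subseteq> labelled_trees {1..k}" if "1 \<le> k" for k
      using du.law_in[OF that] by (auto simp: labelled_trees_eq_proj)
  qed (simp add: finite_labelled_trees)
  show "converges_in_distribution M chain N (That n)"
    unfolding converges_in_distribution_def
  proof (intro allI impI)
    fix f :: "semiplanar \<Rightarrow> real"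
    \<comment> \<open>The initial law is arbitrary: the marginal laws enter through their recursion
      and their total mass.\<close>
    have "(\<lambda>m. \<P>(\<omega> in M. chain m \<omega> = y)) \<longlonglongrightarrow> pmf (du.law n) y" if "y \<in> S n" for y
    proof (rule du.chain_converges[OF assms(4) _ _ that])
      show "\<P>(\<omega> in M. chain (Suc m) \<omega> = y) = (\<Sum>x\<in>S n. \<P>(\<omega> in M. chain m \<omega> = x) * pmf (du.chain n x) y)" for m y
        by (rule markov_process_law[OF M finS]) simp
      show "(\<Sum>x\<in>S n. \<P>(\<omega> in M. chain m \<omega> = x)) = 1" for m
      proof -
        interpret prob_space M using M by (simp add: markov_process_def)
        show ?thesis using markov_process_prob_sum[OF M finS, of m "\<lambda>_. 1"] prob_space by simp
      qed
    qed
    then have "(\<lambda>m. \<Sum>y\<in>S n. \<P>(\<omega> in M. chain m \<omega> = y) * f y) \<longlonglongrightarrow> (\<Sum>y\<in>S n. pmf (du.law n) y * f y)"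
      by (intro tendsto_sum tendsto_mult_right) auto
    then show "(\<lambda>m. \<integral>\<omega>. f (chain m \<omega>) \<partial>M) \<longlonglongrightarrow> (\<integral>\<omega>. f (That n \<omega>) \<partial>N)"
      using markov_process_prob_sum[OF M finS, of _ f] markov_process_prob_sum[OF N finS assms(4), of f] That
      by simp
  qed
  show "distr N (count_space (labelled_trees {1..n})) (\<lambda>\<omega>. proj (That n \<omega>)) =
      distr L (count_space (labelled_trees {1..n})) (T n)"
  proof (rule measure_eqI_finite)
    interpret N: prob_space N using N by (simp add: markov_process_def)
    interpret L: prob_space L using L by (simp add: markov_process_def)
    have mT: "T n \<in> L \<rightarrow>\<^sub>M count_space (labelled_trees {1..n})"
      using L assms(4) by (simp add: markov_process_def)
    have mN: "(\<lambda>\<omega>. proj (That n \<omega>)) \<in> N \<rightarrow>\<^sub>M count_space (labelled_trees {1..n})"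
    proof -
      have 1: "That n \<in> N \<rightarrow>\<^sub>M count_space (S n)" using N assms(4) by (simp add: markov_process_def)
      have 2: "proj \<in> count_space (S n) \<rightarrow>\<^sub>M count_space (labelled_trees {1..n})"
        by (auto simp: labelled_trees_eq_proj)
      show ?thesis by (rule measurable_compose[OF 1 2])
    qed
    fix t assume t: "t \<in> labelled_trees {1..n}"
    then have t': "{t} \<in> sets (count_space (labelled_trees {1..n}))" by simp
    have "\<P>(\<omega> in N. proj (That n \<omega>) = t) = (\<integral>\<omega>. indicator {t} (proj (That n \<omega>)) \<partial>N)"
    proof -
      have "{\<omega> \<in> space N. proj (That n \<omega>) = t} = (\<lambda>\<omega>. proj (That n \<omega>)) -` {t} \<inter> space N" by auto
      then have "{\<omega> \<in> space N. proj (That n \<omega>) = t} \<in> sets N"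
        using measurable_sets[OF mN, of "{t}"] t by simp
      then have "\<P>(\<omega> in N. proj (That n \<omega>) = t) = (\<integral>\<omega>. indicator {\<omega> \<in> space N. proj (That n \<omega>) = t} \<omega> \<partial>N)"
        by simp
      also have "\<dots> = (\<integral>\<omega>. indicator {t} (proj (That n \<omega>)) \<partial>N)"
        by (intro Bochner_Integration.integral_cong) (auto simp: indicator_def)
      finally show ?thesis .
    qed
    also have "\<dots> = (\<Sum>s\<in>S n. pmf (du.law n) s * indicator {t} (proj s))"
      using markov_process_prob_sum[OF N finS assms(4), of "\<lambda>s. indicator {t} (proj s)"] That by simp
    also have "\<dots> = measure_pmf.expectation (du.law n) (\<lambda>s. indicator {t} (proj s))"
      using du.law_in[OF assms(4)] by (subst integral_measure_pmf_real[OF finS]) (auto simp: mult.commute)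
    also have "(\<lambda>s. indicat_real {t} (proj s)) = indicator (proj -` {t})" by (auto simp: indicator_def)
    also have "measure_pmf.expectation (du.law n) \<dots> = \<P>(\<omega> in L. T n \<omega> = t)" unfolding T by (simp add: pmf_map)
    finally have "measure N ((\<lambda>\<omega>. proj (That n \<omega>)) -` {t} \<inter> space N) = measure L (T n -` {t} \<inter> space L)"
      by (simp add: vimage_def Int_def conj_commute)
    then show "emeasure (distr N (count_space (labelled_trees {1..n})) (\<lambda>\<omega>. proj (That n \<omega>))) {t} =
        emeasure (distr L (count_space (labelled_trees {1..n})) (T n)) {t}"
      unfolding emeasure_distr[OF mN t'] emeasure_distr[OF mT t'] N.emeasure_eq_measure L.emeasure_eq_measure
      by (rule arg_cong)
  qed (auto simp: finite_labelled_trees)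
qed

end
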